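(* Let $T$ be a locally compact Hausdorff space with a nonzero bounded Radon measure $\mu$, let $\mathfrak{A}$ be a unital $C^*$-algebra of Hilbert space operators, let $\widetilde{A}=(A_t)_{t\in T}$ be a continuous field of self-adjoint operators in $\mathfrak{A}$ and $\widetilde{B}=(B_t)_{t\in T}$ a continuous field of strictly positive operators in $\mathfrak{A}$. Let $f:J\to\mathbb{R}$ be an operator convex function on an interval $J$ such that the spectrum of $B_t^{-1/2}A_tB_t^{-1/2}$ is contained in $J$ for every $t\in T$, and assume that the integrals below exist as Bochner integrals. Put $A=\int_TA_t\,d\mu(t)$ and $B=\int_TB_t\,d\mu(t)$. Then $$g(A,B)\leq\Theta(\widetilde{A},\widetilde{B}),$$ that is, $$B^{1/2}f\left(B^{-1/2}AB^{-1/2}\right)B^{1/2}\leq\int_TB_t^{1/2}f\left(B_t^{-1/2}A_tB_t^{-1/2}\right)B_t^{1/2}\,d\mu(t).$$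
   Context: A bounded operator is positive ($\geq 0$) if $\langle Ax,x\rangle\ge 0$ for all $x$, and strictly positive if positive and invertible; $X\le Y$ means $Y-X\ge 0$. A continuous $f:J\to\mathbb{R}$ is operator convex if $f(\lambda X+(1-\lambda)Y)\le\lambda f(X)+(1-\lambda)f(Y)$ for all self-adjoint operators $X,Y$ (on any Hilbert space) with spectra in $J$ and all $\lambda\in[0,1]$. A unital $C^*$-algebra of operators contains the identity operator. A field $(A_t)_{t\in T}$ in $\mathfrak{A}$ is continuous if $t\mapsto A_t$ is norm continuous. The perspective of $f$ is $g(L,R)=R^{1/2}f(R^{-1/2}LR^{-1/2})R^{1/2}$ for $L$ self-adjoint and $R$ strictly positive (with the spectrum of $R^{-1/2}LR^{-1/2}$ in $J$), and the non-commutative $f$-divergence functional is $\Theta(\widetilde{A},\widetilde{B})=\int_TB_t^{1/2}f(B_t^{-1/2}A_tB_t^{-1/2})B_t^{1/2}\,d\mu(t)$. *)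

theory Defs
  imports "HOL-Analysis.Analysis" "HOL-Computational_Algebra.Polynomial"
begin

section \<open>Complex Hilbert spaces\<close>

text \<open>
  The norm and the metric come from \<open>real_inner\<close>; \<open>inner_eq_Re_cinner\<close> makes them the ones
  induced by the complex inner product, which is linear in its first argument.
\<close>

class complex_hilbert = real_inner + complete_space +
  fixes scaleC :: "complex \<Rightarrow> 'a \<Rightarrow> 'a" (infixr "*\<^sub>C" 75)
    and cinner :: "'a \<Rightarrow> 'a \<Rightarrow> complex"
  assumes scaleC_add_right: "c *\<^sub>C (x + y) = c *\<^sub>C x + c *\<^sub>C y"
    and scaleC_add_left: "(c + d) *\<^sub>C x = c *\<^sub>C x + d *\<^sub>C x"
    and scaleC_scaleC: "c *\<^sub>C d *\<^sub>C x = (c * d) *\<^sub>C x"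
    and scaleC_of_real: "complex_of_real r *\<^sub>C x = r *\<^sub>R x"
    and cinner_commute: "cinner x y = cnj (cinner y x)"
    and cinner_add_left: "cinner (x + y) z = cinner x z + cinner y z"
    and cinner_scaleC_left: "cinner (c *\<^sub>C x) y = c * cinner x y"
    and inner_eq_Re_cinner: "inner x y = Re (cinner x y)"
begin

subclass banach ..

end

lemma norm_scaleC: "norm (c *\<^sub>C x) = cmod c * norm (x :: 'a :: complex_hilbert)"
proof -
  have "cinner (c *\<^sub>C x) (c *\<^sub>C x) = c * cnj c * cinner x x"
    by (metis cinner_commute cinner_scaleC_left complex_cnj_mult mult.assoc mult.commute)
  also have "\<dots> = of_real ((cmod c)\<^sup>2) * cinner x x"
    by (simp only: complex_norm_square)
  finally have "inner (c *\<^sub>C x) (c *\<^sub>C x) = (cmod c)\<^sup>2 * inner x x"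
    by (simp add: inner_eq_Re_cinner)
  thus ?thesis
    by (simp add: norm_eq_sqrt_inner real_sqrt_mult)
qed

lemma bounded_linear_scaleC: "bounded_linear (\<lambda>x :: 'a :: complex_hilbert. c *\<^sub>C x)"
proof (rule bounded_linear_intro[where K = "cmod c"])
  fix r :: real and x :: 'a
  show "c *\<^sub>C r *\<^sub>R x = r *\<^sub>R c *\<^sub>C x"
    by (simp add: scaleC_of_real[symmetric] scaleC_scaleC mult.commute)
qed (simp_all add: scaleC_add_right norm_scaleC mult.commute)

lemma cmod_cinner_le: "cmod (cinner x y) \<le> 2 * (norm x * norm (y :: 'a :: complex_hilbert))"
proof -
  have "\<bar>Re (cinner x y)\<bar> \<le> norm x * norm y"
    by (metis Cauchy_Schwarz_ineq2 inner_eq_Re_cinner)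
  moreover have "Im (cinner x y) = inner ((- \<i>) *\<^sub>C x) y"
    by (simp add: inner_eq_Re_cinner cinner_scaleC_left)
  hence "\<bar>Im (cinner x y)\<bar> \<le> norm x * norm y"
    using Cauchy_Schwarz_ineq2[of "(- \<i>) *\<^sub>C x" y] by (simp add: norm_scaleC)
  ultimately show ?thesis
    using cmod_le[of "cinner x y"] by linarith
qed


section \<open>Bounded operators\<close>

text \<open>
  Bounded operators on \<open>'a\<close> are the complex linear elements of the Banach space of bounded real
  linear maps.
\<close>

type_synonym 'a op = "'a \<Rightarrow>\<^sub>L 'a"

definition complex_linear :: "('a :: complex_hilbert) op \<Rightarrow> bool" where
  "complex_linear X \<longleftrightarrow> (\<forall>c x. blinfun_apply X (c *\<^sub>C x) = c *\<^sub>C blinfun_apply X x)"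

definition scaleC_op :: "complex \<Rightarrow> ('a :: complex_hilbert) op \<Rightarrow> 'a op" where
  "scaleC_op c X = Blinfun (\<lambda>x. c *\<^sub>C blinfun_apply X x)"

lemma scaleC_op_apply: "blinfun_apply (scaleC_op c X) x = c *\<^sub>C blinfun_apply X x"
  unfolding scaleC_op_def
  by (simp add: bounded_linear_Blinfun_apply
      bounded_linear_compose[OF bounded_linear_scaleC blinfun.bounded_linear_right])

definition is_adjoint :: "('a :: complex_hilbert) op \<Rightarrow> 'a op \<Rightarrow> bool" where
  "is_adjoint X Y \<longleftrightarrow> (\<forall>x y. cinner (blinfun_apply X x) y = cinner x (blinfun_apply Y y))"

definition self_adjoint :: "('a :: complex_hilbert) op \<Rightarrow> bool" where
  "self_adjoint X \<longleftrightarrow> complex_linear X \<and> is_adjoint X X"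

definition positive_op :: "('a :: complex_hilbert) op \<Rightarrow> bool" where
  "positive_op X \<longleftrightarrow> complex_linear X \<and> (\<forall>x. cinner (blinfun_apply X x) x \<in> \<real>\<^sub>\<ge>\<^sub>0)"

definition op_le :: "('a :: complex_hilbert) op \<Rightarrow> 'a op \<Rightarrow> bool" (infix "\<le>\<^sub>o\<^sub>p" 50) where
  "X \<le>\<^sub>o\<^sub>p Y \<longleftrightarrow> positive_op (Y - X)"

definition invertible_op :: "('a :: complex_hilbert) op \<Rightarrow> bool" where
  "invertible_op X \<longleftrightarrow>
     (\<exists>Y. complex_linear Y \<and> X o\<^sub>L Y = id_blinfun \<and> Y o\<^sub>L X = id_blinfun)"

definition strictly_positive_op :: "('a :: complex_hilbert) op \<Rightarrow> bool" where
  "strictly_positive_op X \<longleftrightarrow> positive_op X \<and> invertible_op X"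

definition unital_cstar_algebra :: "('a :: complex_hilbert) op set \<Rightarrow> bool" where
  "unital_cstar_algebra \<AA> \<longleftrightarrow>
     (\<forall>X\<in>\<AA>. complex_linear X) \<and>
     id_blinfun \<in> \<AA> \<and>
     (\<forall>X\<in>\<AA>. \<forall>Y\<in>\<AA>. X + Y \<in> \<AA>) \<and>
     (\<forall>c. \<forall>X\<in>\<AA>. scaleC_op c X \<in> \<AA>) \<and>
     (\<forall>X\<in>\<AA>. \<forall>Y\<in>\<AA>. X o\<^sub>L Y \<in> \<AA>) \<and>
     (\<forall>X\<in>\<AA>. \<exists>Y\<in>\<AA>. is_adjoint X Y) \<and>
     closed \<AA>"


section \<open>Spectrum and continuous functional calculus\<close>

text \<open>
  For an orthogonal projection \<open>P\<close>, the range of \<open>P\<close> is a Hilbert space \<open>S\<close> in its own right (every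
  closed subspace arises in this way), and the bounded operators on \<open>S\<close> are identified with the
  operators \<open>X\<close> such that \<open>P X = X = X P\<close>, that is, with their extensions by zero on the orthogonal
  complement of \<open>S\<close>. The identity of \<open>S\<close> is then \<open>P\<close>. Spectrum and functional calculus are
  defined for operators on \<open>S\<close>; the whole space is the case \<open>P = id_blinfun\<close>.
\<close>

definition projection :: "('a :: complex_hilbert) op \<Rightarrow> bool" where
  "projection P \<longleftrightarrow> self_adjoint P \<and> P o\<^sub>L P = P"

definition ops_on :: "('a :: complex_hilbert) op \<Rightarrow> 'a op set" where
  "ops_on P = {X. complex_linear X \<and> P o\<^sub>L X = X \<and> X o\<^sub>L P = X}"

definition spectrum_on :: "('a :: complex_hilbert) op \<Rightarrow> 'a op \<Rightarrow> complex set" where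
  "spectrum_on P X =
     {z. \<not> (\<exists>Y\<in>ops_on P. (X - scaleC_op z P) o\<^sub>L Y = P \<and> Y o\<^sub>L (X - scaleC_op z P) = P)}"

definition op_power_on :: "('a :: complex_hilbert) op \<Rightarrow> 'a op \<Rightarrow> nat \<Rightarrow> 'a op" where
  "op_power_on P X n = ((\<lambda>Y. X o\<^sub>L Y) ^^ n) P"

definition poly_op_on :: "('a :: complex_hilbert) op \<Rightarrow> real poly \<Rightarrow> 'a op \<Rightarrow> 'a op" where
  "poly_op_on P p X = (\<Sum>i\<le>degree p. coeff p i *\<^sub>R op_power_on P X i)"

text \<open>
  \<open>f(X)\<close> for self-adjoint \<open>X\<close> and \<open>f\<close> continuous on the spectrum of \<open>X\<close>: the operator norm limit of
  \<open>p\<^sub>n(X)\<close> for every sequence of real polynomials \<open>p\<^sub>n\<close> converging to \<open>f\<close> uniformly on the spectrum.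
  Such sequences exist by Weierstrass, so the limit is unique. The values of \<open>f\<close> off the spectrum
  are irrelevant.
\<close>

definition fun_calc_on :: "('a :: complex_hilbert) op \<Rightarrow> (real \<Rightarrow> real) \<Rightarrow> 'a op \<Rightarrow> 'a op" where
  "fun_calc_on P f X =
     (THE Y. \<forall>p. uniform_limit {x. complex_of_real x \<in> spectrum_on P X} (\<lambda>n. poly (p n)) f sequentially
               \<longrightarrow> (\<lambda>n. poly_op_on P (p n) X) \<longlonglongrightarrow> Y)"

abbreviation spectrum :: "('a :: complex_hilbert) op \<Rightarrow> complex set" where
  "spectrum \<equiv> spectrum_on id_blinfun"

abbreviation fun_calc :: "(real \<Rightarrow> real) \<Rightarrow> ('a :: complex_hilbert) op \<Rightarrow> 'a op" where
  "fun_calc \<equiv> fun_calc_on id_blinfun"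

text \<open>Meaningful for strictly positive \<open>R\<close>: the spectrum then lies in the open half-line.\<close>

definition op_powr :: "('a :: complex_hilbert) op \<Rightarrow> real \<Rightarrow> 'a op" where
  "op_powr R a = fun_calc (\<lambda>x. x powr a) R"


section \<open>Square summable sequences\<close>

text \<open>
  HOL cannot quantify over all Hilbert spaces inside a formula. The Hilbert spaces over which
  operator convexity quantifies will be the closed subspaces of the Hilbert space \<open>'a ell2\<close> of square
  summable sequences in \<open>'a\<close>. If \<open>'a\<close> is nonzero these are, up to unitary equivalence, all Hilbert
  spaces of dimension at most \<open>max(\<aleph>\<^sub>0, dim 'a)\<close>; among them are \<open>'a\<close>, its finite direct sums, all
  finite-dimensional Hilbert spaces and all separable ones.
\<close>

lemma ell2_add:
  fixes x y :: "nat \<Rightarrow> 'a :: real_inner"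
  assumes "summable (\<lambda>n. (norm (x n))\<^sup>2)" "summable (\<lambda>n. (norm (y n))\<^sup>2)"
  shows "summable (\<lambda>n. (norm (x n + y n))\<^sup>2)"
proof (rule summable_comparison_test')
  show "summable (\<lambda>n. 2 * (norm (x n))\<^sup>2 + 2 * (norm (y n))\<^sup>2)"
    by (intro summable_add summable_mult assms)
  fix n
  have "(norm (x n + y n))\<^sup>2 \<le> (norm (x n) + norm (y n))\<^sup>2"
    by (intro power_mono norm_triangle_ineq norm_ge_zero)
  also have "\<dots> \<le> 2 * (norm (x n))\<^sup>2 + 2 * (norm (y n))\<^sup>2"
    using sum_squares_bound[of "norm (x n)" "norm (y n)"] by (simp add: power2_sum)
  finally show "norm ((norm (x n + y n))\<^sup>2) \<le> 2 * (norm (x n))\<^sup>2 + 2 * (norm (y n))\<^sup>2"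
    by simp
qed

lemma ell2_norm_mult:
  fixes x y :: "nat \<Rightarrow> 'a :: real_normed_vector"
  assumes "summable (\<lambda>n. (norm (x n))\<^sup>2)" "summable (\<lambda>n. (norm (y n))\<^sup>2)"
  shows "summable (\<lambda>n. norm (x n) * norm (y n))"
proof (rule summable_comparison_test')
  show "summable (\<lambda>n. (norm (x n))\<^sup>2 + (norm (y n))\<^sup>2)"
    by (intro summable_add assms)
  fix n
  show "norm (norm (x n) * norm (y n)) \<le> (norm (x n))\<^sup>2 + (norm (y n))\<^sup>2"
  proof -
    have "2 * (norm (x n) * norm (y n)) \<le> (norm (x n))\<^sup>2 + (norm (y n))\<^sup>2"
      using sum_squares_bound[of "norm (x n)" "norm (y n)"] by (simp add: mult.assoc)
    moreover have nonneg: "0 \<le> norm (x n) * norm (y n)"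
      by (intro mult_nonneg_nonneg norm_ge_zero)
    ultimately show ?thesis
      unfolding real_norm_def abs_of_nonneg[OF nonneg] by linarith
  qed
qed

typedef (overloaded) ('a :: complex_hilbert) ell2 = "{x :: nat \<Rightarrow> 'a. summable (\<lambda>n. (norm (x n))\<^sup>2)}"
  by (rule exI[of _ "\<lambda>_. 0"]) simp

setup_lifting type_definition_ell2

instantiation ell2 :: (complex_hilbert) real_vector
begin

lift_definition zero_ell2 :: "'a ell2" is "\<lambda>_. 0"
  by simp

lift_definition plus_ell2 :: "'a ell2 \<Rightarrow> 'a ell2 \<Rightarrow> 'a ell2" is "\<lambda>x y n. x n + y n"
  by (rule ell2_add)

lift_definition uminus_ell2 :: "'a ell2 \<Rightarrow> 'a ell2" is "\<lambda>x n. - x n"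
  by simp

lift_definition minus_ell2 :: "'a ell2 \<Rightarrow> 'a ell2 \<Rightarrow> 'a ell2" is "\<lambda>x y n. x n - y n"
  subgoal for x y using ell2_add[of x "\<lambda>n. - y n"] by simp
  done

lift_definition scaleR_ell2 :: "real \<Rightarrow> 'a ell2 \<Rightarrow> 'a ell2" is "\<lambda>r x n. r *\<^sub>R x n"
  by (simp add: power_mult_distrib summable_mult)

instance
  by standard (transfer; simp add: fun_eq_iff algebra_simps)+

end

lemma ell2_summable: "summable (\<lambda>n. (norm (Rep_ell2 x n))\<^sup>2)"
  using Rep_ell2[of x] by simp

lemma ell2_summable_inner: "summable (\<lambda>n. inner (Rep_ell2 x n) (Rep_ell2 y n))"
  by (rule summable_comparison_test'[OF ell2_norm_mult[OF ell2_summable[of x] ell2_summable[of y]]])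
    (simp add: Cauchy_Schwarz_ineq2)

lemma ell2_summable_cinner: "summable (\<lambda>n. cinner (Rep_ell2 x n) (Rep_ell2 y n))"
  by (rule summable_comparison_test'[OF
        summable_mult[OF ell2_norm_mult[OF ell2_summable[of x] ell2_summable[of y]], of 2]])
    (simp add: cmod_cinner_le)

instantiation ell2 :: (complex_hilbert) real_inner
begin

definition inner_ell2 :: "'a ell2 \<Rightarrow> 'a ell2 \<Rightarrow> real" where
  "inner_ell2 x y = (\<Sum>n. inner (Rep_ell2 x n) (Rep_ell2 y n))"

definition norm_ell2 :: "'a ell2 \<Rightarrow> real" where
  "norm_ell2 x = sqrt (inner x x)"

definition dist_ell2 :: "'a ell2 \<Rightarrow> 'a ell2 \<Rightarrow> real" where
  "dist_ell2 x y = norm (x - y)"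

definition sgn_ell2 :: "'a ell2 \<Rightarrow> 'a ell2" where
  "sgn_ell2 x = x /\<^sub>R norm x"

definition uniformity_ell2 :: "('a ell2 \<times> 'a ell2) filter" where
  "uniformity_ell2 = (INF e\<in>{0 <..}. principal {(x, y). dist x y < e})"

definition open_ell2 :: "'a ell2 set \<Rightarrow> bool" where
  "open_ell2 U = (\<forall>x\<in>U. eventually (\<lambda>(x', y). x' = x \<longrightarrow> y \<in> U) uniformity)"

instance
proof
  fix x y z :: "'a ell2" and r :: real
  show "inner x y = inner y x"
    by (simp add: inner_ell2_def inner_commute)
  show "inner (x + y) z = inner x z + inner y z"
    by (simp add: inner_ell2_def plus_ell2.rep_eq inner_add_left suminf_add ell2_summable_inner)
  show "inner (r *\<^sub>R x) y = r * inner x y"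
    by (simp add: inner_ell2_def scaleR_ell2.rep_eq suminf_mult ell2_summable_inner)
  show "0 \<le> inner x x"
    by (simp add: inner_ell2_def suminf_nonneg ell2_summable_inner)
  have "inner x x = 0 \<longleftrightarrow> (\<forall>n. Rep_ell2 x n = 0)"
    by (simp add: inner_ell2_def suminf_eq_zero_iff ell2_summable_inner)
  also have "\<dots> \<longleftrightarrow> x = 0"
    by transfer auto
  finally show "inner x x = 0 \<longleftrightarrow> x = 0" .
qed (simp_all add: norm_ell2_def dist_ell2_def sgn_ell2_def uniformity_ell2_def open_ell2_def)

end

lemma norm_ell2_sq: "(norm x)\<^sup>2 = (\<Sum>n. (norm (Rep_ell2 x n))\<^sup>2)"
  by (simp add: power2_norm_eq_inner inner_ell2_def)

lemma ell2_partial_sum_le: "(\<Sum>n<m. (norm (Rep_ell2 x n))\<^sup>2) \<le> (norm x)\<^sup>2"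
  unfolding norm_ell2_sq by (rule sum_le_suminf[OF ell2_summable]) auto

instance ell2 :: (complex_hilbert) complete_space
proof
  fix X :: "nat \<Rightarrow> 'a ell2"
  assume X: "Cauchy X"
  have coord_le: "norm (Rep_ell2 x n) \<le> norm x" for x :: "'a ell2" and n
  proof (rule power2_le_imp_le)
    have "(norm (Rep_ell2 x n))\<^sup>2 \<le> (\<Sum>n<Suc n. (norm (Rep_ell2 x n))\<^sup>2)"
      by (simp add: sum_nonneg)
    also have "\<dots> \<le> (norm x)\<^sup>2"
      by (rule ell2_partial_sum_le)
    finally show "(norm (Rep_ell2 x n))\<^sup>2 \<le> (norm x)\<^sup>2" .
  qed simp
  have "Cauchy (\<lambda>k. Rep_ell2 (X k) n)" for n
    unfolding Cauchy_def
  proof (intro allI impI)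
    fix e :: real
    assume "0 < e"
    then obtain M where M: "\<forall>m\<ge>M. \<forall>k\<ge>M. dist (X m) (X k) < e"
      using X by (auto simp: Cauchy_def)
    have "dist (Rep_ell2 (X m) n) (Rep_ell2 (X k) n) \<le> dist (X m) (X k)" for m k
      using coord_le[of "X m - X k" n] by (simp add: dist_norm minus_ell2.rep_eq)
    thus "\<exists>M. \<forall>m\<ge>M. \<forall>k\<ge>M. dist (Rep_ell2 (X m) n) (Rep_ell2 (X k) n) < e"
      using M by (meson le_less_trans)
  qed
  hence "\<exists>l. (\<lambda>k. Rep_ell2 (X k) n) \<longlonglongrightarrow> l" for n
    by (simp add: Cauchy_convergent_iff convergent_def)
  then obtain L where L: "\<And>n. (\<lambda>k. Rep_ell2 (X k) n) \<longlonglongrightarrow> L n"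
    by metis
  have bound: "\<exists>N. \<forall>k\<ge>N. \<forall>m. (\<Sum>n<m. (norm (Rep_ell2 (X k) n - L n))\<^sup>2) \<le> e\<^sup>2" if e: "0 < e" for e
  proof -
    obtain N where N: "\<forall>m\<ge>N. \<forall>k\<ge>N. dist (X m) (X k) < e"
      using X e by (auto simp: Cauchy_def)
    have "(\<Sum>n<m. (norm (Rep_ell2 (X k) n - L n))\<^sup>2) \<le> e\<^sup>2" if "k \<ge> N" for k m
    proof (rule LIMSEQ_le_const2)
      show "(\<lambda>j. \<Sum>n<m. (norm (Rep_ell2 (X k) n - Rep_ell2 (X j) n))\<^sup>2)
              \<longlonglongrightarrow> (\<Sum>n<m. (norm (Rep_ell2 (X k) n - L n))\<^sup>2)"
        by (intro tendsto_intros L)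
      have "(\<Sum>n<m. (norm (Rep_ell2 (X k) n - Rep_ell2 (X j) n))\<^sup>2) \<le> e\<^sup>2" if "j \<ge> N" for j
      proof -
        have "(\<Sum>n<m. (norm (Rep_ell2 (X k) n - Rep_ell2 (X j) n))\<^sup>2) \<le> (norm (X k - X j))\<^sup>2"
          using ell2_partial_sum_le[of "X k - X j" m] by (simp add: minus_ell2.rep_eq)
        also have "\<dots> \<le> e\<^sup>2"
          using N \<open>k \<ge> N\<close> \<open>j \<ge> N\<close> by (intro power_mono) (auto simp: dist_norm less_imp_le)
        finally show ?thesis .
      qed
      thus "\<exists>M. \<forall>j\<ge>M. (\<Sum>n<m. (norm (Rep_ell2 (X k) n - Rep_ell2 (X j) n))\<^sup>2) \<le> e\<^sup>2"
        by blast
    qed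
    thus ?thesis
      by blast
  qed
  have diff: "summable (\<lambda>n. (norm (Rep_ell2 (X k) n - L n))\<^sup>2)"
    if "\<forall>m. (\<Sum>n<m. (norm (Rep_ell2 (X k) n - L n))\<^sup>2) \<le> B" for k B
    using that by (intro summableI_nonneg_bounded[where x = B]) auto
  obtain k0 where k0: "\<forall>m. (\<Sum>n<m. (norm (Rep_ell2 (X k0) n - L n))\<^sup>2) \<le> 1\<^sup>2"
    using bound[of 1] by auto
  have "summable (\<lambda>n. (norm (Rep_ell2 (X k0) n + (- (Rep_ell2 (X k0) n - L n))))\<^sup>2)"
    using diff[OF k0] by (intro ell2_add ell2_summable) (simp only: norm_minus_cancel)
  hence sL: "summable (\<lambda>n. (norm (L n))\<^sup>2)"
    by simp
  define l where "l = Abs_ell2 L"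
  have l: "Rep_ell2 l = L"
    by (simp add: l_def Abs_ell2_inverse sL)
  have "X \<longlonglongrightarrow> l"
  proof (rule metric_LIMSEQ_I)
    fix e :: real
    assume e: "0 < e"
    obtain N where N: "\<forall>k\<ge>N. \<forall>m. (\<Sum>n<m. (norm (Rep_ell2 (X k) n - L n))\<^sup>2) \<le> (e / 2)\<^sup>2"
      using bound[of "e / 2"] e by auto
    have "dist (X k) l < e" if "k \<ge> N" for k
    proof -
      have "(norm (X k - l))\<^sup>2 \<le> (e / 2)\<^sup>2"
        unfolding norm_ell2_sq minus_ell2.rep_eq l
        using N that by (intro suminf_le_const diff[of k "(e / 2)\<^sup>2"]) auto
      hence "norm (X k - l) \<le> e / 2"
        by (rule power2_le_imp_le) (use e in simp)
      thus ?thesis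
        using e by (simp add: dist_norm)
    qed
    thus "\<exists>N. \<forall>k\<ge>N. dist (X k) l < e"
      by blast
  qed
  thus "convergent X"
    by (auto simp: convergent_def)
qed

instantiation ell2 :: (complex_hilbert) complex_hilbert
begin

lift_definition scaleC_ell2 :: "complex \<Rightarrow> 'a ell2 \<Rightarrow> 'a ell2" is "\<lambda>c x n. c *\<^sub>C x n"
  by (simp add: norm_scaleC power_mult_distrib summable_mult)

definition cinner_ell2 :: "'a ell2 \<Rightarrow> 'a ell2 \<Rightarrow> complex" where
  "cinner_ell2 x y = (\<Sum>n. cinner (Rep_ell2 x n) (Rep_ell2 y n))"

instance
proof
  fix x y z :: "'a ell2" and c d :: complex and r :: real
  show "c *\<^sub>C (x + y) = c *\<^sub>C x + c *\<^sub>C y"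
    by transfer (simp add: scaleC_add_right)
  show "(c + d) *\<^sub>C x = c *\<^sub>C x + d *\<^sub>C x"
    by transfer (simp add: scaleC_add_left)
  show "c *\<^sub>C d *\<^sub>C x = (c * d) *\<^sub>C x"
    by transfer (simp add: scaleC_scaleC)
  show "complex_of_real r *\<^sub>C x = r *\<^sub>R x"
    by transfer (simp add: scaleC_of_real)
  have "cnj (cinner y x) = (\<Sum>n. cnj (cinner (Rep_ell2 y n) (Rep_ell2 x n)))"
    unfolding cinner_ell2_def
    by (rule bounded_linear.suminf[OF bounded_linear_cnj ell2_summable_cinner])
  thus "cinner x y = cnj (cinner y x)"
    unfolding cinner_ell2_def by (subst cinner_commute) simp
  show "cinner (x + y) z = cinner x z + cinner y z"
    by (simp add: cinner_ell2_def plus_ell2.rep_eq cinner_add_left suminf_add ell2_summable_cinner)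
  show "cinner (c *\<^sub>C x) y = c * cinner x y"
    by (simp add: cinner_ell2_def scaleC_ell2.rep_eq cinner_scaleC_left suminf_mult
        ell2_summable_cinner)
  show "inner x y = Re (cinner x y)"
    unfolding cinner_ell2_def inner_ell2_def inner_eq_Re_cinner
    by (rule bounded_linear.suminf[OF bounded_linear_Re ell2_summable_cinner, symmetric])
qed

end


section \<open>Operator convexity\<close>

text \<open>
  Continuity and operator convexity of \<open>f\<close> on \<open>J\<close>, for the self-adjoint operators on all Hilbert
  spaces that are closed subspaces (ranges of projections) of \<open>'k\<close>.
\<close>

definition operator_convex_on :: "('k :: complex_hilbert) itself \<Rightarrow> real set \<Rightarrow> (real \<Rightarrow> real) \<Rightarrow> bool" where
  "operator_convex_on K J f \<longleftrightarrow>
     continuous_on J f \<and>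
     (\<forall>(P :: 'k op) X Y c.
        projection P \<and> X \<in> ops_on P \<and> Y \<in> ops_on P \<and>
        self_adjoint X \<and> self_adjoint Y \<and>
        spectrum_on P X \<subseteq> complex_of_real ` J \<and> spectrum_on P Y \<subseteq> complex_of_real ` J \<and>
        0 \<le> c \<and> c \<le> 1 \<longrightarrow>
        fun_calc_on P f (c *\<^sub>R X + (1 - c) *\<^sub>R Y)
          \<le>\<^sub>o\<^sub>p c *\<^sub>R fun_calc_on P f X + (1 - c) *\<^sub>R fun_calc_on P f Y)"


section \<open>Radon measures and Bochner integrals\<close>

text \<open>
  For finite Borel measures, inner regularity with respect to compact sets on all Borel sets
  includes outer regularity.
\<close>

definition bounded_radon_measure :: "('t :: t2_space) measure \<Rightarrow> bool" where
  "bounded_radon_measure \<mu> \<longleftrightarrow>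
     sets \<mu> = sets borel \<and> finite_measure \<mu> \<and>
     (\<forall>S\<in>sets borel. emeasure \<mu> S = (SUP K\<in>{K. compact K \<and> K \<subseteq> S}. emeasure \<mu> K))"

text \<open>
  The library's \<open>has_bochner_integral\<close> is restricted to second countable spaces, which excludes
  the bounded operators on an infinite-dimensional space. The definition below is the same, for arbitrary
  normed spaces, with Borel measurability of \<open>f\<close> replaced by strong measurability (almost
  everywhere convergence of simple functions to \<open>f\<close>).
\<close>

definition has_bochner :: "'t measure \<Rightarrow> ('t \<Rightarrow> 'b :: real_normed_vector) \<Rightarrow> 'b \<Rightarrow> bool" where
  "has_bochner M f I \<longleftrightarrow>
     (\<exists>s. (\<forall>i. Bochner_Integration.simple_bochner_integrable M (s i)) \<and>
          (AE t in M. (\<lambda>i. s i t) \<longlonglongrightarrow> f t) \<and>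
          (\<lambda>i. \<integral>\<^sup>+ t. ennreal (norm (f t - s i t)) \<partial>M) \<longlonglongrightarrow> 0 \<and>
          (\<lambda>i. Bochner_Integration.simple_bochner_integral M (s i)) \<longlonglongrightarrow> I)"

definition bochner_integrable :: "'t measure \<Rightarrow> ('t \<Rightarrow> 'b :: real_normed_vector) \<Rightarrow> bool" where
  "bochner_integrable M f \<longleftrightarrow> (\<exists>I. has_bochner M f I)"

definition bochner_integral :: "'t measure \<Rightarrow> ('t \<Rightarrow> 'b :: real_normed_vector) \<Rightarrow> 'b" where
  "bochner_integral M f = (THE I. has_bochner M f I)"


section \<open>Perspective and \<open>f\<close>-divergence\<close>

definition perspective :: "(real \<Rightarrow> real) \<Rightarrow> ('a :: complex_hilbert) op \<Rightarrow> 'a op \<Rightarrow> 'a op" where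
  "perspective f L R =
     op_powr R (1/2) o\<^sub>L fun_calc f (op_powr R (-1/2) o\<^sub>L L o\<^sub>L op_powr R (-1/2)) o\<^sub>L op_powr R (1/2)"

definition f_divergence ::
  "(real \<Rightarrow> real) \<Rightarrow> 't measure \<Rightarrow> ('t \<Rightarrow> ('a :: complex_hilbert) op) \<Rightarrow> ('t \<Rightarrow> 'a op) \<Rightarrow> 'a op" where
  "f_divergence f \<mu> A B = bochner_integral \<mu> (\<lambda>t. perspective f (A t) (B t))"

end

theory Submission
  imports Defs "HOL-Computational_Algebra.Fundamental_Theorem_Algebra"
begin

text \<open>
  The perspective \<open>g\<close> of an operator convex function is subadditive, positively homogeneous and,
  where it is defined, norm continuous, and the integral is a limit of Riemann sums with nonnegative weights. The
  inequality is therefore the limit of its version for finite sums.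

  Finite sums: for \<open>R = \<Sum> w\<^sub>k R\<^sub>k\<close> the operators \<open>C\<^sub>k = w\<^sub>k\<^sup>1\<^sup>/\<^sup>2 R\<^sub>k\<^sup>1\<^sup>/\<^sup>2 R\<^sup>-\<^sup>1\<^sup>/\<^sup>2\<close> satisfy
  \<open>\<Sum> C\<^sub>k\<^sup>* C\<^sub>k = 1\<close>. They form a column that is an isometry from the given Hilbert space into the
  square summable sequences. Compressing the block diagonal operator with entries
  \<open>X\<^sub>k = R\<^sub>k\<^sup>-\<^sup>1\<^sup>/\<^sup>2 L\<^sub>k R\<^sub>k\<^sup>-\<^sup>1\<^sup>/\<^sup>2\<close> by this column gives \<open>R\<^sup>-\<^sup>1\<^sup>/\<^sup>2 L R\<^sup>-\<^sup>1\<^sup>/\<^sup>2\<close> with \<open>L = \<Sum> w\<^sub>k L\<^sub>k\<close>, so the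
  claim (\<open>perspective_weighted_sum\<close>) is Jensen's inequality for compression by an isometry
  (\<open>jensen_isometry\<close>). That in turn is operator convexity applied to \<open>X\<close> and its conjugate under a
  reflection.

  Passage to the limit: a Bochner integral is approximated by sums \<open>\<Sum> w\<^sub>k F(t\<^sub>k)\<close> over values of the
  integrand itself (\<open>has_bochner_riemann_sum\<close>). With \<open>F\<close> the triple of \<open>A\<^sub>t\<close>, \<open>B\<^sub>t\<close> and \<open>g(A\<^sub>t, B\<^sub>t)\<close> the same
  points serve all three integrals. Continuity of \<open>g\<close> at \<open>(A, B)\<close> (\<open>tendsto_perspective\<close>) needs \<open>B\<close> to be
  strictly positive and the spectrum of \<open>B\<^sup>-\<^sup>1\<^sup>/\<^sup>2 A B\<^sup>-\<^sup>1\<^sup>/\<^sup>2\<close> to lie in \<open>J\<close>. Both hold because a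
  continuous field of strictly positive operators has a strictly positive integral
  (\<open>bochner_integral_coercive\<close>), applied to \<open>B\<^sub>t\<close> and to \<open>A\<^sub>t - x B\<^sub>t\<close> or \<open>x B\<^sub>t - A\<^sub>t\<close> for \<open>x\<close> outside \<open>J\<close>.

  The functional calculus rests on the bound of \<open>\<parallel>p(X)\<parallel>\<close> by the maximum of \<open>|p|\<close> on the spectrum of a
  self-adjoint \<open>X\<close>. For this it is enough that \<open>q(X) \<ge> 0\<close> whenever \<open>q \<ge> 0\<close> on the spectrum
  (\<open>poly_op_nonneg\<close>): the lower end \<open>m\<close> of the numerical range of \<open>q(X)\<close> is an approximate eigenvalue,
  so factoring \<open>q - m\<close> over the reals exhibits \<open>m\<close> as a value of \<open>q\<close> on the spectrum.
\<close>

section \<open>Bounded operators and the real inner product\<close>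

lemma blinfun_apply_diff [simp]: "blinfun_apply (X - Y) v = X v - Y v"
  by (simp add: blinfun.diff_left)

lemma blinfun_apply_add [simp]: "blinfun_apply (X + Y) v = X v + Y v"
  by (simp add: blinfun.add_left)

lemma blinfun_apply_scaleR [simp]: "blinfun_apply (c *\<^sub>R X) v = c *\<^sub>R X v"
  by (simp add: blinfun.scaleR_left)

lemma blinfun_apply_sum [simp]: "blinfun_apply (sum F K) v = (\<Sum>k\<in>K. F k v)"
  by (simp add: blinfun.sum_left)

lemma blinfun_eq_iff: "X = Y \<longleftrightarrow> (\<forall>v. blinfun_apply X v = Y v)"
  by (auto intro: blinfun_eqI)

lemma scaleC_zero_right [simp]: "c *\<^sub>C (0 :: 'a :: complex_hilbert) = 0"
  by (metis bounded_linear_scaleC linear_simps(3))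

lemma scaleC_diff_right: "c *\<^sub>C (x - y :: 'a :: complex_hilbert) = c *\<^sub>C x - c *\<^sub>C y"
  by (metis bounded_linear_scaleC linear_simps(2))

lemma scaleC_scaleR: "c *\<^sub>C (r *\<^sub>R x :: 'a :: complex_hilbert) = r *\<^sub>R c *\<^sub>C x"
  by (metis bounded_linear_scaleC linear_simps(5))

lemma complex_linearD: "complex_linear X \<Longrightarrow> X (c *\<^sub>C x) = c *\<^sub>C X x"
  by (simp add: complex_linear_def)

lemma complex_linear_id [simp]: "complex_linear id_blinfun"
  by (simp add: complex_linear_def)

lemma complex_linear_zero [simp]: "complex_linear 0"
  by (simp add: complex_linear_def)

lemma complex_linear_compose [simp]:
  "complex_linear X \<Longrightarrow> complex_linear Y \<Longrightarrow> complex_linear (X o\<^sub>L Y)"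
  by (simp add: complex_linear_def)

lemma complex_linear_add [simp]:
  "complex_linear X \<Longrightarrow> complex_linear Y \<Longrightarrow> complex_linear (X + Y)"
  by (simp add: complex_linear_def scaleC_add_right)

lemma complex_linear_diff [simp]:
  "complex_linear X \<Longrightarrow> complex_linear Y \<Longrightarrow> complex_linear (X - Y)"
  by (simp add: complex_linear_def scaleC_diff_right)

lemma complex_linear_scaleR [simp]: "complex_linear X \<Longrightarrow> complex_linear (r *\<^sub>R X)"
  by (simp add: complex_linear_def scaleC_scaleR)

lemma Im_cinner: "Im (cinner x y) = inner ((- \<i>) *\<^sub>C x) (y :: 'a :: complex_hilbert)"
  by (simp add: inner_eq_Re_cinner cinner_scaleC_left)

lemma inner_scaleC_i: "inner (\<i> *\<^sub>C x) (\<i> *\<^sub>C y) = inner x (y :: 'a :: complex_hilbert)"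
proof -
  have "cinner (\<i> *\<^sub>C x) (\<i> *\<^sub>C y) = \<i> * cnj (\<i> * cinner y x)"
    by (metis cinner_commute cinner_scaleC_left)
  also have "\<dots> = cinner x y"
    by (metis cinner_commute complex_cnj_i complex_cnj_mult i_squared minus_minus mult.assoc
        mult.commute mult_minus1 mult_minus_left power2_eq_square)
  finally show ?thesis by (simp add: inner_eq_Re_cinner)
qed

text \<open>
  Since the real inner product is the real part of the complex one, self-adjointness and positivity
  of complex linear operators can be tested with the real inner product alone.
\<close>

lemma self_adjoint_iff:
  "self_adjoint X \<longleftrightarrow> complex_linear X \<and> (\<forall>x y. inner (X x) y = inner x (X y))"
proof
  assume "self_adjoint X"
  thus "complex_linear X \<and> (\<forall>x y. inner (X x) y = inner x (X y))"
    by (simp add: self_adjoint_def is_adjoint_def inner_eq_Re_cinner)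
next
  assume X: "complex_linear X \<and> (\<forall>x y. inner (X x) y = inner x (X y))"
  have "cinner (X x) y = cinner x (X y)" for x y
  proof (rule complex_eqI)
    show "Re (cinner (X x) y) = Re (cinner x (X y))"
      using X by (simp flip: inner_eq_Re_cinner)
    show "Im (cinner (X x) y) = Im (cinner x (X y))"
      using X complex_linearD[of X "- \<i>" x] by (simp only: Im_cinner flip: complex_linearD)
  qed
  thus "self_adjoint X" using X by (simp add: self_adjoint_def is_adjoint_def)
qed

lemma self_adjoint_inner: "self_adjoint X \<Longrightarrow> inner (X x) y = inner x (X y)"
  by (simp add: self_adjoint_iff)

lemma self_adjoint_complex_linear: "self_adjoint X \<Longrightarrow> complex_linear X"
  by (simp add: self_adjoint_def)

text \<open>On a complex space an operator whose quadratic form takes only real values is symmetric.\<close>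

lemma positive_op_iff:
  "positive_op X \<longleftrightarrow> self_adjoint X \<and> (\<forall>v. 0 \<le> inner (X v) v)"
proof
  assume "positive_op X"
  hence cl: "complex_linear X" and nn: "\<And>v. cinner (X v) v \<in> \<real>\<^sub>\<ge>\<^sub>0"
    by (auto simp: positive_op_def)
  have re: "0 \<le> inner (X v) v" for v
    using nn[of v] by (simp add: inner_eq_Re_cinner complex_nonneg_Reals_iff)
  have "Im (cinner (X v) v) = 0" for v
    using nn[of v] by (simp add: complex_nonneg_Reals_iff)
  hence zero: "inner (\<i> *\<^sub>C X v) v = 0" for v
    by (simp add: inner_eq_Re_cinner cinner_scaleC_left)
  \<comment> \<open>The real bilinear form of \<open>\<i> X\<close> vanishes on the diagonal, so it is antisymmetric.\<close>
  have anti: "inner (\<i> *\<^sub>C X x) y = - inner (\<i> *\<^sub>C X y) x" for x y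
    using zero[of "x + y"] zero[of x] zero[of y]
    by (simp add: blinfun.add_right scaleC_add_right inner_add_left inner_add_right)
  have "inner (X x) y = inner x (X y)" for x y
  proof -
    have "inner (X x) y = inner (\<i> *\<^sub>C X x) (\<i> *\<^sub>C y)"
      by (simp add: inner_scaleC_i)
    also have "\<dots> = - inner (\<i> *\<^sub>C \<i> *\<^sub>C X y) x"
      using anti[of x "\<i> *\<^sub>C y"] by (simp add: complex_linearD[OF cl])
    also have "\<dots> = inner x (X y)"
      using scaleC_of_real[of "-1" "X y"] by (simp add: scaleC_scaleC inner_commute)
    finally show ?thesis .
  qed
  thus "self_adjoint X \<and> (\<forall>v. 0 \<le> inner (X v) v)"
    using cl re by (simp add: self_adjoint_iff)
next
  assume X: "self_adjoint X \<and> (\<forall>v. 0 \<le> inner (X v) v)"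
  have "cinner (X v) v \<in> \<real>\<^sub>\<ge>\<^sub>0" for v
  proof -
    have "cinner (X v) v = cinner v (X v)"
      using X by (simp add: self_adjoint_def is_adjoint_def)
    also have "\<dots> = cnj (cinner (X v) v)" by (rule cinner_commute)
    finally have "Im (cinner (X v) v) = - Im (cinner (X v) v)"
      by (metis cnj.simps(2))
    thus ?thesis using X by (simp add: complex_nonneg_Reals_iff inner_eq_Re_cinner)
  qed
  thus "positive_op X" using X by (simp add: positive_op_def self_adjoint_def)
qed

lemma self_adjoint_id [simp]: "self_adjoint id_blinfun"
  by (simp add: self_adjoint_iff)

lemma self_adjoint_zero [simp]: "self_adjoint 0"
  by (simp add: self_adjoint_iff)

lemma self_adjoint_add [simp]: "self_adjoint X \<Longrightarrow> self_adjoint Y \<Longrightarrow> self_adjoint (X + Y)"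
  by (simp add: self_adjoint_iff inner_add_left inner_add_right)

lemma self_adjoint_diff [simp]: "self_adjoint X \<Longrightarrow> self_adjoint Y \<Longrightarrow> self_adjoint (X - Y)"
  by (simp add: self_adjoint_iff inner_diff_left inner_diff_right)

lemma self_adjoint_scaleR [simp]: "self_adjoint X \<Longrightarrow> self_adjoint (r *\<^sub>R X)"
  by (simp add: self_adjoint_iff)

lemma self_adjoint_sum [simp]: "(\<And>k. k \<in> K \<Longrightarrow> self_adjoint (F k)) \<Longrightarrow> self_adjoint (sum F K)"
  by (induction K rule: infinite_finite_induct) auto

lemma self_adjoint_sandwich [simp]:
  "self_adjoint S \<Longrightarrow> self_adjoint X \<Longrightarrow> self_adjoint (S o\<^sub>L X o\<^sub>L S)"
  by (simp add: self_adjoint_iff)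

lemma self_adjoint_limit:
  assumes "\<And>n. self_adjoint (X n)" "X \<longlonglongrightarrow> Y"
  shows "self_adjoint Y"
proof -
  have lim: "(\<lambda>n. X n v) \<longlonglongrightarrow> Y v" for v
    by (intro tendsto_intros assms)
  have "Y (c *\<^sub>C v) = c *\<^sub>C Y v" for c v
  proof (rule LIMSEQ_unique[OF lim])
    have "(\<lambda>n. c *\<^sub>C X n v) \<longlonglongrightarrow> c *\<^sub>C Y v"
      by (rule bounded_linear.tendsto[OF bounded_linear_scaleC lim])
    thus "(\<lambda>n. X n (c *\<^sub>C v)) \<longlonglongrightarrow> c *\<^sub>C Y v"
      using assms(1) by (simp add: self_adjoint_def complex_linearD)
  qed
  moreover have "inner (Y v) w = inner v (Y w)" for v w
  proof (rule LIMSEQ_unique)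
    show "(\<lambda>n. inner (X n v) w) \<longlonglongrightarrow> inner (Y v) w" by (intro tendsto_intros lim)
    have "(\<lambda>n. inner v (X n w)) \<longlonglongrightarrow> inner v (Y w)" by (intro tendsto_intros lim)
    thus "(\<lambda>n. inner (X n v) w) \<longlonglongrightarrow> inner v (Y w)"
      using assms(1) by (simp add: self_adjoint_inner)
  qed
  ultimately show ?thesis by (simp add: self_adjoint_iff complex_linear_def)
qed


section \<open>Invertibility and the spectrum of self-adjoint operators\<close>

definition bounded_below :: "('a :: real_normed_vector \<Rightarrow>\<^sub>L 'b :: real_normed_vector) \<Rightarrow> bool" where
  "bounded_below X \<longleftrightarrow> (\<exists>c>0. \<forall>v. c * norm v \<le> norm (X v))"

lemma bounded_below_compose:
  assumes "bounded_below X" "bounded_below Y"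
  shows "bounded_below (X o\<^sub>L Y)"
proof -
  obtain c d where c: "c > 0" "\<And>v. c * norm v \<le> norm (X v)"
    and d: "d > 0" "\<And>v. d * norm v \<le> norm (Y v)"
    using assms by (auto simp: bounded_below_def)
  have "(c * d) * norm v \<le> norm ((X o\<^sub>L Y) v)" for v
  proof -
    have "(c * d) * norm v \<le> c * norm (Y v)"
      using d(2)[of v] c(1) by (simp add: mult.assoc)
    also have "\<dots> \<le> norm ((X o\<^sub>L Y) v)" using c(2) by simp
    finally show ?thesis .
  qed
  thus ?thesis using c(1) d(1) by (auto simp: bounded_below_def intro!: exI[of _ "c * d"])
qed

lemma coercive_norm_le:
  assumes "e * (norm v)\<^sup>2 \<le> inner (T v) (v :: 'a :: real_inner)"
  shows "e * norm v \<le> norm (T v)"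
proof (cases "v = 0")
  case False
  have "(e * norm v) * norm v \<le> norm (T v) * norm v"
    using assms norm_cauchy_schwarz[of "T v" v] by (simp add: power2_eq_square)
  thus ?thesis using False by simp
qed simp

lemma coercive_bounded_below:
  fixes T :: "'a :: real_inner \<Rightarrow>\<^sub>L 'a"
  assumes "e > 0" "\<And>v. e * (norm v)\<^sup>2 \<le> inner (T v) v"
  shows "bounded_below T"
  unfolding bounded_below_def using assms coercive_norm_le by blast

lemma bij_bounded_below_invertible:
  fixes T :: "'a :: complex_hilbert op"
  assumes cl: "complex_linear T" and c: "c > 0" "\<And>v. c * norm v \<le> norm (T v)"
    and surj: "\<And>y. \<exists>x. T x = y"
  shows "invertible_op T"
proof -
  have inj: "x = y" if "T x = T y" for x y
  proof -
    have "c * norm (x - y) \<le> norm (T (x - y))" by (rule c(2))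
    also have "\<dots> = 0" using that by (simp add: blinfun.diff_right)
    finally show ?thesis using c(1) by (simp add: mult_le_0_iff)
  qed
  obtain S where S: "\<And>y. T (S y) = y" using surj by metis
  have "bounded_linear S"
  proof (rule bounded_linear_intro[where K = "1 / c"])
    show "S (x + y) = S x + S y" for x y
      by (rule inj) (simp add: blinfun.add_right S)
    show "S (r *\<^sub>R x) = r *\<^sub>R S x" for r x
      by (rule inj) (simp add: blinfun.scaleR_right S)
    show "norm (S x) \<le> norm x * (1 / c)" for x
      using c(2)[of "S x"] c(1) by (simp add: S field_simps)
  qed
  hence Y: "blinfun_apply (Blinfun S) = S" by (rule bounded_linear_Blinfun_apply)
  have "S (r *\<^sub>C x) = r *\<^sub>C S x" for r x
    by (rule inj) (simp add: S complex_linearD[OF cl])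
  hence "complex_linear (Blinfun S)"
    by (simp add: complex_linear_def Y)
  moreover have "S (T x) = x" for x by (rule inj) (rule S)
  hence "T o\<^sub>L Blinfun S = id_blinfun" "Blinfun S o\<^sub>L T = id_blinfun"
    by (simp_all add: blinfun_eq_iff Y S)
  ultimately show ?thesis unfolding invertible_op_def by (intro exI[of _ "Blinfun S"]) auto
qed

text \<open>
  The Lax-Milgram theorem: for small \<open>s\<close> the map \<open>x \<mapsto> x + s (y - T x)\<close> is a contraction, and its
  fixed point solves \<open>T x = y\<close>.
\<close>

lemma coercive_invertible:
  fixes T :: "'a :: complex_hilbert op"
  assumes cl: "complex_linear T" and e: "e > 0" "\<And>v. e * (norm v)\<^sup>2 \<le> inner (T v) v"
  shows "invertible_op T"
proof (rule bij_bounded_below_invertible[OF cl e(1)])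
  show "e * norm v \<le> norm (T v)" for v by (rule coercive_norm_le[OF e(2)])
next
  fix y
  define K where "K = norm T + e"
  define s where "s = e / K\<^sup>2"
  have K: "K > 0" "e \<le> K" "s > 0"
    using e(1) by (auto simp: K_def s_def add_nonneg_pos intro!: divide_pos_pos zero_less_power)
  have contr: "(norm (x - s *\<^sub>R T x))\<^sup>2 \<le> (1 - e\<^sup>2 / K\<^sup>2) * (norm x)\<^sup>2" for x
  proof -
    have "norm (T x) \<le> K * norm x"
      using norm_blinfun[of T x] e(1) by (simp add: K_def distrib_right add_increasing2)
    hence "(norm (T x))\<^sup>2 \<le> (K * norm x)\<^sup>2" by (rule power_mono) simp
    hence *: "s\<^sup>2 * (norm (T x))\<^sup>2 \<le> s\<^sup>2 * (K\<^sup>2 * (norm x)\<^sup>2)"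
      by (intro mult_left_mono) (auto simp: power_mult_distrib)
    have "s * K\<^sup>2 = e" using K by (simp add: s_def)
    hence **: "s\<^sup>2 * (K\<^sup>2 * (norm x)\<^sup>2) = s * e * (norm x)\<^sup>2"
      by (metis mult.assoc mult.left_commute power2_eq_square)
    have "s * (e * (norm x)\<^sup>2) \<le> s * inner (T x) x"
      using e(2)[of x] K by (intro mult_left_mono) auto
    moreover have "(norm (x - s *\<^sub>R T x))\<^sup>2 = (norm x)\<^sup>2 - 2 * (s * inner (T x) x) + s\<^sup>2 * (norm (T x))\<^sup>2"
      unfolding power2_norm_eq_inner
      by (simp add: inner_diff_left inner_diff_right inner_commute power2_eq_square algebra_simps)
    ultimately have "(norm (x - s *\<^sub>R T x))\<^sup>2 \<le> (norm x)\<^sup>2 - s * e * (norm x)\<^sup>2"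
      using * ** by (simp add: mult.assoc)
    also have "s * e = e\<^sup>2 / K\<^sup>2" by (simp add: s_def power2_eq_square)
    finally show ?thesis by (simp add: algebra_simps)
  qed
  define c where "c = sqrt (1 - e\<^sup>2 / K\<^sup>2)"
  have "e\<^sup>2 / K\<^sup>2 \<le> 1" "0 < e\<^sup>2 / K\<^sup>2"
    using K e(1) by (auto simp: divide_le_eq_1 power_mono)
  hence c: "0 \<le> c" "c < 1" by (auto simp: c_def)
  have "\<exists>!x. x + s *\<^sub>R (y - T x) = x"
  proof (rule banach_fix_type[OF c], intro allI)
    fix x z
    have "(norm ((x - z) - s *\<^sub>R T (x - z)))\<^sup>2 \<le> (c * norm (x - z))\<^sup>2"
      using contr[of "x - z"] \<open>e\<^sup>2 / K\<^sup>2 \<le> 1\<close> by (simp add: c_def power_mult_distrib)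
    hence "norm ((x - z) - s *\<^sub>R T (x - z)) \<le> c * norm (x - z)"
      by (rule power2_le_imp_le) (simp add: c)
    thus "dist (x + s *\<^sub>R (y - T x)) (z + s *\<^sub>R (y - T z)) \<le> c * dist x z"
      by (simp add: dist_norm blinfun.diff_right algebra_simps)
  qed
  then obtain x where "s *\<^sub>R (y - T x) = 0" by auto
  thus "\<exists>x. T x = y" using K by auto
qed

lemma invertible_bounded_below:
  assumes "invertible_op X"
  shows "bounded_below X"
proof -
  obtain Y where Y: "Y o\<^sub>L X = id_blinfun" using assms by (auto simp: invertible_op_def)
  have "norm v \<le> (norm Y + 1) * norm (X v)" for v
  proof -
    have "v = Y (X v)" using Y by (metis blinfun_apply_blinfun_compose blinfun_apply_id_blinfun)
    hence "norm v \<le> norm Y * norm (X v)" by (metis norm_blinfun)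
    also have "\<dots> \<le> (norm Y + 1) * norm (X v)" by (intro mult_right_mono) auto
    finally show ?thesis .
  qed
  hence "1 / (norm Y + 1) * norm v \<le> norm (X v)" for v
    by (simp add: divide_le_eq mult.commute add_nonneg_pos)
  moreover have "1 / (norm Y + 1) > 0" by (simp add: add_nonneg_pos)
  ultimately show ?thesis unfolding bounded_below_def by blast
qed

text \<open>Since \<open>X\<close> is self-adjoint, its square is coercive; the inverse of the square yields one of \<open>X\<close>.\<close>

lemma bounded_below_invertible:
  assumes X: "self_adjoint X" and "bounded_below X"
  shows "invertible_op X"
proof -
  obtain c where c: "c > 0" "\<And>v. c * norm v \<le> norm (X v)"
    using assms by (auto simp: bounded_below_def)
  have cl: "complex_linear X" using X by (rule self_adjoint_complex_linear)
  have "c\<^sup>2 * (norm v)\<^sup>2 \<le> inner ((X o\<^sub>L X) v) v" for v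
  proof -
    have "c\<^sup>2 * (norm v)\<^sup>2 = (c * norm v)\<^sup>2" by (simp add: power_mult_distrib)
    also have "\<dots> \<le> (norm (X v))\<^sup>2" using c by (intro power_mono) auto
    finally show ?thesis by (simp add: self_adjoint_inner[OF X] power2_norm_eq_inner)
  qed
  hence "invertible_op (X o\<^sub>L X)"
    using cl c(1) by (intro coercive_invertible[where e = "c\<^sup>2"]) auto
  then obtain W where W: "complex_linear W" "\<And>v. X (X (W v)) = v" "\<And>v. W (X (X v)) = v"
    by (auto simp: invertible_op_def blinfun_eq_iff)
  have "W (X v) = X (W v)" for v using W(2,3) by metis
  hence "X o\<^sub>L (W o\<^sub>L X) = id_blinfun" "(W o\<^sub>L X) o\<^sub>L X = id_blinfun"
    using \<open>\<And>v. W (X v) = X (W v)\<close> by (auto intro!: blinfun_eqI simp: W)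
  thus ?thesis using W(1) cl unfolding invertible_op_def by (intro exI[of _ "W o\<^sub>L X"])
      (auto simp: blinfun_eq_iff)
qed

lemma invertible_iff_bounded_below:
  "self_adjoint X \<Longrightarrow> invertible_op X \<longleftrightarrow> bounded_below X"
  using bounded_below_invertible invertible_bounded_below by blast

definition real_spectrum :: "'a :: complex_hilbert op \<Rightarrow> real set" where
  "real_spectrum X = {x. complex_of_real x \<in> spectrum X}"

lemma spectrum_iff: "z \<in> spectrum X \<longleftrightarrow> \<not> invertible_op (X - scaleC_op z id_blinfun)"
proof -
  have "id_blinfun o\<^sub>L Y = Y" "Y o\<^sub>L id_blinfun = Y" for Y :: "'a op"
    by (auto intro: blinfun_eqI)
  thus ?thesis by (auto simp: spectrum_on_def ops_on_def invertible_op_def)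
qed

lemma scaleC_op_of_real: "scaleC_op (of_real r) X = r *\<^sub>R X"
  by (rule blinfun_eqI) (simp add: scaleC_op_apply scaleC_of_real)

text \<open>
  For self-adjoint \<open>X\<close> the spectrum is real and consists of the approximate eigenvalues. All later
  arguments use this description only.
\<close>

lemma real_spectrum_iff:
  assumes "self_adjoint X"
  shows "x \<in> real_spectrum X \<longleftrightarrow> \<not> bounded_below (X - x *\<^sub>R id_blinfun)"
  using assms by (simp add: real_spectrum_def spectrum_iff scaleC_op_of_real
      flip: invertible_iff_bounded_below)

lemma shifted_square_coercive:
  assumes "self_adjoint X"
  shows "b\<^sup>2 * (norm v)\<^sup>2 \<le>
    inner ((((X - a *\<^sub>R id_blinfun) o\<^sub>L (X - a *\<^sub>R id_blinfun)) + b\<^sup>2 *\<^sub>R id_blinfun) v) v"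
proof -
  let ?Y = "X - a *\<^sub>R id_blinfun"
  have "self_adjoint ?Y" using assms by simp
  from self_adjoint_inner[OF this, of "?Y v" v]
  have "inner ((?Y o\<^sub>L ?Y) v) v = inner (?Y v) (?Y v)" by simp
  thus ?thesis
    by (simp only: blinfun_apply_add blinfun_apply_scaleR[of _ id_blinfun] inner_add_left
        blinfun_apply_id_blinfun inner_scaleR_left power2_norm_eq_inner) simp
qed

text \<open>
  For \<open>z = a + \<i> b\<close> with \<open>b \<noteq> 0\<close> the product of \<open>X - z\<close> and \<open>X - \<^emph>\<open>cnj\<close> z\<close> is the coercive operator
  \<open>(X - a)\<^sup>2 + b\<^sup>2\<close>.
\<close>

lemma spectrum_real:
  assumes X: "self_adjoint X" and z: "z \<in> spectrum X"
  shows "z \<in> \<real>"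
proof (rule ccontr)
  assume "z \<notin> \<real>"
  define a b where "a = Re z" and "b = Im z"
  have b: "b \<noteq> 0" using \<open>z \<notin> \<real>\<close> by (auto simp: b_def complex_is_Real_iff)
  have cl: "complex_linear X" using X by (rule self_adjoint_complex_linear)
  define Y where "Y = X - a *\<^sub>R id_blinfun"
  have Y: "complex_linear Y" "self_adjoint Y" using X cl by (auto simp: Y_def)
  define N where "N = (Y o\<^sub>L Y) + b\<^sup>2 *\<^sub>R id_blinfun"
  have "invertible_op N"
    using Y b shifted_square_coercive[OF X, of b _ a]
    by (intro coercive_invertible[where e = "b\<^sup>2"]) (auto simp: N_def Y_def)
  then obtain W where W: "complex_linear W" "\<And>v. N (W v) = v" "\<And>v. W (N v) = v"
    by (auto simp: invertible_op_def blinfun_eq_iff)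
  define Zm Zp where "Zm = X - scaleC_op z id_blinfun" and "Zp = X - scaleC_op (cnj z) id_blinfun"
  have ap: "Zm v = Y v - b *\<^sub>R \<i> *\<^sub>C v" "Zp v = Y v + b *\<^sub>R \<i> *\<^sub>C v" for v
  proof -
    have "z = of_real a + of_real b * \<i>" "cnj z = of_real a + of_real (- b) * \<i>"
      by (auto simp: a_def b_def complex_eq_iff)
    hence "z *\<^sub>C v = a *\<^sub>R v + b *\<^sub>R \<i> *\<^sub>C v" "cnj z *\<^sub>C v = a *\<^sub>R v - b *\<^sub>R \<i> *\<^sub>C v"
      by (simp_all only: scaleC_add_left scaleC_scaleC[symmetric] scaleC_of_real) simp
    thus "Zm v = Y v - b *\<^sub>R \<i> *\<^sub>C v" "Zp v = Y v + b *\<^sub>R \<i> *\<^sub>C v"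
      by (auto simp: Zm_def Zp_def Y_def scaleC_op_apply)
  qed
  have ii: "\<i> *\<^sub>C \<i> *\<^sub>C v = - v" for v :: 'a
    using scaleC_of_real[of "-1" v] by (simp add: scaleC_scaleC)
  have prod: "Zm (Zp v) = N v" "Zp (Zm v) = N v" for v
    by (simp_all add: ap N_def blinfun.add_right blinfun.diff_right blinfun.scaleR_right
        complex_linearD[OF Y(1)] scaleC_add_right scaleC_diff_right scaleC_scaleR ii
        scaleR_add_right scaleR_diff_right power2_eq_square)
  have "Zm (Zp (W v)) = v" for v by (simp add: prod W)
  moreover have "Zp (W (Zm v)) = v" for v
  proof -
    have "W (Zp (Zm v)) = v" for v by (simp add: prod W)
    have "Zm (Zp (W (Zm v))) = Zm v" by (simp add: prod W)
    thus ?thesis by (metis prod(2) W(3))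
  qed
  moreover have "complex_linear Zp"
    using cl by (auto simp: Zp_def complex_linear_def scaleC_op_apply scaleC_diff_right scaleC_scaleC
        mult.commute)
  ultimately have "invertible_op Zm"
    using W(1) unfolding invertible_op_def
    by (intro exI[of _ "Zp o\<^sub>L W"]) (auto intro!: blinfun_eqI)
  thus False using z by (simp add: spectrum_iff Zm_def)
qed

lemma spectrum_subset_iff:
  assumes "self_adjoint X"
  shows "spectrum X \<subseteq> complex_of_real ` J \<longleftrightarrow> real_spectrum X \<subseteq> J"
proof
  assume *: "real_spectrum X \<subseteq> J"
  show "spectrum X \<subseteq> complex_of_real ` J"
  proof
    fix z assume z: "z \<in> spectrum X"
    then obtain r where "z = of_real r" using spectrum_real[OF assms z] by (auto elim: Reals_cases)
    thus "z \<in> complex_of_real ` J" using z * by (auto simp: real_spectrum_def)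
  qed
qed (auto simp: real_spectrum_def)

section \<open>Polynomials of a self-adjoint operator\<close>

abbreviation poly_op :: "real poly \<Rightarrow> 'a :: complex_hilbert op \<Rightarrow> 'a op" where
  "poly_op \<equiv> poly_op_on id_blinfun"

lemma op_power_on_simps [simp]:
  "op_power_on P X 0 = P" "op_power_on P X (Suc n) = X o\<^sub>L op_power_on P X n"
  by (simp_all add: op_power_on_def)

lemma poly_op_eq_sum:
  assumes "degree p \<le> n"
  shows "poly_op p X v = (\<Sum>i\<le>n. coeff p i *\<^sub>R op_power_on id_blinfun X i v)"
proof -
  have "(\<Sum>i\<le>degree p. coeff p i *\<^sub>R op_power_on id_blinfun X i v)
      = (\<Sum>i\<le>n. coeff p i *\<^sub>R op_power_on id_blinfun X i v)"
    using assms by (intro sum.mono_neutral_left) (auto simp: coeff_eq_0)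
  thus ?thesis by (simp add: poly_op_on_def)
qed

lemma poly_op_0 [simp]: "poly_op 0 X = 0"
  by (simp add: poly_op_on_def)

lemma poly_op_pCons_apply [simp]: "poly_op (pCons a p) X v = a *\<^sub>R v + X (poly_op p X v)"
  by (simp add: poly_op_eq_sum[OF degree_pCons_le] sum.atMost_Suc_shift
      poly_op_eq_sum[of p "degree p"] blinfun.sum_right blinfun.scaleR_right del: sum.atMost_Suc)

lemma poly_op_add: "poly_op (p + q) X = poly_op p X + poly_op q X"
proof -
  have "poly_op (p + q) X v = poly_op p X v + poly_op q X v" for v
    by (induction p q rule: poly_induct2) (simp_all add: blinfun.add_right scaleR_add_left)
  thus ?thesis by (simp add: blinfun_eq_iff)
qed

lemma poly_op_smult: "poly_op (smult c p) X = c *\<^sub>R poly_op p X"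
proof -
  have "poly_op (smult c p) X v = c *\<^sub>R poly_op p X v" for v
    by (induction p) (simp_all add: blinfun.scaleR_right scaleR_add_right)
  thus ?thesis by (simp add: blinfun_eq_iff)
qed

lemma poly_op_diff: "poly_op (p - q) X = poly_op p X - poly_op q X"
proof -
  have "poly_op (p - q) X v = poly_op p X v - poly_op q X v" for v
    by (induction p q rule: poly_induct2) (simp_all add: blinfun.diff_right scaleR_diff_left)
  thus ?thesis by (simp add: blinfun_eq_iff)
qed

lemma poly_op_mult_apply: "poly_op (p * q) X v = poly_op p X (poly_op q X v)"
  by (induction p) (simp_all add: poly_op_add poly_op_smult)

lemma poly_op_mult: "poly_op (p * q) X = poly_op p X o\<^sub>L poly_op q X"
  by (simp add: blinfun_eq_iff poly_op_mult_apply)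

lemma poly_op_const: "poly_op [:a:] X = a *\<^sub>R id_blinfun"
  by (simp add: blinfun_eq_iff)

lemma poly_op_linear: "poly_op [:- a, 1:] X = X - a *\<^sub>R id_blinfun"
  by (simp add: blinfun_eq_iff)

lemma poly_op_intertwine:
  fixes C :: "'a :: complex_hilbert \<Rightarrow>\<^sub>L 'b :: complex_hilbert"
  assumes "Y o\<^sub>L C = C o\<^sub>L X"
  shows "poly_op p Y o\<^sub>L C = C o\<^sub>L poly_op p X"
proof -
  have "Y (C v) = C (X v)" for v
    using assms by (metis blinfun_apply_blinfun_compose)
  hence "poly_op p Y (C v) = C (poly_op p X v)" for v
    by (induction p arbitrary: v) (simp_all add: blinfun.add_right blinfun.scaleR_right)
  thus ?thesis by (simp add: blinfun_eq_iff)
qed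

lemma self_adjoint_poly_op [simp]:
  assumes X: "self_adjoint X"
  shows "self_adjoint (poly_op p X)"
proof (induction p)
  case (pCons a p)
  have comm: "poly_op p X o\<^sub>L X = X o\<^sub>L poly_op p X"
    by (rule poly_op_intertwine) simp
  have "self_adjoint (X o\<^sub>L poly_op p X)"
    unfolding self_adjoint_iff
  proof (intro conjI allI)
    fix v w
    have "inner ((X o\<^sub>L poly_op p X) v) w = inner v (poly_op p X (X w))"
      using X pCons.IH by (simp add: self_adjoint_inner)
    also have "poly_op p X (X w) = (X o\<^sub>L poly_op p X) w" by (metis comm blinfun_apply_blinfun_compose)
    finally show "inner ((X o\<^sub>L poly_op p X) v) w = inner v ((X o\<^sub>L poly_op p X) w)" .
  qed (use X pCons.IH in \<open>simp_all add: self_adjoint_complex_linear\<close>)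
  moreover have "poly_op (pCons a p) X = a *\<^sub>R id_blinfun + (X o\<^sub>L poly_op p X)"
    by (simp add: blinfun_eq_iff)
  ultimately show ?case by simp
qed simp

text \<open>Values of real polynomials at complex points serve only to split off real factors.\<close>

definition complex_eval :: "real poly \<Rightarrow> complex \<Rightarrow> complex" where
  "complex_eval p z = poly (map_poly of_real p) z"

lemma complex_eval_simps [simp]:
  "complex_eval 0 z = 0" "complex_eval (pCons a p) z = of_real a + z * complex_eval p z"
  by (simp_all add: complex_eval_def map_poly_pCons)

lemma complex_eval_add [simp]: "complex_eval (p + q) z = complex_eval p z + complex_eval q z"
  by (induction p q rule: poly_induct2) (simp_all add: algebra_simps)

lemma complex_eval_smult [simp]: "complex_eval (smult a p) z = of_real a * complex_eval p z"
  by (induction p) (simp_all add: algebra_simps)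

lemma complex_eval_mult [simp]: "complex_eval (p * q) z = complex_eval p z * complex_eval q z"
  by (induction p) (simp_all add: algebra_simps)

lemma complex_eval_of_real [simp]: "complex_eval p (of_real x) = of_real (poly p x)"
  by (induction p) simp_all

lemma complex_root_exists:
  assumes "degree p > 0"
  obtains z where "complex_eval p z = 0"
proof -
  have "degree (map_poly complex_of_real p) > 0"
    using assms by (subst map_poly_degree_eq) auto
  hence "\<exists>z. poly (map_poly complex_of_real p) z = 0"
    by (intro fundamental_theorem_of_algebra_alt) auto
  thus ?thesis using that by (auto simp: complex_eval_def)
qed

lemma quadratic_dvd_of_complex_root:
  assumes "Im z \<noteq> 0" "complex_eval p z = 0"
  shows "[:(Re z)\<^sup>2 + (Im z)\<^sup>2, - 2 * Re z, 1:] dvd p"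
proof -
  define d where "d = [:(Re z)\<^sup>2 + (Im z)\<^sup>2, - 2 * Re z, 1:]"
  have d: "complex_eval d z = 0" "degree d = 2"
    by (simp_all add: d_def complex_eq_iff power2_eq_square algebra_simps)
  have "degree (p mod d) < 2 \<or> p mod d = 0"
    using degree_mod_less[of d p] d by (auto simp: d_def)
  hence "degree (p mod d) \<le> 1" by auto
  obtain a q where aq: "p mod d = pCons a q" by (rule pCons_cases)
  with \<open>degree (p mod d) \<le> 1\<close> have "degree q = 0" by (simp split: if_splits)
  then obtain b where "q = [:b:]" by (rule degree_eq_zeroE)
  with aq have ab: "p mod d = [:a, b:]" by simp
  have "complex_eval (d * (p div d) + p mod d) z = 0"
    using assms(2) by simp
  hence "of_real a + z * of_real b = 0" using d ab by simp
  hence "b = 0" "a = 0" using assms(1) by (auto simp: complex_eq_iff)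
  thus ?thesis using ab unfolding d_def[symmetric] by (simp add: mod_eq_0_iff_dvd)
qed

text \<open>
  Half of the spectral mapping theorem. Factors \<open>x - r\<close> with \<open>r\<close> outside the spectrum and
  quadratic factors without real root give operators that are bounded below, so if \<open>p(X)\<close> is
  not bounded below then some factor \<open>x - r\<close> of \<open>p\<close> has its root in the spectrum.
\<close>

lemma root_in_real_spectrum:
  assumes X: "self_adjoint X" and "p \<noteq> 0" "\<not> bounded_below (poly_op p X)"
  shows "\<exists>x\<in>real_spectrum X. poly p x = 0"
  using assms(2,3)
proof (induction "degree p" arbitrary: p rule: less_induct)
  case less
  have step: ?case if pd: "p = d * q" and d: "bounded_below (poly_op d X)" "degree d > 0" for d q
  proof -
    have "q \<noteq> 0" "d \<noteq> 0" using less.prems(1) pd by auto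
    hence "degree q < degree p" using d(2) pd by (simp add: degree_mult_eq)
    moreover have "\<not> bounded_below (poly_op q X)"
      using less.prems(2) d(1) bounded_below_compose unfolding pd poly_op_mult by blast
    ultimately have "\<exists>x\<in>real_spectrum X. poly q x = 0"
      using \<open>q \<noteq> 0\<close> by (intro less.hyps)
    thus ?thesis using pd by auto
  qed
  have "degree p > 0"
  proof (rule ccontr)
    assume "\<not> degree p > 0"
    then obtain a where a: "p = [:a:]" by (auto elim: degree_eq_zeroE)
    hence "bounded_below (poly_op p X)"
      using less.prems(1) by (auto simp: bounded_below_def intro!: exI[of _ "\<bar>a\<bar>"])
    thus False using less.prems(2) by simp
  qed
  then obtain z where z: "complex_eval p z = 0" by (rule complex_root_exists)
  show ?case
  proof (cases "Im z = 0")
    case True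
    define r where "r = Re z"
    have "z = of_real r" using True by (simp add: r_def complex_eq_iff)
    hence r: "poly p r = 0" using z by simp
    then obtain q where q: "p = [:- r, 1:] * q" by (auto simp: poly_eq_0_iff_dvd elim: dvdE)
    show ?thesis
    proof (cases "r \<in> real_spectrum X")
      case False
      hence "bounded_below (poly_op [:- r, 1:] X)"
        unfolding poly_op_linear by (simp add: real_spectrum_iff[OF X])
      thus ?thesis by (intro step[OF q]) auto
    qed (use r in blast)
  next
    case False
    define a b where "a = Re z" and "b = Im z"
    obtain q where q: "p = [:a\<^sup>2 + b\<^sup>2, - 2 * a, 1:] * q"
      using quadratic_dvd_of_complex_root[OF False z] by (auto simp: a_def b_def elim: dvdE)
    have eq: "poly_op [:a\<^sup>2 + b\<^sup>2, - 2 * a, 1:] X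
        = ((X - a *\<^sub>R id_blinfun) o\<^sub>L (X - a *\<^sub>R id_blinfun)) + b\<^sup>2 *\<^sub>R id_blinfun"
    proof (rule blinfun_eqI)
      fix v
      have "(2 * a) *\<^sub>R X v = a *\<^sub>R X v + a *\<^sub>R X v"
        by (simp flip: scaleR_add_left)
      thus "poly_op [:a\<^sup>2 + b\<^sup>2, - 2 * a, 1:] X v
        = (((X - a *\<^sub>R id_blinfun) o\<^sub>L (X - a *\<^sub>R id_blinfun)) + b\<^sup>2 *\<^sub>R id_blinfun) v"
        by (simp add: blinfun.add_right blinfun.diff_right blinfun.scaleR_right blinfun.minus_right
            scaleR_add_left scaleR_diff_right power2_eq_square)
    qed
    have "bounded_below (poly_op [:a\<^sup>2 + b\<^sup>2, - 2 * a, 1:] X)"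
      unfolding eq using False shifted_square_coercive[OF X, of b _ a]
      by (intro coercive_bounded_below[where e = "b\<^sup>2"]) (auto simp: b_def)
    thus ?thesis by (intro step[OF q]) auto
  qed
qed

text \<open>The form is nonnegative at \<open>v - s T v\<close>; take \<open>s = 1 / \<parallel>T\<parallel>\<close>.\<close>

lemma norm_le_of_nonneg_form:
  assumes T: "self_adjoint T" and nonneg: "\<And>v. 0 \<le> inner (T v) v"
  shows "(norm (T v))\<^sup>2 \<le> norm T * inner (T v) v"
proof (cases "T = 0")
  case False
  define s where "s = 1 / norm T"
  have s: "s > 0" "s * norm T = 1" using False by (auto simp: s_def)
  have "inner (T (T v)) (T v) \<le> norm T * (norm (T v))\<^sup>2"
  proof -
    have "inner (T (T v)) (T v) \<le> norm (T (T v)) * norm (T v)" by (rule norm_cauchy_schwarz)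
    also have "\<dots> \<le> (norm T * norm (T v)) * norm (T v)"
      by (intro mult_right_mono norm_blinfun) auto
    finally show ?thesis by (simp add: power2_eq_square mult.assoc)
  qed
  hence "s\<^sup>2 * inner (T (T v)) (T v) \<le> s\<^sup>2 * (norm T * (norm (T v))\<^sup>2)"
    by (intro mult_left_mono) auto
  also have "\<dots> = s * (norm (T v))\<^sup>2"
    using s(2) by (metis mult.assoc mult.right_neutral power2_eq_square)
  finally have *: "s\<^sup>2 * inner (T (T v)) (T v) \<le> s * (norm (T v))\<^sup>2" .
  have "0 \<le> inner (T (v - s *\<^sub>R T v)) (v - s *\<^sub>R T v)" by (rule nonneg)
  also have "\<dots> = inner (T v) v - 2 * (s * (norm (T v))\<^sup>2) + s\<^sup>2 * inner (T (T v)) (T v)"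
    unfolding power2_norm_eq_inner using self_adjoint_inner[OF T, of "T v" v]
    by (simp add: blinfun.diff_right blinfun.scaleR_right inner_diff_left inner_diff_right
        inner_commute power2_eq_square algebra_simps)
  finally have "s * (norm (T v))\<^sup>2 \<le> inner (T v) v" using * by linarith
  hence "norm T * (s * (norm (T v))\<^sup>2) \<le> norm T * inner (T v) v" by (intro mult_left_mono) auto
  thus ?thesis using s(2) by (simp add: mult.assoc[symmetric] mult.commute)
qed simp

text \<open>
  The lower end \<open>m\<close> of the numerical range of \<open>T\<close> is an approximate eigenvalue: the nonnegative form
  of \<open>T - m\<close> tends to zero along a minimizing sequence of unit vectors, hence so does \<open>(T - m) v\<close>.
\<close>

lemma numerical_range_minimum:
  fixes T :: "'a :: complex_hilbert op"
  assumes T: "self_adjoint T" and nontriv: "\<exists>v :: 'a. v \<noteq> 0"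
  obtains m where "\<And>v. m * (norm v)\<^sup>2 \<le> inner (T v) v" "m \<in> real_spectrum T"
proof -
  define R where "R = (\<lambda>v. inner (T v) v) ` {v. norm v = 1}"
  obtain w :: 'a where w: "w \<noteq> 0" using nontriv by blast
  hence "norm (w /\<^sub>R norm w) = 1" by simp
  hence ne: "R \<noteq> {}" unfolding R_def by blast
  have "- norm T \<le> inner (T v) v" if "norm v = 1" for v
  proof -
    have "\<bar>inner (T v) v\<bar> \<le> norm (T v) * norm v" by (rule Cauchy_Schwarz_ineq2)
    also have "\<dots> \<le> norm T" using norm_blinfun[of T v] that by simp
    finally show ?thesis by linarith
  qed
  hence bdd: "bdd_below R" unfolding R_def by (intro bdd_belowI[of _ "- norm T"]) auto
  define m where "m = Inf R"
  have m: "m * (norm v)\<^sup>2 \<le> inner (T v) v" for v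
  proof (cases "v = 0")
    case False
    have "inner (T (v /\<^sub>R norm v)) (v /\<^sub>R norm v) \<in> R"
      unfolding R_def using False by (intro imageI) simp
    hence "m \<le> inner (T (v /\<^sub>R norm v)) (v /\<^sub>R norm v)"
      unfolding m_def using bdd by (rule cInf_lower)
    also have "\<dots> = inner (T v) v / (norm v)\<^sup>2"
      by (simp add: blinfun.scaleR_right power2_eq_square divide_inverse algebra_simps)
    finally show ?thesis using False by (simp add: pos_le_divide_eq)
  qed simp
  define T' where "T' = T - m *\<^sub>R id_blinfun"
  have T': "self_adjoint T'" "\<And>v. 0 \<le> inner (T' v) v"
    using T m by (auto simp: T'_def inner_diff_left power2_norm_eq_inner)
  have "\<not> bounded_below T'"
  proof
    assume "bounded_below T'"
    then obtain c where c: "c > 0" "\<And>v. c * norm v \<le> norm (T' v)"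
      by (auto simp: bounded_below_def)
    define e where "e = c\<^sup>2 / (norm T' + 1)"
    have e: "e > 0" using c by (auto simp: e_def add_nonneg_pos)
    have "\<exists>x\<in>R. x < m + e" using cInf_lessD[OF ne, of "m + e"] e unfolding m_def by simp
    then obtain v where v: "norm v = 1" "inner (T v) v < m + e" by (auto simp: R_def)
    hence *: "inner (T' v) v < e"
      by (simp add: T'_def inner_diff_left power2_norm_eq_inner[symmetric])
    have "c\<^sup>2 \<le> (norm (T' v))\<^sup>2" using c(2)[of v] c(1) v by (intro power_mono) auto
    also have "\<dots> \<le> norm T' * inner (T' v) v" by (rule norm_le_of_nonneg_form[OF T'])
    also have "\<dots> \<le> (norm T' + 1) * inner (T' v) v" by (intro mult_right_mono T') auto
    also have "\<dots> < (norm T' + 1) * e" using * by (intro mult_strict_left_mono) (auto simp: add_nonneg_pos)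
    also have "\<dots> = c\<^sup>2" by (simp add: e_def add_nonneg_eq_0_iff)
    finally show False by simp
  qed
  hence "m \<in> real_spectrum T" by (simp add: real_spectrum_iff[OF T] T'_def)
  with m show ?thesis by (rule that)
qed

text \<open>
  The minimum \<open>m\<close> of the numerical range of \<open>q(X)\<close> makes \<open>q(X) - m\<close> fail to be bounded below, so
  \<open>m\<close> is a value of \<open>q\<close> on the spectrum.
\<close>

lemma poly_op_nonneg:
  fixes X :: "'a :: complex_hilbert op"
  assumes X: "self_adjoint X" and q: "\<And>x. x \<in> real_spectrum X \<Longrightarrow> 0 \<le> poly q x"
  shows "0 \<le> inner (poly_op q X v) v"
proof (cases "\<exists>v :: 'a. v \<noteq> 0")
  case True
  obtain m where m: "\<And>v. m * (norm v)\<^sup>2 \<le> inner (poly_op q X v) v"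
      "m \<in> real_spectrum (poly_op q X)"
    using numerical_range_minimum[OF self_adjoint_poly_op[OF X] True] by blast
  have "\<exists>x\<in>real_spectrum X. poly q x = m"
  proof (cases "q = [:m:]")
    case True
    obtain x where "x \<in> real_spectrum X"
      using numerical_range_minimum[OF X \<open>\<exists>v :: 'a. v \<noteq> 0\<close>] by blast
    thus ?thesis using True by auto
  next
    case False
    have "\<not> bounded_below (poly_op (q - [:m:]) X)"
      using m(2) X by (simp add: real_spectrum_iff poly_op_diff poly_op_const)
    moreover have "q - [:m:] \<noteq> 0" using False by simp
    ultimately obtain x where "x \<in> real_spectrum X" "poly (q - [:m:]) x = 0"
      using root_in_real_spectrum[OF X] by blast
    thus ?thesis by auto
  qed
  hence "0 \<le> m" using q by auto
  hence "0 \<le> m * (norm v)\<^sup>2" by simp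
  thus ?thesis using m(1)[of v] by linarith
next
  case False
  hence "v = 0" by blast
  thus ?thesis by simp
qed

text \<open>Positivity of \<open>M\<^sup>2 - p\<^sup>2\<close> on the spectrum says that \<open>\<parallel>p(X) v\<parallel> \<le> M \<parallel>v\<parallel>\<close>.\<close>

lemma norm_poly_op_le:
  assumes X: "self_adjoint X" and M: "0 \<le> M" "\<And>x. x \<in> real_spectrum X \<Longrightarrow> \<bar>poly p x\<bar> \<le> M"
  shows "norm (poly_op p X) \<le> M"
proof (rule norm_blinfun_bound[OF M(1)])
  fix v
  have "0 \<le> inner (poly_op ([:M\<^sup>2:] - p * p) X v) v"
  proof (rule poly_op_nonneg[OF X])
    fix x assume "x \<in> real_spectrum X"
    hence "\<bar>poly p x\<bar>\<^sup>2 \<le> M\<^sup>2" using M by (intro power_mono) auto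
    thus "0 \<le> poly ([:M\<^sup>2:] - p * p) x" by (simp add: power2_eq_square)
  qed
  also have "\<dots> = M\<^sup>2 * inner v v - inner (poly_op p X (poly_op p X v)) v"
    by (simp only: poly_op_diff poly_op_mult poly_op_const blinfun_apply_diff blinfun_apply_scaleR
        blinfun_apply_id_blinfun blinfun_apply_blinfun_compose inner_diff_left inner_scaleR_left)
  also have "inner (poly_op p X (poly_op p X v)) v = inner (poly_op p X v) (poly_op p X v)"
    by (rule self_adjoint_inner[OF self_adjoint_poly_op[OF X]])
  also have "M\<^sup>2 * inner v v - inner (poly_op p X v) (poly_op p X v)
      = (M * norm v)\<^sup>2 - (norm (poly_op p X v))\<^sup>2"
    by (simp only: power_mult_distrib power2_norm_eq_inner)
  finally have "(norm (poly_op p X v))\<^sup>2 \<le> (M * norm v)\<^sup>2" by linarith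
  thus "norm (poly_op p X v) \<le> M * norm v"
    by (rule power2_le_imp_le) (simp add: M(1))
qed

lemma real_spectrum_bounds:
  assumes X: "self_adjoint X"
    and lo: "\<And>v. m * (norm v)\<^sup>2 \<le> inner (X v) v" and hi: "\<And>v. inner (X v) v \<le> M * (norm v)\<^sup>2"
  shows "real_spectrum X \<subseteq> {m..M}"
proof
  fix x assume x: "x \<in> real_spectrum X"
  show "x \<in> {m..M}"
  proof (rule ccontr)
    assume "x \<notin> {m..M}"
    then consider "x < m" | "M < x" by force
    hence "bounded_below (X - x *\<^sub>R id_blinfun)"
    proof cases
      case 1
      thus ?thesis using lo
        by (intro coercive_bounded_below[where e = "m - x"])
          (auto simp: inner_diff_left power2_norm_eq_inner algebra_simps)
    next
      case 2
      hence "bounded_below (x *\<^sub>R id_blinfun - X)" using hi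
        by (intro coercive_bounded_below[where e = "x - M"])
          (auto simp: inner_diff_left power2_norm_eq_inner algebra_simps)
      thus ?thesis by (simp add: bounded_below_def norm_minus_commute)
    qed
    thus False using x by (simp add: real_spectrum_iff[OF X])
  qed
qed

lemma inner_ge_of_real_spectrum:
  assumes X: "self_adjoint X" and "\<And>x. x \<in> real_spectrum X \<Longrightarrow> m \<le> x"
  shows "m * (norm v)\<^sup>2 \<le> inner (X v) v"
  using poly_op_nonneg[OF X, of "[:- m, 1:]" v] assms(2)
  by (simp add: poly_op_linear inner_diff_left power2_norm_eq_inner)

lemma inner_le_of_real_spectrum:
  assumes X: "self_adjoint X" and "\<And>x. x \<in> real_spectrum X \<Longrightarrow> x \<le> M"
  shows "inner (X v) v \<le> M * (norm v)\<^sup>2"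
  using poly_op_nonneg[OF X, of "[:M, - 1:]" v] assms(2)
  by (simp add: blinfun.minus_right inner_diff_left power2_norm_eq_inner)

lemma compact_real_spectrum:
  assumes X: "self_adjoint X"
  shows "compact (real_spectrum X)"
proof -
  have "\<bar>inner (X v) v\<bar> \<le> norm X * (norm v)\<^sup>2" for v
  proof -
    have "\<bar>inner (X v) v\<bar> \<le> norm (X v) * norm v" by (rule Cauchy_Schwarz_ineq2)
    also have "\<dots> \<le> (norm X * norm v) * norm v" by (intro mult_right_mono norm_blinfun) auto
    finally show ?thesis by (simp add: power2_eq_square mult.assoc)
  qed
  hence "inner (X v) v \<le> norm X * (norm v)\<^sup>2" "- norm X * (norm v)\<^sup>2 \<le> inner (X v) v" for v
    by (simp_all add: abs_le_iff minus_le_iff)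
  hence "real_spectrum X \<subseteq> {- norm X..norm X}" by (intro real_spectrum_bounds[OF X])
  hence "bounded (real_spectrum X)" by (rule bounded_subset[OF bounded_closed_interval])
  moreover have "open (- real_spectrum X)"
    unfolding open_dist
  proof
    fix x assume "x \<in> - real_spectrum X"
    hence "bounded_below (X - x *\<^sub>R id_blinfun)" by (simp add: real_spectrum_iff[OF X])
    then obtain c where c: "c > 0" "\<And>v. c * norm v \<le> norm ((X - x *\<^sub>R id_blinfun) v)"
      unfolding bounded_below_def by blast
    have "y \<in> - real_spectrum X" if y: "dist y x < c" for y
    proof -
      have "(c - \<bar>y - x\<bar>) * norm v \<le> norm ((X - y *\<^sub>R id_blinfun) v)" for v
      proof -
        have "norm ((X - x *\<^sub>R id_blinfun) v)
            = norm ((X - y *\<^sub>R id_blinfun) v + (y - x) *\<^sub>R v)"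
          by (simp add: algebra_simps)
        also have "\<dots> \<le> norm ((X - y *\<^sub>R id_blinfun) v) + \<bar>y - x\<bar> * norm v"
          using norm_triangle_ineq[of "(X - y *\<^sub>R id_blinfun) v" "(y - x) *\<^sub>R v"] by simp
        finally show ?thesis using c(2)[of v] by (simp add: algebra_simps)
      qed
      moreover have "0 < c - \<bar>y - x\<bar>" using y by (simp add: dist_real_def)
      ultimately have "bounded_below (X - y *\<^sub>R id_blinfun)" unfolding bounded_below_def by blast
      thus ?thesis by (simp add: real_spectrum_iff[OF X])
    qed
    thus "\<exists>e>0. \<forall>y. dist y x < e \<longrightarrow> y \<in> - real_spectrum X" using c(1) by blast
  qed
  ultimately show ?thesis by (simp add: compact_eq_bounded_closed closed_def)
qed

section \<open>The continuous functional calculus\<close>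

lemma uniform_limit_polys:
  fixes f :: "real \<Rightarrow> real"
  assumes "compact K" "continuous_on K f"
  obtains p :: "nat \<Rightarrow> real poly" where "uniform_limit K (\<lambda>n. poly (p n)) f sequentially"
proof -
  have "\<exists>p. \<forall>x\<in>K. \<bar>f x - poly p x\<bar> < inverse (real (Suc n))" for n
  proof -
    obtain g where g: "real_polynomial_function g"
        "\<And>x. x \<in> K \<Longrightarrow> \<bar>f x - g x\<bar> < inverse (real (Suc n))"
      using Stone_Weierstrass_real_polynomial_function[OF assms, of "inverse (real (Suc n))"] by auto
    obtain a k where "g = (\<lambda>x. \<Sum>i\<le>k. a i * x ^ i)"
      using g(1) by (auto simp: real_polynomial_function_iff_sum)
    hence "poly (\<Sum>i\<le>k. monom (a i) i) = g"
      by (simp add: fun_eq_iff poly_sum poly_monom)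
    thus ?thesis using g(2) by blast
  qed
  then obtain p where p: "\<And>n x. x \<in> K \<Longrightarrow> \<bar>f x - poly (p n) x\<bar> < inverse (real (Suc n))"
    by metis
  have "uniform_limit K (\<lambda>n. poly (p n)) f sequentially"
  proof (rule uniform_limitI)
    fix e :: real assume "e > 0"
    with LIMSEQ_inverse_real_of_nat have "\<forall>\<^sub>F n in sequentially. inverse (real (Suc n)) < e"
      by (rule order_tendstoD)
    thus "\<forall>\<^sub>F n in sequentially. \<forall>x\<in>K. dist (poly (p n) x) (f x) < e"
    proof (rule eventually_mono, intro ballI)
      fix n x assume "inverse (real (Suc n)) < e" "x \<in> K"
      thus "dist (poly (p n) x) (f x) < e"
        using p[of x n] by (simp add: dist_real_def abs_minus_commute)
    qed
  qed
  thus ?thesis by (rule that)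
qed

lemma norm_poly_op_diff_le:
  assumes "self_adjoint X" "0 \<le> M" "\<And>x. x \<in> real_spectrum X \<Longrightarrow> \<bar>poly p x - poly q x\<bar> \<le> M"
  shows "norm (poly_op p X - poly_op q X) \<le> M"
  using norm_poly_op_le[OF assms(1,2), of "p - q"] assms(3) by (simp add: poly_op_diff)

lemma poly_op_uniform_limits_close:
  assumes X: "self_adjoint X"
    and p: "uniform_limit (real_spectrum X) (\<lambda>n. poly (p n)) f sequentially"
    and q: "uniform_limit (real_spectrum X) (\<lambda>n. poly (q n)) f sequentially"
    and e: "e > 0"
  obtains N where "\<And>m n. m \<ge> N \<Longrightarrow> n \<ge> N \<Longrightarrow> norm (poly_op (p m) X - poly_op (q n) X) < e"
proof -
  have "\<forall>\<^sub>F n in sequentially. \<forall>x\<in>real_spectrum X. dist (poly (p n) x) (f x) < e / 4"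
       "\<forall>\<^sub>F n in sequentially. \<forall>x\<in>real_spectrum X. dist (poly (q n) x) (f x) < e / 4"
    by (rule uniform_limitD[OF p], use e in simp) (rule uniform_limitD[OF q], use e in simp)
  then obtain N1 N2 where
      N1: "\<And>n x. n \<ge> N1 \<Longrightarrow> x \<in> real_spectrum X \<Longrightarrow> dist (poly (p n) x) (f x) < e / 4" and
      N2: "\<And>n x. n \<ge> N2 \<Longrightarrow> x \<in> real_spectrum X \<Longrightarrow> dist (poly (q n) x) (f x) < e / 4"
    unfolding eventually_sequentially by blast
  have "norm (poly_op (p m) X - poly_op (q n) X) < e" if "m \<ge> max N1 N2" "n \<ge> max N1 N2" for m n
  proof -
    have "norm (poly_op (p m) X - poly_op (q n) X) \<le> e / 2"
    proof (rule norm_poly_op_diff_le[OF X])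
      fix x assume "x \<in> real_spectrum X"
      hence "dist (poly (p m) x) (f x) < e / 4" "dist (poly (q n) x) (f x) < e / 4"
        using N1[of m x] N2[of n x] that by auto
      thus "\<bar>poly (p m) x - poly (q n) x\<bar> \<le> e / 2"
        unfolding dist_real_def by linarith
    qed (use e in auto)
    thus ?thesis using e by simp
  qed
  thus ?thesis by (rule that)
qed

text \<open>
  The description that defines \<open>f(X)\<close> is satisfied by exactly one operator: by the norm bound for
  polynomials, uniform convergence on the spectrum makes \<open>p\<^sub>n(X)\<close> a Cauchy sequence, and interlacing
  two approximating sequences shows that their limits agree.
\<close>

lemma fun_calc_tendsto:
  assumes X: "self_adjoint X" and f: "continuous_on (real_spectrum X) f"
    and p: "uniform_limit (real_spectrum X) (\<lambda>n. poly (p n)) f sequentially"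
  shows "(\<lambda>n. poly_op (p n) X) \<longlonglongrightarrow> fun_calc f X"
proof -
  define Q where "Q = (\<lambda>Y. \<forall>p. uniform_limit (real_spectrum X) (\<lambda>n. poly (p n)) f sequentially
               \<longrightarrow> (\<lambda>n. poly_op (p n) X) \<longlonglongrightarrow> Y)"
  have "Cauchy (\<lambda>n. poly_op (p n) X)"
    unfolding Cauchy_def dist_norm using poly_op_uniform_limits_close[OF X p p] by metis
  then obtain Y where Y: "(\<lambda>n. poly_op (p n) X) \<longlonglongrightarrow> Y"
    by (auto simp: Cauchy_convergent_iff convergent_def)
  have "(\<lambda>n. poly_op (q n) X) \<longlonglongrightarrow> Y"
    if q: "uniform_limit (real_spectrum X) (\<lambda>n. poly (q n)) f sequentially" for q
  proof -
    have "(\<lambda>n. poly_op (q n) X - poly_op (p n) X) \<longlonglongrightarrow> 0"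
      unfolding LIMSEQ_iff using poly_op_uniform_limits_close[OF X q p] by (metis diff_zero)
    from tendsto_add[OF this Y] show ?thesis by simp
  qed
  hence "Q Y" by (simp add: Q_def)
  moreover have "Z = Y" if "Q Z" for Z
    using that p Y by (auto simp: Q_def intro: LIMSEQ_unique)
  ultimately have "Q (THE Y. Q Y)" by (rule theI)
  thus ?thesis using p by (simp add: Q_def fun_calc_on_def real_spectrum_def)
qed

lemma fun_calc_limit:
  assumes X: "self_adjoint X" and f: "continuous_on (real_spectrum X) f"
  obtains p where "uniform_limit (real_spectrum X) (\<lambda>n. poly (p n)) f sequentially"
    "(\<lambda>n. poly_op (p n) X) \<longlonglongrightarrow> fun_calc f X"
  using uniform_limit_polys[OF compact_real_spectrum[OF X] f] fun_calc_tendsto[OF X f] by metis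

lemma self_adjoint_fun_calc:
  assumes X: "self_adjoint X" and f: "continuous_on (real_spectrum X) f"
  shows "self_adjoint (fun_calc f X)"
  using fun_calc_limit[OF assms] self_adjoint_limit self_adjoint_poly_op[OF X] by metis

lemma fun_calc_approx:
  assumes X: "self_adjoint X" and f: "continuous_on (real_spectrum X) f"
    and e: "0 \<le> e" "\<And>x. x \<in> real_spectrum X \<Longrightarrow> \<bar>f x - poly q x\<bar> \<le> e"
  shows "norm (fun_calc f X - poly_op q X) \<le> e"
proof (rule field_le_epsilon)
  fix d :: real assume d: "d > 0"
  obtain p where p: "uniform_limit (real_spectrum X) (\<lambda>n. poly (p n)) f sequentially"
    "(\<lambda>n. poly_op (p n) X) \<longlonglongrightarrow> fun_calc f X"
    using fun_calc_limit[OF X f] .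
  have lim: "(\<lambda>n. norm (poly_op (p n) X - poly_op q X)) \<longlonglongrightarrow> norm (fun_calc f X - poly_op q X)"
    by (intro tendsto_intros p)
  have "\<forall>\<^sub>F n in sequentially. \<forall>x\<in>real_spectrum X. dist (poly (p n) x) (f x) < d"
    by (rule uniform_limitD[OF p(1) d])
  hence "\<forall>\<^sub>F n in sequentially. norm (poly_op (p n) X - poly_op q X) \<le> e + d"
  proof (rule eventually_mono)
    fix n assume n: "\<forall>x\<in>real_spectrum X. dist (poly (p n) x) (f x) < d"
    show "norm (poly_op (p n) X - poly_op q X) \<le> e + d"
    proof (rule norm_poly_op_diff_le[OF X])
      fix x assume x: "x \<in> real_spectrum X"
      show "\<bar>poly (p n) x - poly q x\<bar> \<le> e + d"
        using bspec[OF n x] e(2)[OF x] by (simp add: dist_real_def)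
    qed (use e d in auto)
  qed
  thus "norm (fun_calc f X - poly_op q X) \<le> e + d"
    using lim by (intro tendsto_upperbound[OF lim]) auto
qed

lemma fun_calc_cong:
  assumes "\<And>x. x \<in> real_spectrum X \<Longrightarrow> f x = g x"
  shows "fun_calc f X = fun_calc g X"
proof -
  have "uniform_limit (real_spectrum X) h f sequentially
      \<longleftrightarrow> uniform_limit (real_spectrum X) h g sequentially" for h :: "nat \<Rightarrow> real \<Rightarrow> real"
    by (rule uniform_limit_cong') (auto simp: assms)
  thus ?thesis by (simp add: fun_calc_on_def flip: real_spectrum_def)
qed

lemma fun_calc_ident:
  assumes "self_adjoint X"
  shows "fun_calc (\<lambda>x. x) X = X"
  using fun_calc_approx[OF assms continuous_on_id, of 0 "[:0, 1:]"]
  by (simp add: blinfun_eq_iff)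

lemma fun_calc_const:
  assumes "self_adjoint X"
  shows "fun_calc (\<lambda>_. c) X = c *\<^sub>R id_blinfun"
  using fun_calc_approx[OF assms continuous_on_const, of 0 c "[:c:]"]
  by (simp add: poly_op_const)

lemma fun_calc_mult:
  assumes X: "self_adjoint X" and f: "continuous_on (real_spectrum X) f"
    and g: "continuous_on (real_spectrum X) g"
  shows "fun_calc f X o\<^sub>L fun_calc g X = fun_calc (\<lambda>x. f x * g x) X"
proof -
  obtain p where p: "uniform_limit (real_spectrum X) (\<lambda>n. poly (p n)) f sequentially"
    "(\<lambda>n. poly_op (p n) X) \<longlonglongrightarrow> fun_calc f X"
    using fun_calc_limit[OF X f] .
  obtain q where q: "uniform_limit (real_spectrum X) (\<lambda>n. poly (q n)) g sequentially"
    "(\<lambda>n. poly_op (q n) X) \<longlonglongrightarrow> fun_calc g X"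
    using fun_calc_limit[OF X g] .
  have "bounded (f ` real_spectrum X)" "bounded (g ` real_spectrum X)"
    using compact_continuous_image[OF f] compact_continuous_image[OF g] compact_real_spectrum[OF X]
    by (auto simp: compact_imp_bounded)
  hence "uniform_limit (real_spectrum X) (\<lambda>n. poly (p n * q n)) (\<lambda>x. f x * g x) sequentially"
    using uniform_lim_mult[OF p(1) q(1)] by (simp add: poly_mult[abs_def] poly_mult cong: uniform_limit_cong')
  hence "(\<lambda>n. poly_op (p n * q n) X) \<longlonglongrightarrow> fun_calc (\<lambda>x. f x * g x) X"
    by (intro fun_calc_tendsto[OF X] continuous_intros f g)
  moreover have "(\<lambda>n. poly_op (p n * q n) X) \<longlonglongrightarrow> (fun_calc f X o\<^sub>L fun_calc g X)"
    unfolding poly_op_mult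
    by (rule bounded_bilinear.tendsto[OF bounded_bilinear_blinfun_compose p(2) q(2)])
  ultimately show ?thesis by (intro LIMSEQ_unique)
qed

text \<open>
  The functional calculus commutes with every map that intertwines the operators. This one fact
  covers unitary conjugation, restriction to an invariant subspace and block diagonal operators.
\<close>

lemma fun_calc_intertwine:
  fixes C :: "'a :: complex_hilbert \<Rightarrow>\<^sub>L 'b :: complex_hilbert"
  assumes X: "self_adjoint X" and Y: "self_adjoint Y" and YC: "Y o\<^sub>L C = C o\<^sub>L X"
    and f: "continuous_on (real_spectrum X \<union> real_spectrum Y) f"
  shows "fun_calc f Y o\<^sub>L C = C o\<^sub>L fun_calc f X"
proof -
  obtain p where p: "uniform_limit (real_spectrum X \<union> real_spectrum Y) (\<lambda>n. poly (p n)) f sequentially"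
    using uniform_limit_polys[OF compact_Un f] compact_real_spectrum[OF X] compact_real_spectrum[OF Y]
    by metis
  have pX: "(\<lambda>n. poly_op (p n) X) \<longlonglongrightarrow> fun_calc f X"
    by (rule fun_calc_tendsto[OF X]) (auto intro: continuous_on_subset[OF f] uniform_limit_on_subset[OF p])
  have pY: "(\<lambda>n. poly_op (p n) Y) \<longlonglongrightarrow> fun_calc f Y"
    by (rule fun_calc_tendsto[OF Y]) (auto intro: continuous_on_subset[OF f] uniform_limit_on_subset[OF p])
  have "(\<lambda>n. poly_op (p n) Y o\<^sub>L C) \<longlonglongrightarrow> (fun_calc f Y o\<^sub>L C)"
    by (rule bounded_bilinear.tendsto[OF bounded_bilinear_blinfun_compose pY tendsto_const])
  moreover have "(\<lambda>n. C o\<^sub>L poly_op (p n) X) \<longlonglongrightarrow> (C o\<^sub>L fun_calc f X)"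
    by (rule bounded_bilinear.tendsto[OF bounded_bilinear_blinfun_compose tendsto_const pX])
  ultimately show ?thesis
    unfolding poly_op_intertwine[OF YC] by (rule LIMSEQ_unique)
qed

lemma tendsto_poly_op:
  assumes "X \<longlonglongrightarrow> Y"
  shows "(\<lambda>n. poly_op p (X n)) \<longlonglongrightarrow> poly_op p Y"
proof (induction p)
  case (pCons a p)
  have eq: "poly_op (pCons a p) Z = a *\<^sub>R id_blinfun + (Z o\<^sub>L poly_op p Z)" for Z :: "'a op"
    by (simp add: blinfun_eq_iff)
  show ?case unfolding eq
    by (intro tendsto_intros bounded_bilinear.tendsto[OF bounded_bilinear_blinfun_compose]
        assms pCons.IH)
qed simp

lemma spectral_enclosure:
  fixes X :: "'a :: complex_hilbert op"
  assumes X: "self_adjoint X" and nontriv: "\<exists>v :: 'a. v \<noteq> 0"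
  obtains m M where "m \<in> real_spectrum X" "M \<in> real_spectrum X" "real_spectrum X \<subseteq> {m..M}"
proof -
  have "real_spectrum X \<noteq> {}"
    using numerical_range_minimum[OF X nontriv] by blast
  then obtain m M where "m \<in> real_spectrum X" "M \<in> real_spectrum X"
      "\<forall>x\<in>real_spectrum X. m \<le> x" "\<forall>x\<in>real_spectrum X. x \<le> M"
    using compact_attains_inf compact_attains_sup compact_real_spectrum[OF X] by metis
  thus ?thesis by (intro that[of m M]) auto
qed

text \<open>
  Spectra of operators near \<open>Y\<close> stay near the spectrum of \<open>Y\<close>. If this spectrum reaches an
  endpoint of \<open>J\<close>, then it is the hypothesis on the other spectra that keeps them inside.
\<close>

lemma spectra_eventually_in_compact_interval:
  fixes X :: "nat \<Rightarrow> 'a :: complex_hilbert op"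
  assumes X: "\<And>n. self_adjoint (X n)" "X \<longlonglongrightarrow> Y" "\<And>n. real_spectrum (X n) \<subseteq> J"
    and Y: "real_spectrum Y \<subseteq> J" and nontriv: "\<exists>v :: 'a. v \<noteq> 0"
  obtains a b where "a \<in> J" "b \<in> J" "real_spectrum Y \<subseteq> {a..b}"
    "\<forall>\<^sub>F n in sequentially. real_spectrum (X n) \<subseteq> {a..b}"
proof -
  have saY: "self_adjoint Y" using self_adjoint_limit X by blast
  obtain m M where mM: "m \<in> real_spectrum Y" "M \<in> real_spectrum Y" "real_spectrum Y \<subseteq> {m..M}"
    using spectral_enclosure[OF saY nontriv] .
  have form: "m * (norm v)\<^sup>2 \<le> inner (Y v) v" "inner (Y v) v \<le> M * (norm v)\<^sup>2" for v
    using mM(3) by (auto intro!: inner_ge_of_real_spectrum[OF saY] inner_le_of_real_spectrum[OF saY])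
  have near: "\<forall>\<^sub>F n in sequentially. real_spectrum (X n) \<subseteq> {m - d..M + d}" if "d > 0" for d
  proof -
    have "\<forall>\<^sub>F n in sequentially. norm (X n - Y) < d"
      using X(2) that by (simp add: tendsto_iff dist_norm)
    thus ?thesis
    proof (rule eventually_mono)
      fix n assume n: "norm (X n - Y) < d"
      have *: "\<bar>inner ((X n - Y) v) v\<bar> \<le> d * (norm v)\<^sup>2" for v
      proof -
        have "\<bar>inner ((X n - Y) v) v\<bar> \<le> norm ((X n - Y) v) * norm v" by (rule Cauchy_Schwarz_ineq2)
        also have "\<dots> \<le> (norm (X n - Y) * norm v) * norm v" by (intro mult_right_mono norm_blinfun) auto
        also have "\<dots> \<le> (d * norm v) * norm v" using n by (intro mult_right_mono) auto
        finally show ?thesis by (simp add: power2_eq_square mult.assoc)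
      qed
      show "real_spectrum (X n) \<subseteq> {m - d..M + d}"
      proof (rule real_spectrum_bounds[OF X(1)])
        fix v
        have **: "\<bar>inner (X n v) v - inner (Y v) v\<bar> \<le> d * (norm v)\<^sup>2"
          using *[of v] by (simp add: inner_diff_left)
        show "(m - d) * (norm v)\<^sup>2 \<le> inner (X n v) v" "inner (X n v) v \<le> (M + d) * (norm v)\<^sup>2"
          using form[of v] ** by (auto simp: algebra_simps abs_le_iff)
      qed
    qed
  qed
  obtain a where a: "a \<in> J" "a \<le> m" "\<forall>\<^sub>F n in sequentially. real_spectrum (X n) \<subseteq> {a..}"
  proof (cases "\<exists>a\<in>J. a < m")
    case True
    then obtain a where a: "a \<in> J" "a < m" by blast
    have "\<forall>\<^sub>F n in sequentially. real_spectrum (X n) \<subseteq> {a..}"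
      using near[of "m - a"] a by (auto elim!: eventually_mono)
    thus ?thesis using a by (intro that[of a]) auto
  next
    case False
    have "real_spectrum (X n) \<subseteq> {m..}" for n using X(3)[of n] False by force
    thus ?thesis using Y mM by (intro that[of m]) auto
  qed
  obtain b where b: "b \<in> J" "M \<le> b" "\<forall>\<^sub>F n in sequentially. real_spectrum (X n) \<subseteq> {..b}"
  proof (cases "\<exists>b\<in>J. M < b")
    case True
    then obtain b where b: "b \<in> J" "M < b" by blast
    have "\<forall>\<^sub>F n in sequentially. real_spectrum (X n) \<subseteq> {..b}"
      using near[of "b - M"] b by (auto elim!: eventually_mono)
    thus ?thesis using b by (intro that[of b]) auto
  next
    case False
    have "real_spectrum (X n) \<subseteq> {..M}" for n using X(3)[of n] False by force
    thus ?thesis using Y mM by (intro that[of M]) auto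
  qed
  have "\<forall>\<^sub>F n in sequentially. real_spectrum (X n) \<subseteq> {a..b}"
    using a(3) b(3) by eventually_elim auto
  moreover have "real_spectrum Y \<subseteq> {a..b}" using mM(3) a(2) b(2) by auto
  ultimately show ?thesis using a(1) b(1) that by blast
qed

lemma blinfun_eq_of_trivial:
  fixes X Y :: "'a :: real_normed_vector \<Rightarrow>\<^sub>L 'b :: real_normed_vector"
  assumes "\<not> (\<exists>v :: 'a. v \<noteq> 0)"
  shows "X = Y"
proof (rule blinfun_eqI)
  fix v :: 'a
  have "v = 0" using assms by blast
  thus "X v = Y v" by simp
qed

text \<open>
  On the compact interval that contains all relevant spectra, \<open>f\<close> is uniformly close to a polynomial
  \<open>p\<close>; then \<open>f(Z)\<close> is close to \<open>p(Z)\<close> for all these operators \<open>Z\<close>, and \<open>p(Z)\<close> is continuous in \<open>Z\<close>.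
\<close>

lemma tendsto_fun_calc:
  fixes X :: "nat \<Rightarrow> 'a :: complex_hilbert op"
  assumes X: "\<And>n. self_adjoint (X n)" "X \<longlonglongrightarrow> Y" "\<And>n. real_spectrum (X n) \<subseteq> J"
    and Y: "real_spectrum Y \<subseteq> J" and J: "is_interval J" and f: "continuous_on J f"
  shows "(\<lambda>n. fun_calc f (X n)) \<longlonglongrightarrow> fun_calc f Y"
proof (cases "\<exists>v :: 'a. v \<noteq> 0")
  case nontriv: True
  have saY: "self_adjoint Y" using self_adjoint_limit X by blast
  obtain a b where ab: "a \<in> J" "b \<in> J" "real_spectrum Y \<subseteq> {a..b}"
    "\<forall>\<^sub>F n in sequentially. real_spectrum (X n) \<subseteq> {a..b}"
    using spectra_eventually_in_compact_interval[OF X Y nontriv] .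
  have "{a..b} \<subseteq> J" using mem_is_interval_1_I[OF J ab(1,2)] by auto
  hence fab: "continuous_on {a..b} f" using f continuous_on_subset by blast
  show ?thesis
  proof (rule tendstoI)
    fix e :: real assume e: "e > 0"
    obtain p where "uniform_limit {a..b} (\<lambda>n. poly (p n)) f sequentially"
      using uniform_limit_polys[OF compact_Icc fab] .
    hence "\<forall>\<^sub>F n in sequentially. \<forall>x\<in>{a..b}. dist (poly (p n) x) (f x) < e / 3"
      by (rule uniform_limitD) (use e in simp)
    then obtain n where n: "\<forall>x\<in>{a..b}. dist (poly (p n) x) (f x) < e / 3"
      unfolding eventually_sequentially by blast
    have approx: "norm (fun_calc f Z - poly_op (p n) Z) \<le> e / 3"
      if "self_adjoint Z" "real_spectrum Z \<subseteq> {a..b}" for Z :: "'a op"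
    proof (rule fun_calc_approx[OF that(1)])
      show "continuous_on (real_spectrum Z) f" using fab that(2) by (rule continuous_on_subset)
      fix x assume "x \<in> real_spectrum Z"
      hence "dist (poly (p n) x) (f x) < e / 3" using n that(2) by blast
      thus "\<bar>f x - poly (p n) x\<bar> \<le> e / 3" by (simp add: dist_real_def abs_minus_commute)
    qed (use e in auto)
    have "\<forall>\<^sub>F k in sequentially. dist (poly_op (p n) (X k)) (poly_op (p n) Y) < e / 3"
      using tendsto_poly_op[OF X(2)] e by (intro tendstoD) auto
    with ab(4) show "\<forall>\<^sub>F k in sequentially. dist (fun_calc f (X k)) (fun_calc f Y) < e"
    proof eventually_elim
      case (elim k)
      have "fun_calc f (X k) - fun_calc f Y = (fun_calc f (X k) - poly_op (p n) (X k))
        + (poly_op (p n) (X k) - poly_op (p n) Y) - (fun_calc f Y - poly_op (p n) Y)" by simp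
      hence "norm (fun_calc f (X k) - fun_calc f Y) \<le> norm (fun_calc f (X k) - poly_op (p n) (X k))
        + norm (poly_op (p n) (X k) - poly_op (p n) Y) + norm (fun_calc f Y - poly_op (p n) Y)"
        by (simp only:) (rule order.trans[OF norm_triangle_ineq4 add_right_mono[OF norm_triangle_ineq]])
      thus ?case using approx[OF X(1) elim(1)] approx[OF saY ab(3)] elim(2)
        by (simp add: dist_norm)
    qed
  qed
next
  case False
  hence "fun_calc f (X n) = fun_calc f Y" for n by (rule blinfun_eq_of_trivial)
  thus ?thesis by simp
qed

section \<open>Jensen's operator inequality\<close>

lemma operator_convex_continuous: "operator_convex_on K J f \<Longrightarrow> continuous_on J f"
  by (simp add: operator_convex_on_def)

lemma scaleC_sum_right:
  "c *\<^sub>C (\<Sum>k\<in>K. F k) = (\<Sum>k\<in>K. c *\<^sub>C F k :: 'a :: complex_hilbert)"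
  by (rule linear_sum[OF bounded_linear.linear[OF bounded_linear_scaleC]])

lemma operator_convex_form:
  fixes X Y :: "'k :: complex_hilbert op"
  assumes f: "operator_convex_on TYPE('k) J f"
    and X: "self_adjoint X" "real_spectrum X \<subseteq> J"
    and Y: "self_adjoint Y" "real_spectrum Y \<subseteq> J"
    and c: "0 \<le> c" "c \<le> 1"
  shows "inner (fun_calc f (c *\<^sub>R X + (1 - c) *\<^sub>R Y) v) v
    \<le> c * inner (fun_calc f X v) v + (1 - c) * inner (fun_calc f Y v) v"
proof -
  have "projection (id_blinfun :: 'k op)"
    by (simp add: projection_def blinfun_eq_iff)
  moreover have "X \<in> ops_on id_blinfun" "Y \<in> ops_on id_blinfun"
    using X Y by (simp_all add: ops_on_def blinfun_eq_iff self_adjoint_complex_linear)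
  ultimately have "fun_calc f (c *\<^sub>R X + (1 - c) *\<^sub>R Y)
      \<le>\<^sub>o\<^sub>p c *\<^sub>R fun_calc f X + (1 - c) *\<^sub>R fun_calc f Y"
    using f X Y c unfolding operator_convex_on_def
    by (simp add: spectrum_subset_iff)
  thus ?thesis
    by (simp add: op_le_def positive_op_iff inner_diff_left inner_add_left)
qed

lemma inner_scaleC_right: "inner x (c *\<^sub>C y) = inner (cnj c *\<^sub>C x) (y :: 'a :: complex_hilbert)"
proof -
  have "cinner x (c *\<^sub>C y) = cinner (cnj c *\<^sub>C x) y"
    by (metis cinner_commute cinner_scaleC_left complex_cnj_mult)
  thus ?thesis by (simp add: inner_eq_Re_cinner)
qed

lemma adjoint_complex_linear:
  fixes V :: "'a :: complex_hilbert \<Rightarrow>\<^sub>L 'b :: complex_hilbert"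
  assumes adj: "\<And>x y. inner (V x) y = inner x (W y)" and cl: "\<And>c x. V (c *\<^sub>C x) = c *\<^sub>C V x"
  shows "W (c *\<^sub>C y) = c *\<^sub>C W y"
proof (rule vector_eq_ldot[THEN iffD1], intro allI)
  fix x
  have "inner x (W (c *\<^sub>C y)) = inner (V (cnj c *\<^sub>C x)) y"
    by (simp add: adj[symmetric] inner_scaleC_right cl)
  thus "inner x (W (c *\<^sub>C y)) = inner x (c *\<^sub>C W y)"
    by (simp add: adj inner_scaleC_right)
qed

text \<open>
  Jensen's inequality for compression by an isometry \<open>V\<close> with adjoint \<open>W\<close>. The reflection
  \<open>U = 2 V W - 1\<close> in the range of \<open>V\<close> is unitary, and the average \<open>Y\<close> of \<open>X\<close> and \<open>U X U\<close> is the
  block diagonal part of \<open>X\<close>. Convexity bounds \<open>f(Y)\<close> by the average of \<open>f(X)\<close> and \<open>U f(X) U\<close>.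
  On the range of \<open>V\<close> this is the claim: there \<open>U\<close> is the identity, and \<open>f(Y) V = V f(W X V)\<close>
  because \<open>Y V = V (W X V)\<close>.
\<close>

lemma jensen_isometry:
  fixes V :: "'a :: complex_hilbert \<Rightarrow>\<^sub>L 'b :: complex_hilbert" and W :: "'b \<Rightarrow>\<^sub>L 'a"
  assumes f: "operator_convex_on TYPE('b) J f" and J: "is_interval J"
    and adj: "\<And>x y. inner (V x) y = inner x (W y)" and cl: "\<And>c x. V (c *\<^sub>C x) = c *\<^sub>C V x"
    and iso: "\<And>x. W (V x) = x"
    and X: "self_adjoint X" and mM: "m \<in> J" "M \<in> J"
    and lo: "\<And>v. m * (norm v)\<^sup>2 \<le> inner (X v) v" and hi: "\<And>v. inner (X v) v \<le> M * (norm v)\<^sup>2"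
  shows "inner (fun_calc f (W o\<^sub>L X o\<^sub>L V) v) v \<le> inner (fun_calc f X (V v)) (V v)"
proof -
  have adj': "inner y (V x) = inner (W y) x" for x y by (metis adj inner_commute)
  have inner_V: "inner (V x) (V y) = inner x y" for x y by (simp add: adj iso)
  hence norm_V: "norm (V x) = norm x" for x by (simp add: norm_eq_sqrt_inner)
  have clW: "W (c *\<^sub>C y) = c *\<^sub>C W y" for c y using adjoint_complex_linear[OF adj cl] .
  have mM_J: "{m..M} \<subseteq> J" using mem_is_interval_1_I[OF J mM] by auto
  have fJ: "continuous_on S f" if "S \<subseteq> {m..M}" for S
    using that mM_J by (intro continuous_on_subset[OF operator_convex_continuous[OF f]]) auto
  define U where "U = 2 *\<^sub>R (V o\<^sub>L W) - id_blinfun"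
  have U_apply: "U x = 2 *\<^sub>R V (W x) - x" for x by (simp add: U_def)
  have U: "self_adjoint U"
    unfolding self_adjoint_iff complex_linear_def
    by (simp add: U_apply cl clW adj adj' inner_diff_left inner_diff_right scaleC_diff_right scaleC_scaleR)
  have UU: "U (U x) = x" for x
    by (simp add: U_apply blinfun.diff_right blinfun.scaleR_right iso scaleR_diff_right)
      (simp flip: scaleR_diff_left)
  have UV: "U (V x) = V x" for x by (simp add: U_apply iso scaleR_2)
  have norm_U: "norm (U x) = norm x" for x
    by (simp add: norm_eq_sqrt_inner self_adjoint_inner[OF U] UU)

  define Z where "Z = U o\<^sub>L X o\<^sub>L U"
  have Z: "self_adjoint Z" using U X by (simp add: Z_def)
  have formZ: "inner (Z v) v = inner (X (U v)) (U v)" for v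
    by (simp add: Z_def self_adjoint_inner[OF U])
  have loZ: "m * (norm v)\<^sup>2 \<le> inner (Z v) v" and hiZ: "inner (Z v) v \<le> M * (norm v)\<^sup>2" for v
    using lo[of "U v"] hi[of "U v"] by (simp_all add: formZ norm_U)
  have SX: "real_spectrum X \<subseteq> {m..M}" by (rule real_spectrum_bounds[OF X lo hi])
  have SZ: "real_spectrum Z \<subseteq> {m..M}" by (rule real_spectrum_bounds[OF Z loZ hiZ])
  have "fun_calc f Z o\<^sub>L U = U o\<^sub>L fun_calc f X"
    by (rule fun_calc_intertwine[OF X Z]) (use SX SZ in \<open>auto intro!: fJ simp: blinfun_eq_iff Z_def UU\<close>)
  hence fZ: "fun_calc f Z (U x) = U (fun_calc f X x)" for x
    by (metis blinfun_apply_blinfun_compose)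

  define Y where "Y = (1 / 2) *\<^sub>R X + (1 - 1 / 2) *\<^sub>R Z"
  have Y: "self_adjoint Y" using X Z by (simp add: Y_def)
  have formY: "inner (Y v) v = (inner (X v) v + inner (Z v) v) / 2" for v
    by (simp add: Y_def inner_add_left)
  have SY: "real_spectrum Y \<subseteq> {m..M}"
  proof (rule real_spectrum_bounds[OF Y])
    show "m * (norm v)\<^sup>2 \<le> inner (Y v) v" for v
      unfolding formY using add_mono[OF lo[of v] loZ[of v]] by simp
    show "inner (Y v) v \<le> M * (norm v)\<^sup>2" for v
      unfolding formY using add_mono[OF hi[of v] hiZ[of v]] by simp
  qed
  define D where "D = W o\<^sub>L X o\<^sub>L V"
  have D: "self_adjoint D"
    unfolding self_adjoint_iff complex_linear_def
    by (simp add: D_def cl clW complex_linearD[OF self_adjoint_complex_linear[OF X]]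
        adj[symmetric] adj'[symmetric] self_adjoint_inner[OF X])
  have formD: "inner (D v) v = inner (X (V v)) (V v)" for v by (simp add: D_def adj')
  have SD: "real_spectrum D \<subseteq> {m..M}"
  proof (rule real_spectrum_bounds[OF D])
    show "m * (norm v)\<^sup>2 \<le> inner (D v) v" "inner (D v) v \<le> M * (norm v)\<^sup>2" for v
      using lo[of "V v"] hi[of "V v"] by (simp_all add: formD norm_V)
  qed
  have "Y (V x) = V (D x)" for x
    by (simp add: Y_def Z_def D_def UV) (simp add: U_apply scaleR_diff_right)
  hence "fun_calc f Y o\<^sub>L V = V o\<^sub>L fun_calc f D"
    by (intro fun_calc_intertwine[OF D Y]) (use SD SY in \<open>auto intro!: fJ simp: blinfun_eq_iff\<close>)
  hence fY: "fun_calc f Y (V x) = V (fun_calc f D x)" for x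
    by (metis blinfun_apply_blinfun_compose)

  have "inner (fun_calc f D v) v = inner (fun_calc f Y (V v)) (V v)"
    by (simp add: fY inner_V)
  also have "\<dots> \<le> 1 / 2 * inner (fun_calc f X (V v)) (V v)
      + (1 - 1 / 2) * inner (fun_calc f Z (V v)) (V v)"
    unfolding Y_def using SX SZ mM_J by (intro operator_convex_form[OF f] X Z) auto
  also have "inner (fun_calc f Z (V v)) (V v) = inner (U (fun_calc f X (V v))) (V v)"
    using fZ[of "V v"] by (simp add: UV)
  also have "\<dots> = inner (fun_calc f X (V v)) (V v)"
    by (simp add: self_adjoint_inner[OF U] UV)
  finally show ?thesis by (simp add: D_def)
qed

definition ell2_embed :: "nat \<Rightarrow> 'a :: complex_hilbert \<Rightarrow>\<^sub>L 'a ell2" where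
  "ell2_embed k = Blinfun (\<lambda>x. Abs_ell2 (\<lambda>i. if i = k then x else 0))"

definition ell2_coord :: "nat \<Rightarrow> 'a :: complex_hilbert ell2 \<Rightarrow>\<^sub>L 'a" where
  "ell2_coord k = Blinfun (\<lambda>x. Rep_ell2 x k)"

lemma Rep_ell2_single: "Rep_ell2 (Abs_ell2 (\<lambda>i. if i = k then x else 0)) = (\<lambda>i. if i = k then x else 0)"
proof (rule Abs_ell2_inverse)
  have "summable (\<lambda>n. (norm (if n = k then x else 0))\<^sup>2)"
    by (rule summable_finite[of "{k}"]) auto
  thus "(\<lambda>i. if i = k then x else 0) \<in> {x. summable (\<lambda>n. (norm (x n))\<^sup>2)}" by simp
qed

lemma inner_ell2_single:
  "inner (Abs_ell2 (\<lambda>i. if i = k then x else 0)) y = inner x (Rep_ell2 y k)"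
proof -
  have "(\<Sum>n. inner (if n = k then x else 0) (Rep_ell2 y n))
      = (\<Sum>n\<in>{k}. inner (if n = k then x else 0) (Rep_ell2 y n))"
    by (rule suminf_finite) auto
  thus ?thesis by (simp add: inner_ell2_def Rep_ell2_single)
qed

lemma ell2_embed_apply: "ell2_embed k x = Abs_ell2 (\<lambda>i. if i = k then x else 0)"
  unfolding ell2_embed_def
proof (subst bounded_linear_Blinfun_apply)
  show "bounded_linear (\<lambda>x :: 'a. Abs_ell2 (\<lambda>i. if i = k then x else 0))"
  proof (rule bounded_linear_intro[where K = 1])
    fix x y :: 'a and r :: real
    show "Abs_ell2 (\<lambda>i. if i = k then x + y else 0)
        = Abs_ell2 (\<lambda>i. if i = k then x else 0) + Abs_ell2 (\<lambda>i. if i = k then y else 0)"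
      by (rule Rep_ell2_inject[THEN iffD1]) (auto simp: plus_ell2.rep_eq Rep_ell2_single)
    show "Abs_ell2 (\<lambda>i. if i = k then r *\<^sub>R x else 0) = r *\<^sub>R Abs_ell2 (\<lambda>i. if i = k then x else 0)"
      by (rule Rep_ell2_inject[THEN iffD1]) (auto simp: scaleR_ell2.rep_eq Rep_ell2_single)
    show "norm (Abs_ell2 (\<lambda>i. if i = k then x else 0)) \<le> norm x * 1"
      by (simp add: norm_eq_sqrt_inner inner_ell2_single Rep_ell2_single)
  qed
qed simp

lemma ell2_coord_apply: "ell2_coord k x = Rep_ell2 x k"
  unfolding ell2_coord_def
proof (subst bounded_linear_Blinfun_apply)
  show "bounded_linear (\<lambda>x :: 'a ell2. Rep_ell2 x k)"
  proof (rule bounded_linear_intro[where K = 1])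
    fix x :: "'a ell2"
    have "(norm (Rep_ell2 x k))\<^sup>2 \<le> (\<Sum>n<Suc k. (norm (Rep_ell2 x n))\<^sup>2)"
      by (simp add: sum_nonneg)
    also have "\<dots> \<le> (norm x)\<^sup>2" by (rule ell2_partial_sum_le)
    finally show "norm (Rep_ell2 x k) \<le> norm x * 1" by (auto intro: power2_le_imp_le)
  qed (simp_all add: plus_ell2.rep_eq scaleR_ell2.rep_eq)
qed simp

lemma ell2_embed_adjoint: "inner (ell2_embed k x) y = inner x (ell2_coord k y)"
  by (simp add: ell2_embed_apply ell2_coord_apply inner_ell2_single)

lemma ell2_coord_embed: "ell2_coord k (ell2_embed j x) = (if k = j then x else 0)"
  by (simp add: ell2_embed_apply ell2_coord_apply Rep_ell2_single)

lemma ell2_embed_scaleC: "ell2_embed k (c *\<^sub>C x) = c *\<^sub>C ell2_embed k x"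
  by (rule Rep_ell2_inject[THEN iffD1])
    (auto simp: ell2_embed_apply scaleC_ell2.rep_eq Rep_ell2_single)

lemma ell2_coord_scaleC: "ell2_coord k (c *\<^sub>C x) = c *\<^sub>C ell2_coord k x"
  by (simp add: ell2_coord_apply scaleC_ell2.rep_eq)

lemma sum_norm_ell2_coord_le: "(\<Sum>k<n. (norm (ell2_coord k x))\<^sup>2) \<le> (norm x)\<^sup>2"
  by (simp add: ell2_coord_apply ell2_partial_sum_le)

text \<open>
  The column \<open>V\<close> with entries \<open>C\<^sub>k\<close> is an isometry into the square summable sequences and
  compresses the block diagonal operator \<open>\<Delta>\<close> with entries \<open>X\<^sub>k\<close> to the sum of the \<open>C\<^sub>k\<^sup>* X\<^sub>k C\<^sub>k\<close>.
  The infinitely many remaining diagonal entries of \<open>\<Delta>\<close> are filled with \<open>m\<close>, which keeps its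
  spectrum in \<open>[m, M]\<close>.
\<close>

lemma jensen_sum:
  fixes X C D :: "nat \<Rightarrow> 'a :: complex_hilbert op"
  assumes f: "operator_convex_on TYPE('a ell2) J f" and J: "is_interval J"
    and X: "\<And>k. k < n \<Longrightarrow> self_adjoint (X k)" and mM: "m \<in> J" "M \<in> J" "m \<le> M"
    and lo: "\<And>k v. k < n \<Longrightarrow> m * (norm v)\<^sup>2 \<le> inner (X k v) v"
    and hi: "\<And>k v. k < n \<Longrightarrow> inner (X k v) v \<le> M * (norm v)\<^sup>2"
    and CD: "\<And>k x y. k < n \<Longrightarrow> inner (C k x) y = inner x (D k y)"
    and C: "\<And>k. k < n \<Longrightarrow> complex_linear (C k)"
    and unit: "(\<Sum>k<n. D k o\<^sub>L C k) = id_blinfun"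
  shows "inner (fun_calc f (\<Sum>k<n. D k o\<^sub>L X k o\<^sub>L C k) v) v
    \<le> (\<Sum>k<n. inner (fun_calc f (X k) (C k v)) (C k v))"
proof -
  define V where "V = (\<Sum>k<n. ell2_embed k o\<^sub>L C k)"
  define W where "W = (\<Sum>k<n. D k o\<^sub>L ell2_coord k)"
  define \<Delta> where "\<Delta> = m *\<^sub>R id_blinfun
    + (\<Sum>k<n. ell2_embed k o\<^sub>L (X k - m *\<^sub>R id_blinfun) o\<^sub>L ell2_coord k)"
  have V: "V x = (\<Sum>k<n. ell2_embed k (C k x))" for x by (simp add: V_def)
  have coord_V: "ell2_coord k (V x) = C k x" if "k < n" for k x
  proof -
    have "ell2_coord k (V x) = (\<Sum>j<n. if j = k then C j x else 0)"
      by (auto simp: V blinfun.sum_right ell2_coord_embed intro!: sum.cong)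
    thus ?thesis using that by simp
  qed
  have adj: "inner (V x) y = inner x (W y)" for x y
    by (simp add: V W_def inner_sum_left inner_sum_right ell2_embed_adjoint CD)
  have clV: "V (c *\<^sub>C x) = c *\<^sub>C V x" for c x
  proof -
    have "V (c *\<^sub>C x) = (\<Sum>k<n. c *\<^sub>C ell2_embed k (C k x))"
      using C by (simp add: V complex_linearD ell2_embed_scaleC)
    also have "\<dots> = c *\<^sub>C V x"
      by (simp add: V scaleC_sum_right)
    finally show ?thesis .
  qed
  have W_V: "W (V x) = x" for x
  proof -
    have "W (V x) = (\<Sum>k<n. D k o\<^sub>L C k) x" by (simp add: W_def coord_V)
    thus ?thesis by (simp add: unit)
  qed
  have \<Delta>_apply: "\<Delta> x = m *\<^sub>R x + (\<Sum>k<n. ell2_embed k (X k (ell2_coord k x) - m *\<^sub>R ell2_coord k x))"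
    for x by (simp add: \<Delta>_def)
  have \<Delta>_embed: "\<Delta> (ell2_embed j x) = ell2_embed j (X j x)" if "j < n" for j x
  proof -
    have "(\<Sum>k<n. ell2_embed k (X k (ell2_coord k (ell2_embed j x)) - m *\<^sub>R ell2_coord k (ell2_embed j x)))
        = (\<Sum>k<n. if k = j then ell2_embed k (X k x - m *\<^sub>R x) else 0)"
      by (intro sum.cong) (auto simp: ell2_coord_embed)
    also have "\<dots> = ell2_embed j (X j x - m *\<^sub>R x)" using that by simp
    finally show ?thesis by (simp add: \<Delta>_apply blinfun.diff_right blinfun.scaleR_right)
  qed
  have form: "inner (\<Delta> x) y = m * inner x y
      + (\<Sum>k<n. inner (X k (ell2_coord k x) - m *\<^sub>R ell2_coord k x) (ell2_coord k y))" for x y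
    by (simp add: \<Delta>_apply inner_add_left inner_sum_left ell2_embed_adjoint)
  have \<Delta>: "self_adjoint \<Delta>"
    unfolding self_adjoint_iff complex_linear_def
  proof (intro conjI allI)
    fix c x
    have "(\<Sum>k<n. ell2_embed k (X k (ell2_coord k (c *\<^sub>C x)) - m *\<^sub>R ell2_coord k (c *\<^sub>C x)))
        = (\<Sum>k<n. c *\<^sub>C ell2_embed k (X k (ell2_coord k x) - m *\<^sub>R ell2_coord k x))"
      by (intro sum.cong)
        (simp_all add: ell2_coord_scaleC complex_linearD[OF self_adjoint_complex_linear[OF X]]
          ell2_embed_scaleC[symmetric] scaleC_diff_right scaleC_scaleR)
    also have "\<dots> = c *\<^sub>C (\<Sum>k<n. ell2_embed k (X k (ell2_coord k x) - m *\<^sub>R ell2_coord k x))"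
      by (rule scaleC_sum_right[symmetric])
    finally show "\<Delta> (c *\<^sub>C x) = c *\<^sub>C \<Delta> x"
      by (simp add: \<Delta>_apply scaleC_add_right scaleC_scaleR)
  next
    fix x y
    have "inner y (\<Delta> x) = m * inner y x
      + (\<Sum>k<n. inner (ell2_coord k y) (X k (ell2_coord k x) - m *\<^sub>R ell2_coord k x))"
      by (simp only: inner_commute[of y] inner_commute[of "ell2_coord _ y"] form)
    thus "inner (\<Delta> y) x = inner y (\<Delta> x)"
      by (simp add: form inner_diff_left inner_diff_right self_adjoint_inner[OF X])
  qed
  have lo\<Delta>: "m * (norm x)\<^sup>2 \<le> inner (\<Delta> x) x" for x
  proof -
    have "0 \<le> (\<Sum>k<n. inner (X k (ell2_coord k x) - m *\<^sub>R ell2_coord k x) (ell2_coord k x))"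
      using lo by (intro sum_nonneg) (auto simp: inner_diff_left power2_norm_eq_inner)
    thus ?thesis by (simp add: form power2_norm_eq_inner)
  qed
  have hi\<Delta>: "inner (\<Delta> x) x \<le> M * (norm x)\<^sup>2" for x
  proof -
    have "(\<Sum>k<n. inner (X k (ell2_coord k x) - m *\<^sub>R ell2_coord k x) (ell2_coord k x))
        \<le> (\<Sum>k<n. (M - m) * (norm (ell2_coord k x))\<^sup>2)"
      using hi by (intro sum_mono) (auto simp: inner_diff_left power2_norm_eq_inner algebra_simps)
    also have "\<dots> = (M - m) * (\<Sum>k<n. (norm (ell2_coord k x))\<^sup>2)" by (simp add: sum_distrib_left)
    also have "\<dots> \<le> (M - m) * (norm x)\<^sup>2"
      using mM by (intro mult_left_mono sum_norm_ell2_coord_le) auto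
    finally show ?thesis unfolding form power2_norm_eq_inner[symmetric] by (simp add: algebra_simps)
  qed
  have "(W o\<^sub>L \<Delta> o\<^sub>L V) x = (\<Sum>k<n. D k o\<^sub>L X k o\<^sub>L C k) x" for x
  proof -
    have "\<Delta> (V x) = (\<Sum>j<n. ell2_embed j (X j (C j x)))"
      by (simp add: V blinfun.sum_right \<Delta>_embed)
    moreover have "ell2_coord k (\<Sum>j<n. ell2_embed j (X j (C j x))) = X k (C k x)" if "k < n" for k
    proof -
      have "ell2_coord k (\<Sum>j<n. ell2_embed j (X j (C j x))) = (\<Sum>j<n. if j = k then X j (C j x) else 0)"
        by (auto simp: blinfun.sum_right ell2_coord_embed intro!: sum.cong)
      thus ?thesis using that by simp
    qed
    ultimately show ?thesis by (simp add: W_def)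
  qed
  hence eq: "W o\<^sub>L \<Delta> o\<^sub>L V = (\<Sum>k<n. D k o\<^sub>L X k o\<^sub>L C k)" by (simp add: blinfun_eq_iff)
  have mM_J: "{m..M} \<subseteq> J" using mem_is_interval_1_I[OF J mM(1,2)] by auto
  have f\<Delta>: "fun_calc f \<Delta> (ell2_embed k x) = ell2_embed k (fun_calc f (X k) x)" if "k < n" for k x
  proof -
    have "fun_calc f \<Delta> o\<^sub>L ell2_embed k = ell2_embed k o\<^sub>L fun_calc f (X k)"
    proof (rule fun_calc_intertwine[OF X[OF that] \<Delta>])
      show "\<Delta> o\<^sub>L ell2_embed k = ell2_embed k o\<^sub>L X k"
        using that by (simp add: blinfun_eq_iff \<Delta>_embed)
      have "real_spectrum (X k) \<union> real_spectrum \<Delta> \<subseteq> {m..M}"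
        using real_spectrum_bounds[OF X[OF that] lo[OF that] hi[OF that]]
          real_spectrum_bounds[OF \<Delta> lo\<Delta> hi\<Delta>] by blast
      thus "continuous_on (real_spectrum (X k) \<union> real_spectrum \<Delta>) f"
        using mM_J by (intro continuous_on_subset[OF operator_convex_continuous[OF f]]) auto
    qed
    thus ?thesis by (metis blinfun_apply_blinfun_compose)
  qed
  have "inner (fun_calc f (W o\<^sub>L \<Delta> o\<^sub>L V) v) v \<le> inner (fun_calc f \<Delta> (V v)) (V v)"
    by (rule jensen_isometry[OF f J adj clV W_V \<Delta> mM(1,2) lo\<Delta> hi\<Delta>])
  also have "fun_calc f \<Delta> (V v) = (\<Sum>k<n. ell2_embed k (fun_calc f (X k) (C k v)))"
    by (simp add: V blinfun.sum_right f\<Delta>)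
  also have "inner \<dots> (V v) = (\<Sum>k<n. inner (fun_calc f (X k) (C k v)) (C k v))"
    by (simp add: inner_sum_left ell2_embed_adjoint coord_V)
  finally show ?thesis by (simp add: eq)
qed

section \<open>Square roots and the perspective\<close>

lemma strictly_positive_self_adjoint: "strictly_positive_op R \<Longrightarrow> self_adjoint R"
  by (simp add: strictly_positive_op_def positive_op_iff)

lemma strictly_positive_nonneg: "strictly_positive_op R \<Longrightarrow> 0 \<le> inner (R v) v"
  by (simp add: strictly_positive_op_def positive_op_iff)

lemma coercive_strictly_positive:
  assumes "self_adjoint R" "e > 0" "\<And>v. e * (norm v)\<^sup>2 \<le> inner (R v) v"
  shows "strictly_positive_op R"
proof -
  have "0 \<le> inner (R v) v" for v
    using order_trans[OF _ assms(3)] assms(2) by simp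
  moreover have "invertible_op R"
    using assms by (intro coercive_invertible) (auto simp: self_adjoint_complex_linear)
  ultimately show ?thesis using assms(1) by (simp add: strictly_positive_op_def positive_op_iff)
qed

lemma strictly_positive_spectrum:
  assumes R: "strictly_positive_op R"
  shows "real_spectrum R \<subseteq> {0<..}"
proof
  fix x assume x: "x \<in> real_spectrum R"
  have sa: "self_adjoint R" using R by (rule strictly_positive_self_adjoint)
  have "bounded_below R"
    using R by (simp add: strictly_positive_op_def invertible_bounded_below)
  hence "x \<noteq> 0" using x by (auto simp: real_spectrum_iff[OF sa])
  moreover have "x \<ge> 0"
  proof (rule ccontr)
    assume "\<not> x \<ge> 0"
    moreover have "(- x) * (norm v)\<^sup>2 \<le> inner ((R - x *\<^sub>R id_blinfun) v) v" for v
      using strictly_positive_nonneg[OF R, of v] by (simp add: inner_diff_left power2_norm_eq_inner)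
    ultimately have "bounded_below (R - x *\<^sub>R id_blinfun)"
      by (intro coercive_bounded_below[where e = "- x"]) auto
    thus False using x by (simp add: real_spectrum_iff[OF sa])
  qed
  ultimately show "x \<in> {0<..}" by simp
qed

lemma strictly_positive_coercive:
  fixes R :: "'a :: complex_hilbert op"
  assumes R: "strictly_positive_op R"
  shows "\<exists>e>0. \<forall>v. e * (norm v)\<^sup>2 \<le> inner (R v) v"
proof (cases "\<exists>v :: 'a. v \<noteq> 0")
  case True
  have sa: "self_adjoint R" using R by (rule strictly_positive_self_adjoint)
  obtain m where "\<And>v. m * (norm v)\<^sup>2 \<le> inner (R v) v" "m \<in> real_spectrum R"
    using numerical_range_minimum[OF sa True] by blast
  thus ?thesis using strictly_positive_spectrum[OF R] by (intro exI[of _ m]) auto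
next
  case False
  hence "(v :: 'a) = 0" for v by blast
  hence zero: "(norm v)\<^sup>2 = 0" for v :: 'a by simp
  have "1 * (norm v)\<^sup>2 \<le> inner (R v) v" for v
    using strictly_positive_nonneg[OF R, of v] zero[of v] by linarith
  thus ?thesis by (intro exI[of _ 1]) simp
qed

lemma continuous_on_powr_positive: "continuous_on {0<..} (\<lambda>x :: real. x powr a)"
  by (intro continuous_intros) auto

lemma op_powr_continuous:
  "strictly_positive_op R \<Longrightarrow> continuous_on (real_spectrum R) (\<lambda>x. x powr a)"
  by (rule continuous_on_subset[OF continuous_on_powr_positive strictly_positive_spectrum])

lemma self_adjoint_op_powr: "strictly_positive_op R \<Longrightarrow> self_adjoint (op_powr R a)"
  unfolding op_powr_def
  by (intro self_adjoint_fun_calc op_powr_continuous strictly_positive_self_adjoint)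

lemma op_powr_compose:
  assumes R: "strictly_positive_op R"
  shows "op_powr R a o\<^sub>L op_powr R b = op_powr R (a + b)"
  unfolding op_powr_def powr_add
  by (rule fun_calc_mult[OF strictly_positive_self_adjoint[OF R] op_powr_continuous[OF R]
        op_powr_continuous[OF R]])

lemma op_powr_0:
  assumes R: "strictly_positive_op R"
  shows "op_powr R 0 = id_blinfun"
proof -
  have "op_powr R 0 = fun_calc (\<lambda>_. 1) R"
    unfolding op_powr_def using strictly_positive_spectrum[OF R] by (intro fun_calc_cong) auto
  thus ?thesis using fun_calc_const[OF strictly_positive_self_adjoint[OF R], of 1] by simp
qed

lemma op_powr_1:
  assumes R: "strictly_positive_op R"
  shows "op_powr R 1 = R"
proof -
  have "op_powr R 1 = fun_calc (\<lambda>x. x) R"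
    unfolding op_powr_def using strictly_positive_spectrum[OF R] by (intro fun_calc_cong) auto
  thus ?thesis using fun_calc_ident[OF strictly_positive_self_adjoint[OF R]] by simp
qed

lemma op_sqrt_apply:
  assumes R: "strictly_positive_op R"
  shows "op_powr R (1/2) (op_powr R (1/2) v) = R v"
    and "op_powr R (1/2) (op_powr R (-1/2) v) = v"
    and "op_powr R (-1/2) (op_powr R (1/2) v) = v"
  using op_powr_compose[OF R, of "1/2" "1/2"] op_powr_compose[OF R, of "1/2" "-1/2"]
    op_powr_compose[OF R, of "-1/2" "1/2"] op_powr_0[OF R] op_powr_1[OF R]
  by (simp_all add: blinfun_eq_iff)

lemmas op_sqrt_simps = op_sqrt_apply[simplified]

abbreviation relative_op :: "'a :: complex_hilbert op \<Rightarrow> 'a op \<Rightarrow> 'a op" where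
  "relative_op L R \<equiv> op_powr R (-1/2) o\<^sub>L L o\<^sub>L op_powr R (-1/2)"

lemma self_adjoint_relative_op:
  "self_adjoint L \<Longrightarrow> strictly_positive_op R \<Longrightarrow> self_adjoint (relative_op L R)"
  by (simp add: self_adjoint_op_powr)

text \<open>In the coordinates \<open>R\<^sup>1\<^sup>/\<^sup>2 v\<close> the relative operator represents the form of \<open>L\<close> with respect to that of \<open>R\<close>.\<close>

lemma relative_op_form:
  assumes R: "strictly_positive_op R"
  shows "inner (relative_op L R (op_powr R (1/2) v)) (op_powr R (1/2) v) = inner (L v) v"
    and "(norm (op_powr R (1/2) v))\<^sup>2 = inner (R v) v"
  by (simp_all add: power2_norm_eq_inner self_adjoint_inner[OF self_adjoint_op_powr[OF R]]
      op_sqrt_simps[OF R] inner_commute)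

lemma relative_op_bounds_iff:
  assumes R: "strictly_positive_op R"
  shows "(\<forall>v. m * (norm v)\<^sup>2 \<le> inner (relative_op L R v) v) \<longleftrightarrow> (\<forall>v. m * inner (R v) v \<le> inner (L v) v)"
    and "(\<forall>v. inner (relative_op L R v) v \<le> M * (norm v)\<^sup>2) \<longleftrightarrow> (\<forall>v. inner (L v) v \<le> M * inner (R v) v)"
  by (metis relative_op_form[OF R] op_sqrt_apply(2)[OF R])+

lemma perspective_form:
  assumes R: "strictly_positive_op R"
  shows "inner (perspective f L R v) v
    = inner (fun_calc f (relative_op L R) (op_powr R (1/2) v)) (op_powr R (1/2) v)"
  by (simp add: perspective_def self_adjoint_inner[OF self_adjoint_op_powr[OF R]])

lemma self_adjoint_perspective:
  assumes "self_adjoint L" "strictly_positive_op R" "continuous_on (real_spectrum (relative_op L R)) f"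
  shows "self_adjoint (perspective f L R)"
  unfolding perspective_def
  using assms by (intro self_adjoint_sandwich self_adjoint_op_powr self_adjoint_fun_calc
      self_adjoint_relative_op)

lemma tendsto_op_sandwich:
  fixes X Y :: "nat \<Rightarrow> 'a :: complex_hilbert op"
  assumes "X \<longlonglongrightarrow> X'" "Y \<longlonglongrightarrow> Y'"
  shows "(\<lambda>n. X n o\<^sub>L Y n o\<^sub>L X n) \<longlonglongrightarrow> (X' o\<^sub>L Y' o\<^sub>L X')"
  by (intro bounded_bilinear.tendsto[OF bounded_bilinear_blinfun_compose] assms)

lemma tendsto_op_powr:
  assumes "\<And>n. strictly_positive_op (R n)" "R \<longlonglongrightarrow> R'" "strictly_positive_op R'"
  shows "(\<lambda>n. op_powr (R n) a) \<longlonglongrightarrow> op_powr R' a"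
  unfolding op_powr_def
  by (rule tendsto_fun_calc[OF _ assms(2), where J = "{0<..}"])
    (auto intro!: strictly_positive_self_adjoint assms continuous_on_powr_positive
      simp: is_interval_def dest: subsetD[OF strictly_positive_spectrum[OF assms(1)]]
      subsetD[OF strictly_positive_spectrum[OF assms(3)]])

lemma tendsto_perspective:
  assumes L: "\<And>n. self_adjoint (L n)" "L \<longlonglongrightarrow> L'"
    and R: "\<And>n. strictly_positive_op (R n)" "R \<longlonglongrightarrow> R'" "strictly_positive_op R'"
    and spec: "\<And>n. real_spectrum (relative_op (L n) (R n)) \<subseteq> J" "real_spectrum (relative_op L' R') \<subseteq> J"
    and f: "continuous_on J f" and J: "is_interval J"
  shows "(\<lambda>n. perspective f (L n) (R n)) \<longlonglongrightarrow> perspective f L' R'"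
  unfolding perspective_def
proof (intro tendsto_op_sandwich tendsto_op_powr R)
  have "(\<lambda>n. relative_op (L n) (R n)) \<longlonglongrightarrow> relative_op L' R'"
    by (intro tendsto_op_sandwich tendsto_op_powr R L)
  thus "(\<lambda>n. fun_calc f (relative_op (L n) (R n))) \<longlonglongrightarrow> fun_calc f (relative_op L' R')"
    by (rule tendsto_fun_calc[OF self_adjoint_relative_op[OF L(1) R(1)] _ spec J f])
qed

text \<open>
  With \<open>R\<close> the weighted sum of the \<open>R\<^sub>k\<close>, apply Jensen's inequality to the relative operators of
  \<open>L\<^sub>k\<close> and \<open>R\<^sub>k\<close> with the coefficients \<open>C\<^sub>k = w\<^sub>k\<^sup>1\<^sup>/\<^sup>2 R\<^sub>k\<^sup>1\<^sup>/\<^sup>2 R\<^sup>-\<^sup>1\<^sup>/\<^sup>2\<close> and multiply by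
  \<open>R\<^sup>1\<^sup>/\<^sup>2\<close> from both sides.
\<close>

lemma perspective_weighted_sum:
  fixes L R :: "nat \<Rightarrow> 'a :: complex_hilbert op"
  assumes f: "operator_convex_on TYPE('a ell2) J f" and J: "is_interval J"
    and nontriv: "\<exists>v :: 'a. v \<noteq> 0"
    and L: "\<And>k. k < n \<Longrightarrow> self_adjoint (L k)" and R: "\<And>k. k < n \<Longrightarrow> strictly_positive_op (R k)"
    and spec: "\<And>k. k < n \<Longrightarrow> real_spectrum (relative_op (L k) (R k)) \<subseteq> J"
    and w: "\<And>k. k < n \<Longrightarrow> 0 \<le> w k"
    and sumR: "strictly_positive_op (\<Sum>k<n. w k *\<^sub>R R k)"
  shows "real_spectrum (relative_op (\<Sum>k<n. w k *\<^sub>R L k) (\<Sum>k<n. w k *\<^sub>R R k)) \<subseteq> J"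
    and "inner (perspective f (\<Sum>k<n. w k *\<^sub>R L k) (\<Sum>k<n. w k *\<^sub>R R k) v) v
      \<le> (\<Sum>k<n. w k * inner (perspective f (L k) (R k) v) v)"
proof -
  define R' L' where "R' = (\<Sum>k<n. w k *\<^sub>R R k)" and "L' = (\<Sum>k<n. w k *\<^sub>R L k)"
  have R': "strictly_positive_op R'" using sumR by (simp add: R'_def)
  have L': "self_adjoint L'" unfolding L'_def using L by (intro self_adjoint_sum self_adjoint_scaleR) auto
  define X where "X = (\<lambda>k. relative_op (L k) (R k))"
  have X: "self_adjoint (X k)" if "k < n" for k
    unfolding X_def by (rule self_adjoint_relative_op[OF L[OF that] R[OF that]])
  have "n > 0"
  proof (rule ccontr)
    assume "\<not> n > 0"
    hence "R' = 0" by (simp add: R'_def)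
    moreover obtain e where "e > 0" "\<And>v. e * (norm v)\<^sup>2 \<le> inner (R' v) v"
      using strictly_positive_coercive[OF R'] by blast
    ultimately have "e * (norm v)\<^sup>2 \<le> 0" for v :: 'a by simp
    thus False using \<open>e > 0\<close> nontriv by (auto simp: mult_le_0_iff)
  qed
  have "\<exists>l. fst l \<in> J \<and> snd l \<in> J \<and> real_spectrum (X k) \<subseteq> {fst l..snd l}"
    if k: "k < n" for k
  proof -
    obtain a b where "a \<in> real_spectrum (X k)" "b \<in> real_spectrum (X k)" "real_spectrum (X k) \<subseteq> {a..b}"
      using spectral_enclosure[OF X[OF k] nontriv] .
    thus ?thesis using spec[OF k] by (intro exI[of _ "(a, b)"]) (auto simp: X_def)
  qed
  then obtain l where l: "\<And>k. k < n \<Longrightarrow>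
      fst (l k) \<in> J \<and> snd (l k) \<in> J \<and> real_spectrum (X k) \<subseteq> {fst (l k)..snd (l k)}"
    by metis
  define lo hi where "lo = fst \<circ> l" and "hi = snd \<circ> l"
  have lohi: "lo k \<in> J" "hi k \<in> J" "real_spectrum (X k) \<subseteq> {lo k..hi k}" if "k < n" for k
    using l[OF that] by (auto simp: lo_def hi_def)
  \<comment> \<open>One interval \<open>[m, M]\<close> in \<open>J\<close> for all \<open>k\<close>, as Jensen's inequality requires.\<close>
  define m M where "m = Min (lo ` {..<n})" and "M = Max (hi ` {..<n})"
  have ne: "lo ` {..<n} \<noteq> {}" "hi ` {..<n} \<noteq> {}" using \<open>n > 0\<close> by auto
  have "m \<in> lo ` {..<n}" "M \<in> hi ` {..<n}"
    unfolding m_def M_def using Min_in[OF _ ne(1)] Max_in[OF _ ne(2)] by simp_all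
  hence mM: "m \<in> J" "M \<in> J" using lohi by auto
  have SX: "real_spectrum (X k) \<subseteq> {m..M}" if "k < n" for k
  proof -
    have "m \<le> lo k" "hi k \<le> M" unfolding m_def M_def using that by auto
    thus ?thesis using lohi(3)[OF that] by fastforce
  qed
  have "real_spectrum (X 0) \<noteq> {}"
    using numerical_range_minimum[OF X[OF \<open>n > 0\<close>] nontriv] by blast
  hence "m \<le> M" using SX[OF \<open>n > 0\<close>] by force
  have lo: "m * (norm v)\<^sup>2 \<le> inner (X k v) v" and hi: "inner (X k v) v \<le> M * (norm v)\<^sup>2"
    if "k < n" for k v
    using SX[OF that] by (auto intro!: inner_ge_of_real_spectrum[OF X[OF that]]
        inner_le_of_real_spectrum[OF X[OF that]])
  have "m * inner (R k v) v \<le> inner (L k v) v" "inner (L k v) v \<le> M * inner (R k v) v"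
    if "k < n" for k v
    using relative_op_bounds_iff[OF R[OF that], where L = "L k"] lo[OF that] hi[OF that]
    unfolding X_def by blast+
  hence "w k * (m * inner (R k v) v) \<le> w k * inner (L k v) v"
      "w k * inner (L k v) v \<le> w k * (M * inner (R k v) v)" if "k < n" for k v
    using that w by (auto intro!: mult_left_mono)
  hence "(\<Sum>k<n. w k * (m * inner (R k v) v)) \<le> (\<Sum>k<n. w k * inner (L k v) v)"
      "(\<Sum>k<n. w k * inner (L k v) v) \<le> (\<Sum>k<n. w k * (M * inner (R k v) v))" for v
    by (auto intro!: sum_mono)
  hence "m * inner (R' v) v \<le> inner (L' v) v" "inner (L' v) v \<le> M * inner (R' v) v" for v
    by (simp_all add: R'_def L'_def inner_sum_left sum_distrib_left mult.left_commute)
  hence "real_spectrum (relative_op L' R') \<subseteq> {m..M}"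
    using relative_op_bounds_iff[OF R', where L = L']
    by (intro real_spectrum_bounds[OF self_adjoint_relative_op[OF L' R']]) blast+
  thus "real_spectrum (relative_op (\<Sum>k<n. w k *\<^sub>R L k) (\<Sum>k<n. w k *\<^sub>R R k)) \<subseteq> J"
    using mem_is_interval_1_I[OF J mM] unfolding R'_def L'_def by auto

  define S I where "S = op_powr R' (1/2)" and "I = op_powr R' (-1/2)"
  define T where "T = (\<lambda>k. op_powr (R k) (1/2))"
  have sa: "self_adjoint S" "self_adjoint I" "\<And>k. k < n \<Longrightarrow> self_adjoint (T k)"
    using R R' by (simp_all add: S_def I_def T_def self_adjoint_op_powr)
  define C where "C = (\<lambda>k. sqrt (w k) *\<^sub>R (T k o\<^sub>L I))"
  define D where "D = (\<lambda>k. sqrt (w k) *\<^sub>R (I o\<^sub>L T k))"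
  have ww: "sqrt (w k) * sqrt (w k) = w k" if "k < n" for k using w[OF that] by simp
  have DC: "(D k o\<^sub>L C k) x = I (w k *\<^sub>R R k (I x))" if "k < n" for k x
    using ww[OF that]
    by (simp add: D_def C_def T_def blinfun.scaleR_right op_sqrt_simps[OF R[OF that]])
  have unit: "(\<Sum>k<n. D k o\<^sub>L C k) = id_blinfun"
  proof (rule blinfun_eqI)
    fix x
    have "(\<Sum>k<n. D k o\<^sub>L C k) x = I (R' (I x))"
      by (simp add: DC R'_def blinfun.sum_right del: blinfun_apply_blinfun_compose)
    also have "\<dots> = x"
      unfolding I_def using op_sqrt_apply[OF R'] by metis
    finally show "(\<Sum>k<n. D k o\<^sub>L C k) x = id_blinfun x" by simp
  qed
  have DXC: "(D k o\<^sub>L X k o\<^sub>L C k) x = I (w k *\<^sub>R L k (I x))" if "k < n" for k x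
    using ww[OF that]
    by (simp add: D_def C_def T_def X_def blinfun.scaleR_right op_sqrt_simps[OF R[OF that]])
  have sum_DXC: "(\<Sum>k<n. D k o\<^sub>L X k o\<^sub>L C k) = relative_op L' R'"
  proof (rule blinfun_eqI)
    fix x
    have "(\<Sum>k<n. D k o\<^sub>L X k o\<^sub>L C k) x = I (L' (I x))"
      by (simp add: DXC L'_def blinfun.sum_right del: blinfun_apply_blinfun_compose)
    thus "(\<Sum>k<n. D k o\<^sub>L X k o\<^sub>L C k) x = relative_op L' R' x" by (simp add: I_def)
  qed
  have "inner (perspective f L' R' v) v = inner (fun_calc f (\<Sum>k<n. D k o\<^sub>L X k o\<^sub>L C k) (S v)) (S v)"
    unfolding sum_DXC S_def by (rule perspective_form[OF R'])
  also have "\<dots> \<le> (\<Sum>k<n. inner (fun_calc f (X k) (C k (S v))) (C k (S v)))"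
  proof (rule jensen_sum[OF f J X mM \<open>m \<le> M\<close> lo hi _ _ unit])
    show "inner (C k x) y = inner x (D k y)" if "k < n" for k x y
      using sa(2) sa(3)[OF that] by (simp add: C_def D_def self_adjoint_inner)
    show "complex_linear (C k)" if "k < n" for k
      using sa(2) sa(3)[OF that] by (simp add: C_def self_adjoint_complex_linear)
  qed
  also have "\<dots> = (\<Sum>k<n. w k * inner (perspective f (L k) (R k) v) v)"
  proof (rule sum.cong)
    fix k assume "k \<in> {..<n}"
    hence k: "k < n" by simp
    have "C k (S v) = sqrt (w k) *\<^sub>R T k v"
      using op_sqrt_apply(3)[OF R', of v] by (simp add: C_def I_def S_def)
    hence "inner (fun_calc f (X k) (C k (S v))) (C k (S v))
        = w k * inner (fun_calc f (X k) (T k v)) (T k v)"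
      using ww[OF k] by (simp add: blinfun.scaleR_right flip: mult.assoc)
    also have "\<dots> = w k * inner (perspective f (L k) (R k) v) v"
      unfolding X_def T_def perspective_form[OF R[OF k]] ..
    finally show "inner (fun_calc f (X k) (C k (S v))) (C k (S v))
        = w k * inner (perspective f (L k) (R k) v) v" .
  qed simp
  finally show "inner (perspective f (\<Sum>k<n. w k *\<^sub>R L k) (\<Sum>k<n. w k *\<^sub>R R k) v) v
      \<le> (\<Sum>k<n. w k * inner (perspective f (L k) (R k) v) v)"
    by (simp add: R'_def L'_def)
qed

section \<open>Bochner integrals as limits of Riemann sums\<close>

lemma simple_bochner_integrable_measurable:
  fixes g :: "'t \<Rightarrow> real"
  assumes "Bochner_Integration.simple_bochner_integrable M g"
  shows "g \<in> borel_measurable M"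
  using assms by (auto elim!: simple_bochner_integrable.cases intro: borel_measurable_simple_function)

text \<open>
  A strongly measurable \<open>f\<close> need not be Borel measurable, and the nonnegative integral is not
  additive on nonmeasurable functions. But the error \<open>\<parallel>f - s\<^sub>i\<parallel>\<close> is almost everywhere the limit of the
  measurable functions \<open>\<parallel>s\<^sub>j - s\<^sub>i\<parallel>\<close>, so it can be exchanged for a measurable function.
\<close>

lemma approximation_error_AE_measurable:
  fixes s :: "nat \<Rightarrow> 't \<Rightarrow> 'b :: real_normed_vector"
  assumes s: "\<And>i. Bochner_Integration.simple_bochner_integrable M (s i)"
    and lim: "AE t in M. (\<lambda>i. s i t) \<longlonglongrightarrow> f t"
  obtains h where "h \<in> borel_measurable M" "AE t in M. ennreal (norm (f t - s i t)) = h t"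
proof
  define h where "h = (\<lambda>t. liminf (\<lambda>j. ennreal (norm (s j t - s i t))))"
  have [measurable]: "(\<lambda>t. norm (s j t - s i t)) \<in> borel_measurable M" for j
    by (intro simple_bochner_integrable_measurable
        simple_bochner_integrable_compose2[where p = "\<lambda>x y. norm (x - y)"] s) simp
  show "h \<in> borel_measurable M" unfolding h_def by measurable
  show "AE t in M. ennreal (norm (f t - s i t)) = h t"
    using lim
  proof eventually_elim
    case (elim t)
    have "(\<lambda>j. ennreal (norm (s j t - s i t))) \<longlonglongrightarrow> ennreal (norm (f t - s i t))"
      by (intro tendsto_intros tendsto_ennrealI elim)
    thus ?case unfolding h_def by (intro lim_imp_Liminf[symmetric]) auto
  qed
qed

lemma has_bochner_Pair:
  fixes f :: "'t \<Rightarrow> 'b :: real_normed_vector" and g :: "'t \<Rightarrow> 'c :: real_normed_vector"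
  assumes "has_bochner M f I" "has_bochner M g K"
  shows "has_bochner M (\<lambda>t. (f t, g t)) (I, K)"
proof -
  obtain s where s: "\<And>i. Bochner_Integration.simple_bochner_integrable M (s i)"
      "AE t in M. (\<lambda>i. s i t) \<longlonglongrightarrow> f t"
      "(\<lambda>i. \<integral>\<^sup>+ t. ennreal (norm (f t - s i t)) \<partial>M) \<longlonglongrightarrow> 0"
      "(\<lambda>i. Bochner_Integration.simple_bochner_integral M (s i)) \<longlonglongrightarrow> I"
    using assms(1) unfolding has_bochner_def by blast
  obtain r where r: "\<And>i. Bochner_Integration.simple_bochner_integrable M (r i)"
      "AE t in M. (\<lambda>i. r i t) \<longlonglongrightarrow> g t"
      "(\<lambda>i. \<integral>\<^sup>+ t. ennreal (norm (g t - r i t)) \<partial>M) \<longlonglongrightarrow> 0"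
      "(\<lambda>i. Bochner_Integration.simple_bochner_integral M (r i)) \<longlonglongrightarrow> K"
    using assms(2) unfolding has_bochner_def by blast
  define p where "p = (\<lambda>i t. (s i t, r i t))"
  have p: "Bochner_Integration.simple_bochner_integrable M (p i)" for i
    unfolding p_def by (rule simple_bochner_integrable_compose2[OF _ s(1) r(1)]) (simp add: zero_prod_def)
  have "Bochner_Integration.simple_bochner_integral M (p i)
      = (Bochner_Integration.simple_bochner_integral M (s i), Bochner_Integration.simple_bochner_integral M (r i))" for i
    using simple_bochner_integral_linear[OF bounded_linear.linear[OF bounded_linear_fst] p[of i]]
      simple_bochner_integral_linear[OF bounded_linear.linear[OF bounded_linear_snd] p[of i]]
    by (simp add: p_def prod_eq_iff)
  hence "(\<lambda>i. Bochner_Integration.simple_bochner_integral M (p i)) \<longlonglongrightarrow> (I, K)"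
    by (simp add: tendsto_Pair s(4) r(4))
  moreover have "AE t in M. (\<lambda>i. p i t) \<longlonglongrightarrow> (f t, g t)"
    using s(2) r(2) unfolding p_def by eventually_elim (rule tendsto_Pair)
  moreover have "(\<lambda>i. \<integral>\<^sup>+ t. ennreal (norm ((f t, g t) - p i t)) \<partial>M) \<longlonglongrightarrow> 0"
  proof (rule tendsto_sandwich[OF _ _ tendsto_const])
    have "(\<integral>\<^sup>+ t. ennreal (norm ((f t, g t) - p i t)) \<partial>M)
        \<le> (\<integral>\<^sup>+ t. ennreal (norm (f t - s i t)) \<partial>M) + (\<integral>\<^sup>+ t. ennreal (norm (g t - r i t)) \<partial>M)" for i
    proof -
      obtain h where h: "h \<in> borel_measurable M" "AE t in M. ennreal (norm (f t - s i t)) = h t"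
        using approximation_error_AE_measurable[OF s(1,2)] .
      obtain k where k: "k \<in> borel_measurable M" "AE t in M. ennreal (norm (g t - r i t)) = k t"
        using approximation_error_AE_measurable[OF r(1,2)] .
      have "AE t in M. ennreal (norm ((f t, g t) - p i t)) \<le> h t + k t"
        using h(2) k(2)
      proof eventually_elim
        case (elim t)
        have "ennreal (norm ((f t, g t) - p i t)) \<le> ennreal (norm (f t - s i t) + norm (g t - r i t))"
          unfolding p_def by (intro ennreal_leI) (simp add: norm_Pair_le)
        thus ?case by (simp add: elim[symmetric])
      qed
      hence "(\<integral>\<^sup>+ t. ennreal (norm ((f t, g t) - p i t)) \<partial>M) \<le> (\<integral>\<^sup>+ t. h t + k t \<partial>M)"
        by (rule nn_integral_mono_AE)
      also have "\<dots> = (\<integral>\<^sup>+ t. h t \<partial>M) + (\<integral>\<^sup>+ t. k t \<partial>M)" by (rule nn_integral_add[OF h(1) k(1)])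
      also have "\<dots> = (\<integral>\<^sup>+ t. ennreal (norm (f t - s i t)) \<partial>M) + (\<integral>\<^sup>+ t. ennreal (norm (g t - r i t)) \<partial>M)"
        using nn_integral_cong_AE[OF h(2)] nn_integral_cong_AE[OF k(2)] by simp
      finally show ?thesis .
    qed
    thus "\<forall>\<^sub>F i in sequentially. (\<integral>\<^sup>+ t. ennreal (norm ((f t, g t) - p i t)) \<partial>M)
        \<le> (\<integral>\<^sup>+ t. ennreal (norm (f t - s i t)) \<partial>M) + (\<integral>\<^sup>+ t. ennreal (norm (g t - r i t)) \<partial>M)"
      by simp
    show "(\<lambda>i. (\<integral>\<^sup>+ t. ennreal (norm (f t - s i t)) \<partial>M) + (\<integral>\<^sup>+ t. ennreal (norm (g t - r i t)) \<partial>M)) \<longlonglongrightarrow> 0"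
      using tendsto_add[OF s(3) r(3)] by simp
  qed simp
  ultimately show ?thesis using p unfolding has_bochner_def by blast
qed

lemma has_bochner_bounded_linear:
  fixes f :: "'t \<Rightarrow> 'b :: real_normed_vector" and T :: "'b \<Rightarrow> 'c :: real_normed_vector"
  assumes "has_bochner M f I" and T: "bounded_linear T"
  shows "has_bochner M (\<lambda>t. T (f t)) (T I)"
proof -
  obtain s where s: "\<And>i. Bochner_Integration.simple_bochner_integrable M (s i)"
      "AE t in M. (\<lambda>i. s i t) \<longlonglongrightarrow> f t"
      "(\<lambda>i. \<integral>\<^sup>+ t. ennreal (norm (f t - s i t)) \<partial>M) \<longlonglongrightarrow> 0"
      "(\<lambda>i. Bochner_Integration.simple_bochner_integral M (s i)) \<longlonglongrightarrow> I"
    using assms(1) unfolding has_bochner_def by blast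
  obtain K where K: "K > 0" "\<And>x. norm (T x) \<le> norm x * K"
    using bounded_linear.pos_bounded[OF T] by blast
  define p where "p = (\<lambda>i t. T (s i t))"
  have "Bochner_Integration.simple_bochner_integrable M (p i)" for i
    unfolding p_def using simple_bochner_integrable_compose2[of "\<lambda>x _. T x", OF _ s(1) s(1)]
    by (simp add: bounded_linear.linear[OF T] linear_0)
  moreover have "(\<lambda>i. Bochner_Integration.simple_bochner_integral M (p i)) \<longlonglongrightarrow> T I"
    unfolding p_def simple_bochner_integral_linear[OF bounded_linear.linear[OF T] s(1)]
    by (rule bounded_linear.tendsto[OF T s(4)])
  moreover have "AE t in M. (\<lambda>i. p i t) \<longlonglongrightarrow> T (f t)"
    using s(2) unfolding p_def by eventually_elim (rule bounded_linear.tendsto[OF T])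
  moreover have "(\<lambda>i. \<integral>\<^sup>+ t. ennreal (norm (T (f t) - p i t)) \<partial>M) \<longlonglongrightarrow> 0"
  proof (rule tendsto_sandwich[OF _ _ tendsto_const])
    have "(\<integral>\<^sup>+ t. ennreal (norm (T (f t) - p i t)) \<partial>M)
        \<le> ennreal K * (\<integral>\<^sup>+ t. ennreal (norm (f t - s i t)) \<partial>M)" for i
    proof -
      obtain h where h: "h \<in> borel_measurable M" "AE t in M. ennreal (norm (f t - s i t)) = h t"
        using approximation_error_AE_measurable[OF s(1,2)] .
      have "AE t in M. ennreal (norm (T (f t) - p i t)) \<le> ennreal K * h t"
        using h(2)
      proof eventually_elim
        case (elim t)
        have "norm (T (f t) - p i t) \<le> K * norm (f t - s i t)"
          using K(2)[of "f t - s i t"]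
          by (simp add: p_def linear_diff[OF bounded_linear.linear[OF T]] mult.commute)
        hence "ennreal (norm (T (f t) - p i t)) \<le> ennreal (K * norm (f t - s i t))"
          by (rule ennreal_leI)
        thus ?case using K(1) by (simp add: ennreal_mult elim[symmetric])
      qed
      hence "(\<integral>\<^sup>+ t. ennreal (norm (T (f t) - p i t)) \<partial>M) \<le> (\<integral>\<^sup>+ t. ennreal K * h t \<partial>M)"
        by (rule nn_integral_mono_AE)
      also have "\<dots> = ennreal K * (\<integral>\<^sup>+ t. h t \<partial>M)" by (rule nn_integral_cmult[OF h(1)])
      also have "(\<integral>\<^sup>+ t. h t \<partial>M) = (\<integral>\<^sup>+ t. ennreal (norm (f t - s i t)) \<partial>M)"
        using nn_integral_cong_AE[OF h(2)] by simp
      finally show ?thesis .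
    qed
    thus "\<forall>\<^sub>F i in sequentially. (\<integral>\<^sup>+ t. ennreal (norm (T (f t) - p i t)) \<partial>M)
        \<le> ennreal K * (\<integral>\<^sup>+ t. ennreal (norm (f t - s i t)) \<partial>M)"
      by simp
    show "(\<lambda>i. ennreal K * (\<integral>\<^sup>+ t. ennreal (norm (f t - s i t)) \<partial>M)) \<longlonglongrightarrow> 0"
      using ennreal_tendsto_cmult[OF _ s(3), of "ennreal K"] by simp
  qed simp
  ultimately show ?thesis unfolding has_bochner_def by blast
qed

lemma has_bochner_indicator:
  assumes E: "E \<in> sets M" and fin: "finite_measure M"
  shows "has_bochner M (indicator E :: 't \<Rightarrow> real) (measure M E)"
proof -
  interpret finite_measure M by (rule fin)
  have E': "E \<inter> space M = E" using sets.sets_into_space[OF E] by blast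
  have s: "Bochner_Integration.simple_bochner_integrable M (indicator E :: 't \<Rightarrow> real)"
    by (rule simple_bochner_integrable.intros) (use E in \<open>auto intro: simple_function_indicator\<close>)
  have "ennreal (Bochner_Integration.simple_bochner_integral M (indicator E)) = (\<integral>\<^sup>+ t. ennreal (indicator E t) \<partial>M)"
    by (rule simple_bochner_integral_eq_nn_integral[OF s]) simp
  also have "\<dots> = ennreal (measure M E)"
    using E by (simp add: emeasure_eq_measure ennreal_indicator)
  finally have "Bochner_Integration.simple_bochner_integral M (indicator E) = measure M E"
    by (subst (asm) ennreal_inj) (auto intro: simple_bochner_integral_nonneg)
  thus ?thesis using s unfolding has_bochner_def by (intro exI[of _ "\<lambda>_. indicator E"]) simp
qed

text \<open>
  Let \<open>s\<close> be a simple function close to \<open>f\<close>. On each level set of \<open>s\<close> there is a point \<open>t\<close> at which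
  \<open>\<parallel>f - s\<parallel>\<close> is close to its infimum on this set, hence at most about its mean. Replacing the value
  of \<open>s\<close> by \<open>f(t)\<close> costs no more than the integral of \<open>\<parallel>f - s\<parallel>\<close>.
\<close>

lemma has_bochner_riemann_sum:
  fixes f :: "'t \<Rightarrow> 'b :: real_normed_vector"
  assumes fin: "finite_measure M" and f: "has_bochner M f I" and e: "e > 0"
  obtains n :: nat and w :: "nat \<Rightarrow> real" and t :: "nat \<Rightarrow> 't"
  where "\<forall>k. 0 \<le> w k" "\<forall>k<n. t k \<in> space M" "norm ((\<Sum>k<n. w k *\<^sub>R f (t k)) - I) < e"
proof -
  interpret finite_measure M by (rule fin)
  obtain s where s: "\<And>i. Bochner_Integration.simple_bochner_integrable M (s i)"
      "(\<lambda>i. \<integral>\<^sup>+ t. ennreal (norm (f t - s i t)) \<partial>M) \<longlonglongrightarrow> 0"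
      "(\<lambda>i. Bochner_Integration.simple_bochner_integral M (s i)) \<longlonglongrightarrow> I"
    using f unfolding has_bochner_def by blast
  have "\<forall>\<^sub>F i in sequentially. (\<integral>\<^sup>+ t. ennreal (norm (f t - s i t)) \<partial>M) < ennreal (e / 4)"
    using e by (intro order_tendstoD[OF s(2)]) simp
  moreover have "\<forall>\<^sub>F i in sequentially. dist (Bochner_Integration.simple_bochner_integral M (s i)) I < e / 4"
    using e by (intro tendstoD[OF s(3)]) simp
  ultimately have "\<forall>\<^sub>F i in sequentially. (\<integral>\<^sup>+ t. ennreal (norm (f t - s i t)) \<partial>M) < ennreal (e / 4)
      \<and> dist (Bochner_Integration.simple_bochner_integral M (s i)) I < e / 4"
    by (rule eventually_conj)
  then obtain i where i: "(\<integral>\<^sup>+ t. ennreal (norm (f t - s i t)) \<partial>M) < ennreal (e / 4)"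
      "dist (Bochner_Integration.simple_bochner_integral M (s i)) I < e / 4"
    unfolding eventually_sequentially by blast
  define S where "S = s i"
  have simple: "simple_function M S"
    using s(1)[of i] by (auto simp: S_def elim: simple_bochner_integrable.cases)
  define V where "V = S ` space M"
  have V: "finite V" using simple by (simp add: V_def simple_function_def)
  define E where "E = (\<lambda>v. {x \<in> space M. S x = v})"
  have E: "E v \<in> sets M" for v
  proof -
    have "E v = S -` {v} \<inter> space M" by (auto simp: E_def)
    thus ?thesis using simple by (simp add: simple_functionD)
  qed
  define c where "c = (\<lambda>v. INF x\<in>E v. norm (f x - v))"
  have bdd: "bdd_below ((\<lambda>x. norm (f x - v)) ` E v)" for v
    by (rule bdd_belowI[of _ 0]) auto
  have ne: "E v \<noteq> {}" if "v \<in> V" for v using that by (auto simp: E_def V_def)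
  have c_nonneg: "0 \<le> c v" if "v \<in> V" for v
    unfolding c_def by (rule cINF_greatest[OF ne[OF that]]) simp
  define N where "N = measure M (space M) + 1"
  have N: "N > 0" unfolding N_def by (simp add: add_nonneg_pos)
  define d where "d = e / (4 * N)"
  have d: "d > 0" using e N by (simp add: d_def)
  have "\<exists>x\<in>E v. norm (f x - v) < c v + d" if "v \<in> V" for v
    using cINF_less_iff[OF ne[OF that] bdd[of v], of "c v + d"] d by (simp add: c_def)
  then obtain \<tau> where \<tau>: "\<And>v. v \<in> V \<Longrightarrow> \<tau> v \<in> E v" "\<And>v. v \<in> V \<Longrightarrow> norm (f (\<tau> v) - v) < c v + d"
    by metis
  have "ennreal (\<Sum>v\<in>V. c v * measure M (E v)) = (\<Sum>v\<in>V. ennreal (c v) * emeasure M (E v))"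
    using c_nonneg by (simp add: emeasure_eq_measure sum_ennreal[symmetric] ennreal_mult)
  also have "\<dots> = (\<Sum>v\<in>V. \<integral>\<^sup>+ x. ennreal (c v) * indicator (E v) x \<partial>M)"
    using E by (simp add: nn_integral_cmult_indicator)
  also have "\<dots> = (\<integral>\<^sup>+ x. (\<Sum>v\<in>V. ennreal (c v) * indicator (E v) x) \<partial>M)"
    using E by (intro nn_integral_sum[symmetric]) auto
  also have "\<dots> \<le> (\<integral>\<^sup>+ x. ennreal (norm (f x - S x)) \<partial>M)"
  proof (rule nn_integral_mono)
    fix x assume x: "x \<in> space M"
    have "(\<Sum>v\<in>V. ennreal (c v) * indicator (E v) x) = (\<Sum>v\<in>V. if v = S x then ennreal (c v) else 0)"
      using x by (intro sum.cong) (auto simp: E_def indicator_def)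
    also have "\<dots> = ennreal (c (S x))" using x V by (simp add: V_def)
    also have "\<dots> \<le> ennreal (norm (f x - S x))"
      unfolding c_def using x by (intro ennreal_leI cINF_lower[OF bdd]) (simp add: E_def)
    finally show "(\<Sum>v\<in>V. ennreal (c v) * indicator (E v) x) \<le> ennreal (norm (f x - S x))" .
  qed
  also have "\<dots> < ennreal (e / 4)" using i(1) by (simp add: S_def)
  finally have sum_c: "(\<Sum>v\<in>V. c v * measure M (E v)) < e / 4"
    using c_nonneg by (subst (asm) ennreal_less_iff) (auto intro!: sum_nonneg)
  have "(\<Sum>v\<in>V. measure M (E v)) = measure M (\<Union>v\<in>V. E v)"
    using V E by (intro finite_measure_finite_Union[symmetric]) (auto simp: disjoint_family_on_def E_def)
  also have "\<dots> \<le> measure M (space M)" by (rule bounded_measure)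
  finally have "d * (\<Sum>v\<in>V. measure M (E v)) \<le> d * measure M (space M)"
    using d by (intro mult_left_mono) auto
  also have "\<dots> \<le> d * N" using d by (intro mult_left_mono) (auto simp: N_def)
  also have "\<dots> = e / 4" using N by (simp add: d_def)
  finally have sum_d: "d * (\<Sum>v\<in>V. measure M (E v)) \<le> e / 4" .
  have "norm ((\<Sum>v\<in>V. measure M (E v) *\<^sub>R f (\<tau> v)) - Bochner_Integration.simple_bochner_integral M S)
      = norm (\<Sum>v\<in>V. measure M (E v) *\<^sub>R (f (\<tau> v) - v))"
    by (simp add: simple_bochner_integral_def V_def E_def scaleR_diff_right sum_subtractf)
  also have "\<dots> \<le> (\<Sum>v\<in>V. norm (measure M (E v) *\<^sub>R (f (\<tau> v) - v)))" by (rule norm_sum)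
  also have "\<dots> \<le> (\<Sum>v\<in>V. measure M (E v) * (c v + d))"
  proof (rule sum_mono)
    fix v assume "v \<in> V"
    hence "norm (f (\<tau> v) - v) \<le> c v + d" using \<tau>(2) by (simp add: less_imp_le)
    thus "norm (measure M (E v) *\<^sub>R (f (\<tau> v) - v)) \<le> measure M (E v) * (c v + d)"
      by (simp add: mult_left_mono)
  qed
  also have "\<dots> = (\<Sum>v\<in>V. c v * measure M (E v)) + d * (\<Sum>v\<in>V. measure M (E v))"
    by (simp add: sum_distrib_left algebra_simps flip: sum.distrib)
  also have "\<dots> < e / 2" using sum_c sum_d by simp
  finally have *: "norm ((\<Sum>v\<in>V. measure M (E v) *\<^sub>R f (\<tau> v)) - Bochner_Integration.simple_bochner_integral M S) < e / 2" .
  have "norm ((\<Sum>v\<in>V. measure M (E v) *\<^sub>R f (\<tau> v)) - I)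
      \<le> norm ((\<Sum>v\<in>V. measure M (E v) *\<^sub>R f (\<tau> v)) - Bochner_Integration.simple_bochner_integral M S)
        + norm (Bochner_Integration.simple_bochner_integral M S - I)"
    using norm_triangle_ineq[of "(\<Sum>v\<in>V. measure M (E v) *\<^sub>R f (\<tau> v))
        - Bochner_Integration.simple_bochner_integral M S" "Bochner_Integration.simple_bochner_integral M S - I"]
    by simp
  also have "\<dots> < e" using * i(2) e by (simp add: S_def dist_norm)
  finally have close: "norm ((\<Sum>v\<in>V. measure M (E v) *\<^sub>R f (\<tau> v)) - I) < e" .
  obtain b where b: "bij_betw b {..<card V} V"
    using ex_bij_betw_nat_finite[OF V] by (auto simp: atLeast0LessThan)
  show ?thesis
  proof (rule that[of "\<lambda>k. measure M (E (b k))" "card V" "\<lambda>k. \<tau> (b k)"])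
    show "\<forall>k<card V. \<tau> (b k) \<in> space M"
    proof (intro allI impI)
      fix k assume "k < card V"
      hence "b k \<in> V" using b by (auto simp: bij_betw_def)
      thus "\<tau> (b k) \<in> space M" using \<tau>(1) by (auto simp: E_def)
    qed
    have "(\<Sum>k<card V. measure M (E (b k)) *\<^sub>R f (\<tau> (b k))) = (\<Sum>v\<in>V. measure M (E v) *\<^sub>R f (\<tau> v))"
      by (rule sum.reindex_bij_betw[OF b])
    thus "norm ((\<Sum>k<card V. measure M (E (b k)) *\<^sub>R f (\<tau> (b k))) - I) < e"
      using close by simp
  qed simp
qed

text \<open>Riemann sums for the pair \<open>(f, f)\<close> are close to both integrals at once.\<close>

lemma has_bochner_unique:
  fixes f :: "'t \<Rightarrow> 'b :: real_normed_vector"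
  assumes fin: "finite_measure M" and "has_bochner M f I" "has_bochner M f K"
  shows "I = K"
proof -
  have "norm (I - K) \<le> e" if e: "e > 0" for e
  proof -
    obtain n :: nat and w :: "nat \<Rightarrow> real" and t :: "nat \<Rightarrow> 't"
      where *: "norm ((\<Sum>k<n. w k *\<^sub>R (f (t k), f (t k))) - (I, K)) < e / 2"
      by (rule has_bochner_riemann_sum[OF fin has_bochner_Pair[OF assms(2,3)] half_gt_zero[OF e]])
        (rule that)
    define \<sigma> where "\<sigma> = (\<Sum>k<n. w k *\<^sub>R f (t k))"
    have "(\<Sum>k<n. w k *\<^sub>R (f (t k), f (t k))) - (I, K) = (\<sigma> - I, \<sigma> - K)"
      by (simp add: \<sigma>_def prod_eq_iff fst_sum snd_sum)
    with * have "norm (\<sigma> - I, \<sigma> - K) < e / 2" by simp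
    hence "norm (\<sigma> - I) < e / 2" "norm (\<sigma> - K) < e / 2"
      using norm_fst_le[of "\<sigma> - I" "\<sigma> - K"] norm_snd_le[of "\<sigma> - K" "\<sigma> - I"] by linarith+
    moreover have "norm (I - K) \<le> norm (\<sigma> - K) + norm (\<sigma> - I)"
      using norm_triangle_ineq4[of "\<sigma> - K" "\<sigma> - I"] by simp
    ultimately show ?thesis by linarith
  qed
  hence "norm (I - K) \<le> 0" by (rule field_le_epsilon) simp
  thus ?thesis by simp
qed

lemma bochner_integral_has_bochner:
  assumes "finite_measure M" "bochner_integrable M f"
  shows "has_bochner M f (bochner_integral M f)"
proof -
  obtain I where I: "has_bochner M f I" using assms(2) by (auto simp: bochner_integrable_def)
  show ?thesis unfolding bochner_integral_def
    by (rule theI[of _ I]) (use I has_bochner_unique[OF assms(1)] in blast)+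
qed

text \<open>
  Riemann sums have nonnegative weights. Applied to pairs, this transfers relations between
  several integrands to their integrals.
\<close>

lemma bochner_integral_in_closed_cone:
  fixes f :: "'t \<Rightarrow> 'b :: real_normed_vector"
  assumes fin: "finite_measure M" and f: "has_bochner M f I" and C: "closed C"
    and zero: "0 \<in> C" and add: "\<And>x y. x \<in> C \<Longrightarrow> y \<in> C \<Longrightarrow> x + y \<in> C"
    and scale: "\<And>r x. 0 \<le> r \<Longrightarrow> x \<in> C \<Longrightarrow> r *\<^sub>R x \<in> C"
    and mem: "\<And>t. t \<in> space M \<Longrightarrow> f t \<in> C"
  shows "I \<in> C"
proof -
  have "\<exists>y\<in>C. dist y I < e" if e: "e > 0" for e
  proof -
    obtain n :: nat and w t where *: "\<forall>k. 0 \<le> w k" "\<forall>k<n. t k \<in> space M"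
        "norm ((\<Sum>k<n. w k *\<^sub>R f (t k)) - I) < e"
      by (rule has_bochner_riemann_sum[OF fin f e]) (erule (2) that)
    have "(\<Sum>k<m. w k *\<^sub>R f (t k)) \<in> C" if "m \<le> n" for m
      using that
    proof (induction m)
      case (Suc m)
      hence "w m *\<^sub>R f (t m) \<in> C" using *(1,2) by (intro scale mem) auto
      thus ?case using Suc by (simp add: add)
    qed (simp add: zero)
    from this[of n] *(3) show ?thesis by (intro bexI[of _ "\<Sum>k<n. w k *\<^sub>R f (t k)"]) (simp_all add: dist_norm)
  qed
  hence "I \<in> closure C" by (simp add: closure_approachable)
  thus ?thesis using C by simp
qed

text \<open>
  The lower bounds of the \<open>D t\<close> need not be bounded away from zero. But some set \<open>E\<close> on which they are
  at least a fixed \<open>c > 0\<close> has positive measure, and then \<open>c\<close> times this measure is a lower bound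
  of the integral.
\<close>

lemma bochner_integral_coercive:
  fixes D :: "'t :: t2_space \<Rightarrow> 'a :: complex_hilbert op"
  assumes fin: "finite_measure M" and sets: "sets M = sets borel" and nonzero: "emeasure M UNIV \<noteq> 0"
    and cont: "continuous_on UNIV D" and D: "has_bochner M D I"
    and coercive: "\<And>t. \<exists>e>0. \<forall>v. e * (norm v)\<^sup>2 \<le> inner (D t v) v"
  obtains e where "e > 0" "\<And>v. e * (norm v)\<^sup>2 \<le> inner (I v) v"
proof -
  interpret finite_measure M by (rule fin)
  have nonneg: "0 \<le> inner (D t v) v" for t v
  proof -
    obtain e where "e > 0" "\<forall>v. e * (norm v)\<^sup>2 \<le> inner (D t v) v" using coercive by blast
    thus ?thesis using order_trans[of 0 "e * (norm v)\<^sup>2"] by simp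
  qed
  \<comment> \<open>The closed sets \<open>E n\<close> exhaust the space, so one of them has positive measure.\<close>
  define E where "E = (\<lambda>n :: nat. {t. \<forall>v. inverse (real (Suc n)) * (norm v)\<^sup>2 \<le> inner (D t v) v})"
  have "closed (E n)" for n
    unfolding E_def by (intro closed_Collect_all closed_Collect_le continuous_intros cont)
  hence E: "E n \<in> sets M" for n by (simp add: sets)
  have "(\<Union>n. E n) = UNIV"
  proof -
    have "t \<in> (\<Union>n. E n)" for t
    proof -
      obtain e where e: "e > 0" "\<forall>v. e * (norm v)\<^sup>2 \<le> inner (D t v) v" using coercive by blast
      obtain n where n: "inverse (real (Suc n)) < e" using reals_Archimedean[OF e(1)] by blast
      have "inverse (real (Suc n)) * (norm v)\<^sup>2 \<le> inner (D t v) v" for v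
      proof -
        have "inverse (real (Suc n)) * (norm v)\<^sup>2 \<le> e * (norm v)\<^sup>2"
          using n by (intro mult_right_mono) auto
        thus ?thesis using e(2) by (meson order_trans)
      qed
      thus ?thesis by (auto simp: E_def)
    qed
    thus ?thesis by blast
  qed
  hence "\<exists>n. emeasure M (E n) \<noteq> 0"
    using nonzero emeasure_UN_eq_0[of M E] E by auto
  then obtain n where n: "emeasure M (E n) \<noteq> 0" by blast
  define c where "c = inverse (real (Suc n))"
  have c: "c > 0" by (simp add: c_def)
  define C where "C = {p :: 'a op \<times> real. \<forall>v. (c * snd p) * (norm v)\<^sup>2 \<le> inner (blinfun_apply (fst p) v) v}"
  have "(I, measure M (E n)) \<in> C"
  proof (rule bochner_integral_in_closed_cone[OF fin has_bochner_Pair[OF D has_bochner_indicator[OF E fin]]])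
    show "closed C"
      unfolding C_def by (intro closed_Collect_all closed_Collect_le continuous_intros)
    show "0 \<in> C" by (simp add: C_def)
    show "p + q \<in> C" if "p \<in> C" "q \<in> C" for p q
    proof -
      have "(c * snd p) * (norm v)\<^sup>2 \<le> inner (blinfun_apply (fst p) v) v" "(c * snd q) * (norm v)\<^sup>2 \<le> inner (blinfun_apply (fst q) v) v" for v
        using that by (auto simp: C_def)
      from add_mono[OF this] show ?thesis by (simp add: C_def inner_add_left algebra_simps)
    qed
    show "r *\<^sub>R p \<in> C" if "0 \<le> r" "p \<in> C" for r p
    proof -
      have "(c * snd p) * (norm v)\<^sup>2 \<le> inner (blinfun_apply (fst p) v) v" for v using that by (auto simp: C_def)
      from mult_left_mono[OF this that(1)] show ?thesis by (simp add: C_def ac_simps)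
    qed
    show "(D t, indicator (E n) t) \<in> C" for t
      using nonneg[of t] by (auto simp: C_def E_def c_def indicator_def)
  qed
  moreover have "c * measure M (E n) > 0"
    using n c by (simp add: emeasure_eq_measure zero_less_measure_iff)
  ultimately show ?thesis by (intro that[of "c * measure M (E n)"]) (auto simp: C_def)
qed

section \<open>The integral inequality\<close>

lemma self_adjoint_bochner_integral:
  fixes F :: "'t \<Rightarrow> 'a :: complex_hilbert op"
  assumes "finite_measure M" "has_bochner M F I" "\<And>t. self_adjoint (F t)"
  shows "self_adjoint I"
proof -
  have "closed {X :: 'a op. self_adjoint X}"
    unfolding closed_sequential_limits using self_adjoint_limit by blast
  hence "I \<in> {X. self_adjoint X}"
    using assms by (intro bochner_integral_in_closed_cone[OF assms(1,2)]) auto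
  thus ?thesis by simp
qed

lemma invertible_op_powr_half:
  assumes "strictly_positive_op R"
  shows "invertible_op (op_powr R (-1/2))"
  unfolding invertible_op_def
  using op_sqrt_simps[OF assms] self_adjoint_complex_linear[OF self_adjoint_op_powr[OF assms]]
  by (intro exI[of _ "op_powr R (1/2)"]) (simp add: blinfun_eq_iff)

lemma not_in_spectrum_relative_op:
  assumes L: "self_adjoint L" and R: "strictly_positive_op R"
    and bb: "bounded_below (L - x *\<^sub>R R)"
  shows "x \<notin> real_spectrum (relative_op L R)"
proof -
  let ?I = "op_powr R (-1/2)"
  have I: "bounded_below ?I"
    by (rule invertible_bounded_below[OF invertible_op_powr_half[OF R]])
  have "relative_op L R - x *\<^sub>R id_blinfun = ?I o\<^sub>L (L - x *\<^sub>R R) o\<^sub>L ?I"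
  proof (rule blinfun_eqI)
    fix v
    have "?I (R (?I v)) = v" using op_sqrt_apply[OF R] by metis
    thus "(relative_op L R - x *\<^sub>R id_blinfun) v = (?I o\<^sub>L (L - x *\<^sub>R R) o\<^sub>L ?I) v"
      by (simp add: blinfun.diff_right blinfun.scaleR_right)
  qed
  moreover have "bounded_below (?I o\<^sub>L (L - x *\<^sub>R R) o\<^sub>L ?I)"
    by (intro bounded_below_compose I bb)
  ultimately have "bounded_below (relative_op L R - x *\<^sub>R id_blinfun)" by (simp only:)
  thus ?thesis unfolding real_spectrum_iff[OF self_adjoint_relative_op[OF L R]] by blast
qed

text \<open>
  If \<open>x\<close> lies to the left of \<open>J\<close>, then every \<open>F t - x G t\<close> is coercive, hence so is its integral,
  and \<open>x\<close> is not in the spectrum of the relative operator of the integrals; the other side is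
  symmetric. Integrating only \<open>F t \<ge> m G t\<close> with \<open>m = inf J\<close> would not exclude an endpoint missing
  from \<open>J\<close>.
\<close>

lemma spectrum_relative_op_integral:
  fixes F G :: "'t :: t2_space \<Rightarrow> 'a :: complex_hilbert op"
  assumes fin: "finite_measure M" and sets: "sets M = sets borel" and nonzero: "emeasure M UNIV \<noteq> 0"
    and F: "continuous_on UNIV F" "\<And>t. self_adjoint (F t)" "has_bochner M F L"
    and G: "continuous_on UNIV G" "\<And>t. strictly_positive_op (G t)" "has_bochner M G R"
    and L: "self_adjoint L" and R: "strictly_positive_op R"
    and J: "is_interval J" and spec: "\<And>t. real_spectrum (relative_op (F t) (G t)) \<subseteq> J"
    and nontriv: "\<exists>v :: 'a. v \<noteq> 0"
  shows "real_spectrum (relative_op L R) \<subseteq> J"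
proof
  fix x assume x: "x \<in> real_spectrum (relative_op L R)"
  have FG: "has_bochner M (\<lambda>t. F t - x *\<^sub>R G t) (L - x *\<^sub>R R)"
    using has_bochner_bounded_linear[OF has_bochner_Pair[OF F(3) G(3)],
        of "\<lambda>p. fst p - x *\<^sub>R snd p"]
    by (simp add: bounded_linear_sub bounded_linear_fst bounded_linear_snd
        bounded_linear_compose[OF bounded_linear_scaleR_right])
  have GF: "has_bochner M (\<lambda>t. x *\<^sub>R G t - F t) (x *\<^sub>R R - L)"
    using has_bochner_bounded_linear[OF FG bounded_linear_minus[OF bounded_linear_ident]] by simp
  have enclosure: "\<exists>m\<in>J. \<exists>M\<in>J. \<forall>v. m * inner (G t v) v \<le> inner (F t v) v
      \<and> inner (F t v) v \<le> M * inner (G t v) v" for t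
  proof -
    have sa: "self_adjoint (relative_op (F t) (G t))"
      by (rule self_adjoint_relative_op[OF F(2) G(2)])
    obtain m M where mM: "m \<in> real_spectrum (relative_op (F t) (G t))"
        "M \<in> real_spectrum (relative_op (F t) (G t))"
        "real_spectrum (relative_op (F t) (G t)) \<subseteq> {m..M}"
      using spectral_enclosure[OF sa nontriv] .
    have "\<forall>v. m * (norm v)\<^sup>2 \<le> inner (relative_op (F t) (G t) v) v"
      using mM(3) by (intro allI inner_ge_of_real_spectrum[OF sa]) auto
    moreover have "\<forall>v. inner (relative_op (F t) (G t) v) v \<le> M * (norm v)\<^sup>2"
      using mM(3) by (intro allI inner_le_of_real_spectrum[OF sa]) auto
    ultimately have "\<forall>v. m * inner (G t v) v \<le> inner (F t v) v"
        "\<forall>v. inner (F t v) v \<le> M * inner (G t v) v"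
      unfolding relative_op_bounds_iff[OF G(2)] by blast+
    thus ?thesis using mM(1,2) spec by blast
  qed
  show "x \<in> J"
  proof (rule ccontr)
    assume "x \<notin> J"
    have "(\<forall>y\<in>J. x < y) \<or> (\<forall>y\<in>J. y < x)"
    proof (rule ccontr)
      assume "\<not> ?thesis"
      then obtain y z where "y \<in> J" "y \<le> x" "z \<in> J" "x \<le> z" by (auto simp: not_less)
      thus False using \<open>x \<notin> J\<close> mem_is_interval_1_I[OF J, of y z x] by blast
    qed
    hence "bounded_below (L - x *\<^sub>R R)"
    proof
      assume less: "\<forall>y\<in>J. x < y"
      have "\<exists>e>0. \<forall>v. e * (norm v)\<^sup>2 \<le> inner ((F t - x *\<^sub>R G t) v) v" for t
      proof -
        obtain m where m: "m \<in> J" "\<forall>v. m * inner (G t v) v \<le> inner (F t v) v"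
          using enclosure[of t] by blast
        obtain e where e: "e > 0" "\<And>v. e * (norm v)\<^sup>2 \<le> inner (G t v) v"
          using strictly_positive_coercive[OF G(2)[of t]] by blast
        have "(m - x) * e * (norm v)\<^sup>2 \<le> inner ((F t - x *\<^sub>R G t) v) v" for v
        proof -
          have "(m - x) * (e * (norm v)\<^sup>2) \<le> (m - x) * inner (G t v) v"
            using less m(1) e(2) by (intro mult_left_mono) (auto simp: less_imp_le)
          also have "\<dots> \<le> inner ((F t - x *\<^sub>R G t) v) v"
            using m(2) by (simp add: inner_diff_left left_diff_distrib)
          finally show ?thesis by (simp add: mult.assoc)
        qed
        moreover have "(m - x) * e > 0" using less m(1) e(1) by simp
        ultimately show ?thesis by blast
      qed
      moreover have "continuous_on UNIV (\<lambda>t. F t - x *\<^sub>R G t)"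
        by (intro continuous_intros F G)
      ultimately obtain e where "e > 0" "\<And>v. e * (norm v)\<^sup>2 \<le> inner ((L - x *\<^sub>R R) v) v"
        using bochner_integral_coercive[OF fin sets nonzero _ FG] by blast
      thus ?thesis by (rule coercive_bounded_below)
    next
      assume greater: "\<forall>y\<in>J. y < x"
      have "\<exists>e>0. \<forall>v. e * (norm v)\<^sup>2 \<le> inner ((x *\<^sub>R G t - F t) v) v" for t
      proof -
        obtain M where m: "M \<in> J" "\<forall>v. inner (F t v) v \<le> M * inner (G t v) v"
          using enclosure[of t] by blast
        obtain e where e: "e > 0" "\<And>v. e * (norm v)\<^sup>2 \<le> inner (G t v) v"
          using strictly_positive_coercive[OF G(2)[of t]] by blast
        have "(x - M) * e * (norm v)\<^sup>2 \<le> inner ((x *\<^sub>R G t - F t) v) v" for v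
        proof -
          have "(x - M) * (e * (norm v)\<^sup>2) \<le> (x - M) * inner (G t v) v"
            using greater m(1) e(2) by (intro mult_left_mono) (auto simp: less_imp_le)
          also have "\<dots> \<le> inner ((x *\<^sub>R G t - F t) v) v"
            using m(2) by (simp add: inner_diff_left left_diff_distrib)
          finally show ?thesis by (simp add: mult.assoc)
        qed
        moreover have "(x - M) * e > 0" using greater m(1) e(1) by simp
        ultimately show ?thesis by blast
      qed
      moreover have "continuous_on UNIV (\<lambda>t. x *\<^sub>R G t - F t)"
        by (intro continuous_intros F G)
      ultimately obtain e where "e > 0" "\<And>v. e * (norm v)\<^sup>2 \<le> inner ((x *\<^sub>R R - L) v) v"
        using bochner_integral_coercive[OF fin sets nonzero _ GF] by blast
      hence "bounded_below (x *\<^sub>R R - L)" by (rule coercive_bounded_below)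
      thus ?thesis by (simp add: bounded_below_def norm_minus_commute)
    qed
    thus False using x not_in_spectrum_relative_op[OF L R] by blast
  qed
qed

theorem theorem2p1:
  fixes \<mu> :: "('t :: t2_space) measure"
    and \<AA> :: "('h :: complex_hilbert) op set"
    and A\<^sub>t B\<^sub>t :: "'t \<Rightarrow> 'h op"
    and A B :: "'h op"
    and J :: "real set"
    and f :: "real \<Rightarrow> real"
  assumes "locally_compact_space (euclidean :: 't topology)"
    and "bounded_radon_measure \<mu>" and "emeasure \<mu> UNIV \<noteq> 0"
    and "unital_cstar_algebra \<AA>"
    and "continuous_on UNIV A\<^sub>t" and "\<And>t. A\<^sub>t t \<in> \<AA>" and "\<And>t. self_adjoint (A\<^sub>t t)"
    and "continuous_on UNIV B\<^sub>t" and "\<And>t. B\<^sub>t t \<in> \<AA>" and "\<And>t. strictly_positive_op (B\<^sub>t t)"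
    and "is_interval J"
    and "operator_convex_on TYPE('h ell2) J f"
    and "\<And>t. spectrum (op_powr (B\<^sub>t t) (-1/2) o\<^sub>L A\<^sub>t t o\<^sub>L op_powr (B\<^sub>t t) (-1/2)) \<subseteq> complex_of_real ` J"
    and "bochner_integrable \<mu> A\<^sub>t"
    and "bochner_integrable \<mu> B\<^sub>t"
    and "bochner_integrable \<mu> (\<lambda>t. perspective f (A\<^sub>t t) (B\<^sub>t t))"
    and "A = bochner_integral \<mu> A\<^sub>t"
    and "B = bochner_integral \<mu> B\<^sub>t"
  shows "perspective f A B \<le>\<^sub>o\<^sub>p f_divergence f \<mu> A\<^sub>t B\<^sub>t"
proof -
  define G where "G = (\<lambda>t. perspective f (A\<^sub>t t) (B\<^sub>t t))"
  define \<Theta> where "\<Theta> = f_divergence f \<mu> A\<^sub>t B\<^sub>t"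
  show ?thesis
  proof (cases "\<exists>v :: 'h. v \<noteq> 0")
    case False
    \<comment> \<open>On the zero space all spectra are empty, and \<open>J\<close> may be empty too.\<close>
    hence "f_divergence f \<mu> A\<^sub>t B\<^sub>t - perspective f A B = 0" by (rule blinfun_eq_of_trivial)
    thus ?thesis by (simp add: op_le_def positive_op_iff)
  next
    case nontriv: True
    have fin: "finite_measure \<mu>" and sets: "sets \<mu> = sets borel"
      using assms(2) by (auto simp: bounded_radon_measure_def)
    note J = assms(11) and conv = assms(12)
    have cont: "continuous_on J f" by (rule operator_convex_continuous[OF conv])
    have IA: "has_bochner \<mu> A\<^sub>t A" and IB: "has_bochner \<mu> B\<^sub>t B" and IG: "has_bochner \<mu> G \<Theta>"
      using bochner_integral_has_bochner[OF fin] assms(14-18)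
      by (simp_all add: \<Theta>_def f_divergence_def G_def)
    have spec: "real_spectrum (relative_op (A\<^sub>t t) (B\<^sub>t t)) \<subseteq> J" for t
      using assms(13)[of t] spectrum_subset_iff[OF self_adjoint_relative_op[OF assms(7,10)]] by blast
    have saG: "self_adjoint (G t)" for t
      unfolding G_def
      by (intro self_adjoint_perspective assms(7,10) continuous_on_subset[OF cont spec])
    have saA: "self_adjoint A" by (rule self_adjoint_bochner_integral[OF fin IA assms(7)])
    have saB: "self_adjoint B"
      by (rule self_adjoint_bochner_integral[OF fin IB strictly_positive_self_adjoint[OF assms(10)]])
    have sa\<Theta>: "self_adjoint \<Theta>" by (rule self_adjoint_bochner_integral[OF fin IG saG])
    obtain e where e: "e > 0" "\<And>v. e * (norm v)\<^sup>2 \<le> inner (B v) v"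
      using bochner_integral_coercive[OF fin sets assms(3) assms(8) IB
          strictly_positive_coercive[OF assms(10)]] by blast
    have spB: "strictly_positive_op B" by (rule coercive_strictly_positive[OF saB e])
    have specAB: "real_spectrum (relative_op A B) \<subseteq> J"
      by (rule spectrum_relative_op_integral[OF fin sets assms(3) assms(5,7) IA assms(8,10) IB
            saA spB J spec nontriv])

    \<comment> \<open>Riemann sums within \<open>e / 2\<close> of the integrals keep \<open>R j\<close> strictly positive.\<close>
    define \<delta> where "\<delta> = (\<lambda>j. min (e / 2) (inverse (real (Suc j))))"
    have \<delta>: "\<delta> j > 0" for j using e(1) by (simp add: \<delta>_def)
    define Q where "Q = (\<lambda>j (n :: nat) w t. (\<forall>k. 0 \<le> w k) \<and>
        norm ((\<Sum>k<n. w k *\<^sub>R (A\<^sub>t (t k), B\<^sub>t (t k), G (t k))) - (A, B, \<Theta>)) < \<delta> j)"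
    have "\<exists>n w t. Q j n w t" for j
      unfolding Q_def
      by (rule has_bochner_riemann_sum[OF fin has_bochner_Pair[OF IA has_bochner_Pair[OF IB IG]] \<delta>])
        (intro exI conjI)
    then obtain n w t where "\<And>j. Q j (n j) (w j) (t j)" by metis
    hence w: "\<And>j k. 0 \<le> w j k"
      and close: "\<And>j. norm ((\<Sum>k<n j. w j k *\<^sub>R (A\<^sub>t (t j k), B\<^sub>t (t j k), G (t j k))) - (A, B, \<Theta>)) < \<delta> j"
      by (simp_all add: Q_def)
    define L R S where "L = (\<lambda>j. \<Sum>k<n j. w j k *\<^sub>R A\<^sub>t (t j k))"
      and "R = (\<lambda>j. \<Sum>k<n j. w j k *\<^sub>R B\<^sub>t (t j k))" and "S = (\<lambda>j. \<Sum>k<n j. w j k *\<^sub>R G (t j k))"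
    have eq: "(\<Sum>k<n j. w j k *\<^sub>R (A\<^sub>t (t j k), B\<^sub>t (t j k), G (t j k))) = (L j, R j, S j)" for j
    proof -
      have "(\<Sum>k<m. w j k *\<^sub>R (A\<^sub>t (t j k), B\<^sub>t (t j k), G (t j k))) = (\<Sum>k<m. w j k *\<^sub>R A\<^sub>t (t j k),
          \<Sum>k<m. w j k *\<^sub>R B\<^sub>t (t j k), \<Sum>k<m. w j k *\<^sub>R G (t j k))" for m
        by (induction m) (simp_all add: zero_prod_def)
      thus ?thesis by (simp only: L_def R_def S_def)
    qed
    have lim: "(\<lambda>j. (L j, R j, S j)) \<longlonglongrightarrow> (A, B, \<Theta>)"
    proof (rule metric_LIMSEQ_I)
      fix r :: real assume "r > 0"
      then obtain N where N: "inverse (real (Suc N)) < r" using reals_Archimedean by blast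
      have "dist (L j, R j, S j) (A, B, \<Theta>) < r" if "j \<ge> N" for j
      proof -
        have "dist (L j, R j, S j) (A, B, \<Theta>) < inverse (real (Suc j))"
          using close[of j] unfolding eq dist_norm \<delta>_def by simp
        also have "\<dots> \<le> inverse (real (Suc N))" using that by (intro le_imp_inverse_le) auto
        finally show ?thesis using N by simp
      qed
      thus "\<exists>N. \<forall>j\<ge>N. dist (L j, R j, S j) (A, B, \<Theta>) < r" by blast
    qed
    have LRS: "L \<longlonglongrightarrow> A" "R \<longlonglongrightarrow> B" "S \<longlonglongrightarrow> \<Theta>"
      using tendsto_fst[OF lim] tendsto_fst[OF tendsto_snd[OF lim]] tendsto_snd[OF tendsto_snd[OF lim]]
      by simp_all
    have saL: "self_adjoint (L j)" for j
      unfolding L_def by (intro self_adjoint_sum self_adjoint_scaleR assms(7))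
    have spR: "strictly_positive_op (R j)" for j
    proof (rule coercive_strictly_positive)
      show "self_adjoint (R j)"
        unfolding R_def
        by (intro self_adjoint_sum self_adjoint_scaleR strictly_positive_self_adjoint assms(10))
      show "e / 2 > 0" using e(1) by simp
      fix v
      have "norm (R j - B) \<le> norm (R j - B, S j - \<Theta>)" by (rule norm_fst_le)
      also have "\<dots> \<le> norm ((L j, R j, S j) - (A, B, \<Theta>))"
        using norm_snd_le[of "(R j - B, S j - \<Theta>)" "L j - A"] by simp
      also have "\<dots> < e / 2" using close[of j] unfolding eq \<delta>_def by simp
      finally have "norm (R j - B) \<le> e / 2" by simp
      have "\<bar>inner ((R j - B) v) v\<bar> \<le> norm ((R j - B) v) * norm v" by (rule Cauchy_Schwarz_ineq2)
      also have "\<dots> \<le> (norm (R j - B) * norm v) * norm v" by (intro mult_right_mono norm_blinfun) auto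
      also have "\<dots> \<le> (e / 2 * norm v) * norm v"
        using \<open>norm (R j - B) \<le> e / 2\<close> by (intro mult_right_mono) auto
      finally have "\<bar>inner (R j v) v - inner (B v) v\<bar> \<le> e / 2 * (norm v)\<^sup>2"
        by (simp add: inner_diff_left power2_eq_square mult.assoc)
      moreover have "e * (norm v)\<^sup>2 = e / 2 * (norm v)\<^sup>2 + e / 2 * (norm v)\<^sup>2" by simp
      ultimately show "e / 2 * (norm v)\<^sup>2 \<le> inner (R j v) v" using e(2)[of v] by linarith
    qed
    have specLR: "real_spectrum (relative_op (L j) (R j)) \<subseteq> J" for j
      unfolding L_def R_def
      by (rule perspective_weighted_sum(1)[OF conv J nontriv]) (use assms(7,10) spec w spR in \<open>auto simp: R_def\<close>)
    have ineq: "inner (perspective f (L j) (R j) v) v \<le> inner (S j v) v" for j v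
    proof -
      have "inner (perspective f (L j) (R j) v) v
          \<le> (\<Sum>k<n j. w j k * inner (perspective f (A\<^sub>t (t j k)) (B\<^sub>t (t j k)) v) v)"
        unfolding L_def R_def
        by (rule perspective_weighted_sum(2)[OF conv J nontriv]) (use assms(7,10) spec w spR in \<open>auto simp: R_def\<close>)
      also have "\<dots> = inner (S j v) v" by (simp add: S_def G_def inner_sum_left)
      finally show ?thesis .
    qed
    have limP: "(\<lambda>j. perspective f (L j) (R j)) \<longlonglongrightarrow> perspective f A B"
      by (rule tendsto_perspective[OF saL LRS(1) spR LRS(2) spB specLR specAB cont J])
    have "inner (perspective f A B v) v \<le> inner (\<Theta> v) v" for v
    proof (rule LIMSEQ_le)
      show "(\<lambda>j. inner (perspective f (L j) (R j) v) v) \<longlonglongrightarrow> inner (perspective f A B v) v"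
        by (intro tendsto_intros limP)
      show "(\<lambda>j. inner (S j v) v) \<longlonglongrightarrow> inner (\<Theta> v) v" by (intro tendsto_intros LRS(3))
    qed (use ineq in blast)
    moreover have "self_adjoint (perspective f A B)"
      by (rule self_adjoint_perspective[OF saA spB continuous_on_subset[OF cont specAB]])
    ultimately have "positive_op (\<Theta> - perspective f A B)"
      using sa\<Theta> by (simp add: positive_op_iff inner_diff_left)
    thus ?thesis by (simp add: op_le_def \<Theta>_def)
  qed
qed

end
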